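(* Let $m_n\to\infty$ be positive integers, let $w_n:\mathcal{Z}\to\mathbb{R}^{m_n}$ be measurable functions with $\int w_n\,dQ=0$ and $\int|w_n|^2\,dQ<\infty$, let $W_n=\int w_nw_n^{\top}\,dQ$, and let $\hat w_n$ be an estimator of $w_n$ based on $Z_1,\dots,Z_n$. Suppose that the sequence $W_n$ is regular, that $$\frac1n\sum_{j=1}^n|\hat w_n(Z_j)-w_n(Z_j)|^2=o_p(m_n^{-1}),$$ that $\int|w_n|^4\,dQ=O(m_n^2)$, and that $m_n^4=o(n)$. Then the following hold. (i) If $\frac1n\sum_{j=1}^n\hat w_n(Z_j)=\frac1n\sum_{j=1}^nw_n(Z_j)+o_p(n^{-1/2})$, then $(-2\log\hat{\mathscr{R}}_n-m_n)/\sqrt{2m_n}$ is asymptotically standard normal. (ii) If there is a measurable function $\psi$ from $\mathcal{Z}$ into $\mathbb{R}^q$ satisfying $\int\psi\,dQ=0$ and $\int\psi\psi^{\top}\,dQ=I_q$ such that, with $A_n=\int w_n\psi^{\top}\,dQ$, one has $$\frac1n\sum_{j=1}^n\hat w_n(Z_j)=\frac1n\sum_{j=1}^n\big(w_n(Z_j)-A_n\psi(Z_j)\big)+o_p(n^{-1/2})\quad\text{and}\quad \operatorname{trace}(A_n^{\top}W_n^{-1}A_n)\to q,$$ then $(-2\log\hat{\mathscr{R}}_n-m_n+q)/\sqrt{2(m_n-q)}$ is asymptotically standard normal.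
   Context: $(\mathcal{Z},\mathscr{S})$ is a measurable space; $Z_1,\dots,Z_n$ are independent copies of a $\mathcal{Z}$-valued random variable $Z$ with distribution $Q$ (the same for all $n$). $|\cdot|$ is the Euclidean norm (for vectors, $o_p$ statements are in this norm) and $I_q$ is the $q\times q$ identity matrix ($q$ fixed). An estimator $\hat w_n$ of $w_n$ is an $\mathbb{R}^{m_n}$-valued function on $\mathcal{Z}$ depending on the observations $Z_1,\dots,Z_n$, such that $\hat w_n(Z_j)$ are random vectors. A sequence $W_n$ of $m_n\times m_n$ dispersion (covariance) matrices is regular if $0<\inf_n\inf_{|u|=1}u^{\top}W_nu\le\sup_n\sup_{|u|=1}u^{\top}W_nu<\infty$. With $\mathscr{P}_n=\{\pi\in[0,1]^n:\pi_1+\dots+\pi_n=1\}$, $$\hat{\mathscr{R}}_n=\sup\Big\{\prod_{j=1}^n n\pi_j:\ \pi\in\mathscr{P}_n,\ \frac1n\sum_{j=1}^n\pi_j\hat w_n(Z_j)=0\Big\},$$ with the supremum taken in $[0,\infty)$, so that $\sup\emptyset=0$ and $-2\log 0=+\infty$. *)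

theory Defs
  imports
    "HOL-Probability.Probability"
    "HOL-Library.Landau_Symbols"
    "Jordan_Normal_Form.Gauss_Jordan_Elimination"
begin

(* HOL-Analysis also has a type and a constant vec (vectors of type-indexed dimension), and its own
   inner product. Here the dimension grows with n, so vectors and matrices are those of
   Jordan_Normal_Form throughout. *)
hide_type (open) Finite_Cartesian_Product.vec
hide_const (open) Finite_Cartesian_Product.vec Inner_Product.inner
unbundle no vec_syntax and no inner_syntax

text \<open>Vectors and matrices of varying dimension\<close>

definition vnorm :: "real vec \<Rightarrow> real" where
  "vnorm v = sqrt (v \<bullet> v)"

(* the matrix u v^T *)
definition outer_prod :: "real vec \<Rightarrow> real vec \<Rightarrow> real mat" where
  "outer_prod u v = mat (dim_vec u) (dim_vec v) (\<lambda>(i, k). u $ i * v $ k)"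

definition mat_trace :: "real mat \<Rightarrow> real" where
  "mat_trace A = (\<Sum>i<dim_row A. A $$ (i, i))"

(* mat_inverse returns None on singular matrices, where mat_inv is unspecified; it is applied only
   to the members of a regular sequence, which are invertible. *)
definition mat_inv :: "real mat \<Rightarrow> real mat" where
  "mat_inv A = the (mat_inverse A)"

definition vmean :: "nat \<Rightarrow> nat \<Rightarrow> (nat \<Rightarrow> real vec) \<Rightarrow> real vec" where
  "vmean d n x = (1 / real n) \<cdot>\<^sub>v finsum_vec TYPE(real) d x {1..n}"

(* Borel measurable maps into R^d: the Borel sigma-algebra of R^d is generated by the coordinates. *)
definition random_vec :: "nat \<Rightarrow> 'a measure \<Rightarrow> ('a \<Rightarrow> real vec) \<Rightarrow> bool" where
  "random_vec d M X \<longleftrightarrow>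
     (\<forall>\<omega>\<in>space M. X \<omega> \<in> carrier_vec d) \<and> (\<forall>i<d. (\<lambda>\<omega>. X \<omega> $ i) \<in> borel_measurable M)"

(* Entrywise integrals. The Bochner integral of a non-integrable entry is 0 by convention; this is
   harmless where these are used: the w_n are assumed square integrable, and the requirement
   that psi psi^T integrate to the identity matrix makes each squared coordinate of psi have a
   nonzero integral and hence be integrable. *)
definition vec_integral :: "nat \<Rightarrow> 'a measure \<Rightarrow> ('a \<Rightarrow> real vec) \<Rightarrow> real vec" where
  "vec_integral d Q f = vec d (\<lambda>i. \<integral>z. f z $ i \<partial>Q)"

definition mat_integral :: "nat \<Rightarrow> nat \<Rightarrow> 'a measure \<Rightarrow> ('a \<Rightarrow> real mat) \<Rightarrow> real mat" where
  "mat_integral d e Q F = mat d e (\<lambda>(i, k). \<integral>z. F z $$ (i, k) \<partial>Q)"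

text \<open>Sequences are indexed by \<open>n \<ge> 1\<close>; their values at 0 are irrelevant.\<close>

(* The infima and suprema are taken in the extended reals, where they always exist. *)
definition regular_seq :: "(nat \<Rightarrow> nat) \<Rightarrow> (nat \<Rightarrow> real mat) \<Rightarrow> bool" where
  "regular_seq m W \<longleftrightarrow>
     0 < (INF n\<in>{1..}. INF u\<in>{u \<in> carrier_vec (m n). vnorm u = 1}. ereal (u \<bullet> (W n *\<^sub>v u))) \<and>
     (SUP n\<in>{1..}. SUP u\<in>{u \<in> carrier_vec (m n). vnorm u = 1}. ereal (u \<bullet> (W n *\<^sub>v u))) < \<infinity>"

(* X_n = o_p(r_n) for random variables X_n and positive rates r_n. *)
definition little_op :: "'a measure \<Rightarrow> (nat \<Rightarrow> 'a \<Rightarrow> real) \<Rightarrow> (nat \<Rightarrow> real) \<Rightarrow> bool" where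
  "little_op M X r \<longleftrightarrow>
     (\<forall>\<epsilon>>0. (\<lambda>n. measure M {\<omega> \<in> space M. \<bar>X n \<omega>\<bar> > \<epsilon> * r n}) \<longlonglongrightarrow> 0)"

(* The statistics may take the value +infinity, so the convergence in distribution is expressed
   through their distribution functions on the real line instead of through weak_conv_m. *)
definition asymp_std_normal :: "'a measure \<Rightarrow> (nat \<Rightarrow> 'a \<Rightarrow> ereal) \<Rightarrow> bool" where
  "asymp_std_normal M T \<longleftrightarrow>
     (\<forall>n\<ge>1. T n \<in> borel_measurable M) \<and>
     weak_conv (\<lambda>n x. measure M {\<omega> \<in> space M. T n \<omega> \<le> ereal x}) (cdf std_normal_distribution)"

text \<open>Samples, estimators and the empirical likelihood ratio\<close>

definition sample :: "(nat \<Rightarrow> 'a \<Rightarrow> 'z) \<Rightarrow> nat \<Rightarrow> 'a \<Rightarrow> nat \<Rightarrow> 'z" where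
  "sample Z n \<omega> = (\<lambda>j\<in>{1..n}. Z j \<omega>)"

(* h maps a sample of size n to a function from the sample space of Q into R^d; measurability is
   required only of its values at the observations. *)
definition is_estimator ::
  "'a measure \<Rightarrow> 'z measure \<Rightarrow> (nat \<Rightarrow> 'a \<Rightarrow> 'z) \<Rightarrow> nat \<Rightarrow> nat \<Rightarrow> ((nat \<Rightarrow> 'z) \<Rightarrow> 'z \<Rightarrow> real vec) \<Rightarrow> bool"
where
  "is_estimator M Q Z n d h \<longleftrightarrow>
     (\<forall>x \<in> {1..n} \<rightarrow>\<^sub>E space Q. \<forall>z\<in>space Q. h x z \<in> carrier_vec d) \<and>
     (\<forall>j\<in>{1..n}. random_vec d M (\<lambda>\<omega>. h (sample Z n \<omega>) (Z j \<omega>)))"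

definition prob_weights :: "nat \<Rightarrow> (nat \<Rightarrow> real) set" where
  "prob_weights n = {\<pi> \<in> {1..n} \<rightarrow>\<^sub>E {0..1}. (\<Sum>j=1..n. \<pi> j) = 1}"

(* The supremum is that of [0,\<infinity>): since the products are nonnegative, inserting 0 only has the
   effect that the supremum over an empty set of weights is 0. *)
definition el_ratio :: "nat \<Rightarrow> nat \<Rightarrow> (nat \<Rightarrow> real vec) \<Rightarrow> real" where
  "el_ratio d n x =
     Sup (insert 0 {(\<Prod>j=1..n. real n * \<pi> j) | \<pi>.
       \<pi> \<in> prob_weights n \<and> vmean d n (\<lambda>j. \<pi> j \<cdot>\<^sub>v x j) = 0\<^sub>v d})"

definition minus2_log :: "real \<Rightarrow> ereal" where
  "minus2_log r = (if r = 0 then \<infinity> else ereal (- 2 * ln r))"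

end

theory Submission
  imports Defs "Jordan_Normal_Form.Determinant"
begin

text \<open>
  Write \<open>x j\<close> for the estimated constraints at the observations, \<open>xm\<close> for their mean and \<open>S\<close> for
  their sample second moment matrix. For every \<open>u\<close> with all \<open>1 + u \<bullet> x j > 0\<close>, weak duality bounds the
  likelihood ratio above by the product of the \<open>1 / (1 + u \<bullet> x j)\<close>, and the weights
  \<open>(1 - u \<bullet> (x j - xm)) / n\<close> with \<open>(S - xm xm\<^sup>T) u = xm\<close> are feasible and bound it below. Third order
  expansion of the logarithm makes both bounds \<open>n xm\<^sup>T W\<^sup>-\<^sup>1 xm\<close> up to \<open>o(m\<^sup>1\<^sup>/\<^sup>2)\<close>; the exact multiplier is never
  needed. The cubic remainder is controlled by the fourth moment through
  \<open>\<Sum>\<bar>u \<bullet> w j\<bar>\<^sup>3 \<le> (\<Sum>(u \<bullet> w j)\<^sup>2 \<Sum>(u \<bullet> w j)\<^sup>4)\<^sup>1\<^sup>/\<^sup>2\<close>, which is where \<open>m\<^sup>4 = o(n)\<close> enters.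

  Replacing \<open>xm\<close> by the mean \<open>wm\<close> of the \<open>w (Z j)\<close> costs \<open>o(m\<^sup>1\<^sup>/\<^sup>2)\<close> in (i), and in (ii) as well: the
  contribution of \<open>\<psi>\<close> is \<open>O(1)\<close> in probability by Bessel's inequality. Both parts
  thus reduce to the asymptotic normality of \<open>(n wm\<^sup>T W\<^sup>-\<^sup>1 wm - m) / (2m)\<^sup>1\<^sup>/\<^sup>2\<close>. With
  \<open>T k = \<bar>W\<^sup>-\<^sup>1\<^sup>/\<^sup>2 \<Sum>(j \<le> k) w (Z j)\<bar>\<^sup>2 - k m\<close>, conditioning on the first \<open>k\<close> observations
  gives, up to summable errors, the recursion \<open>\<phi> (k + 1) = exp (- t\<^sup>2 k / n\<^sup>2) \<phi> k\<close> for
  the characteristic function \<open>\<phi> k\<close> of \<open>T k / (n (2m)\<^sup>1\<^sup>/\<^sup>2)\<close> at \<open>t\<close>, hence the limit \<open>exp (- t\<^sup>2 / 2)\<close>.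
\<close>

section \<open>Vectors as functions on an initial segment of the naturals\<close>

text \<open>The correction in (ii) has norm of order \<open>n powr (- 1 / 2)\<close> in probability,
  so pairing it with \<open>wm\<close> by Cauchy-Schwarz would cost the order \<open>sqrt m\<close>,
  exactly the scale of the limit. The cross term is therefore treated on its own: it splits into
  \<open>q\<close> products of two scalar sums over the sample, each of variance at most
  \<open>n\<close>; Bessel's inequality bounds the second variance. What remains is bounded and
  disappears because \<open>m\<close> grows. A stochastic order holds for each fixed tolerance only.
  A single sequence \<open>e n\<close> is made to tend to 0 so slowly that the exceptional events at
  tolerance \<open>e n\<close> still have vanishing probability. Outside them all is deterministic,
  with \<open>mu = sqrt m\<close> and \<open>h\<close> the fourth root of \<open>n\<close>: the rate
  of \<open>m\<close> reads \<open>mu ^ 2 \<le> e ^ 4 * h\<close>, its growth reads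
  \<open>1 \<le> e ^ 4 * mu\<close>, and every error must come out as a constant times
  \<open>e * mu\<close>. The recursion for the characteristic functions closes because the
  conditional variance of an increment of \<open>T k\<close> is, to leading order, four times the
  quadratic form itself, which concentrates around \<open>k * m\<close> since \<open>m\<close>
  grows.\<close>

declare One_nat_def [simp del]

text \<open>Vectors are functions on the naturals of which only the first \<open>d\<close>
  coordinates count; what lies beyond is arbitrary. The dimension can then vary with
  \<open>n\<close> without carrier conditions.\<close>

definition ip :: "nat \<Rightarrow> (nat \<Rightarrow> real) \<Rightarrow> (nat \<Rightarrow> real) \<Rightarrow> real" where
  "ip d u v = (\<Sum>i<d. u i * v i)"

definition nrm :: "nat \<Rightarrow> (nat \<Rightarrow> real) \<Rightarrow> real" where
  "nrm d u = sqrt (ip d u u)"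

definition mapp :: "nat \<Rightarrow> (nat \<Rightarrow> nat \<Rightarrow> real) \<Rightarrow> (nat \<Rightarrow> real) \<Rightarrow> nat \<Rightarrow> real" where
  "mapp d W u = (\<lambda>i. \<Sum>k<d. W i k * u k)"

lemma ip_add_left: "ip d (\<lambda>i. u i + v i) w = ip d u w + ip d v w"
  by (simp add: ip_def algebra_simps sum.distrib)
lemma ip_add_right: "ip d w (\<lambda>i. u i + v i) = ip d w u + ip d w v"
  by (simp add: ip_def algebra_simps sum.distrib)
lemma ip_diff_left: "ip d (\<lambda>i. u i - v i) w = ip d u w - ip d v w"
  by (simp add: ip_def algebra_simps sum_subtractf)
lemma ip_scale_right: "ip d w (\<lambda>i. c * u i) = c * ip d w u"
  by (simp add: ip_def algebra_simps sum_distrib_left)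
lemma ip_scale_left: "ip d (\<lambda>i. c * u i) w = c * ip d u w"
  by (simp add: ip_def algebra_simps sum_distrib_left)
lemma ip_commute: "ip d u v = ip d v u"
  by (simp add: ip_def mult.commute)
lemma ip_sum_right: "ip d w (\<lambda>i. \<Sum>j\<in>J. x j i) = (\<Sum>j\<in>J. ip d w (x j))"
  unfolding ip_def sum_distrib_left by (rule sum.swap)
lemma ip_cong: "(\<And>i. i < d \<Longrightarrow> u i = u' i) \<Longrightarrow> (\<And>i. i < d \<Longrightarrow> v i = v' i) \<Longrightarrow> ip d u v = ip d u' v'"
  by (simp add: ip_def)

lemma ip_self_nonneg [simp]: "0 \<le> ip d u u"
  by (simp add: ip_def sum_nonneg)

lemma nrm_sq: "(nrm d u)\<^sup>2 = ip d u u"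
  by (simp add: nrm_def)

lemma nrm_nonneg [simp]: "0 \<le> nrm d u"
  by (simp add: nrm_def)

lemma nrm_L2_set: "nrm d u = L2_set u {..<d}"
  by (simp add: nrm_def L2_set_def ip_def power2_eq_square)

lemma ip_Cauchy_Schwarz: "\<bar>ip d u v\<bar> \<le> nrm d u * nrm d v"
proof -
  have "\<bar>ip d u v\<bar> \<le> (\<Sum>i<d. \<bar>u i\<bar> * \<bar>v i\<bar>)"
    unfolding ip_def by (rule order_trans[OF sum_abs]) (simp add: abs_mult)
  also have "\<dots> \<le> nrm d u * nrm d v"
    unfolding nrm_L2_set by (rule L2_set_mult_ineq)
  finally show ?thesis .
qed

lemma nrm_triangle: "nrm d (\<lambda>i. u i + v i) \<le> nrm d u + nrm d v"
  unfolding nrm_L2_set by (rule L2_set_triangle_ineq)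

lemma ip_mapp_sym:
  assumes "\<And>i k. i < d \<Longrightarrow> k < d \<Longrightarrow> W i k = W k i"
  shows "ip d u (mapp d W v) = ip d v (mapp d W u)"
proof -
  have "ip d u (mapp d W v) = (\<Sum>i<d. \<Sum>k<d. u i * (W i k * v k))"
    by (simp add: ip_def mapp_def sum_distrib_left)
  also have "\<dots> = (\<Sum>k<d. \<Sum>i<d. u i * (W i k * v k))"
    by (rule sum.swap)
  also have "\<dots> = (\<Sum>k<d. \<Sum>i<d. v k * (W k i * u i))"
    by (intro sum.cong refl) (simp add: assms)
  also have "\<dots> = ip d v (mapp d W u)"
    by (simp add: ip_def mapp_def sum_distrib_left)
  finally show ?thesis .
qed

text \<open>A kernel vector would make the quadratic form vanish, so the determinant is nonzero. The
  inverse is symmetric because its transpose is again an inverse of the symmetric matrix. Applied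
  both to \<open>W n\<close> and to a sample covariance matrix.\<close>

lemma posdef_inverse_exists:
  fixes W :: "nat \<Rightarrow> nat \<Rightarrow> real"
  assumes sym: "\<And>i k. i < d \<Longrightarrow> k < d \<Longrightarrow> W i k = W k i"
    and pd: "\<And>u. 0 < nrm d u \<Longrightarrow> 0 < ip d u (mapp d W u)"
  shows "\<exists>P. (\<forall>i<d. \<forall>k<d. P i k = P k i)
    \<and> (\<forall>i<d. \<forall>k<d. (\<Sum>l<d. W i l * P l k) = (if i = k then 1 else 0))"
proof -
  define A where "A = mat d d (\<lambda>(i, k). W i k)"
  have A: "A \<in> carrier_mat d d" by (simp add: A_def)
  have "Determinant.det A \<noteq> 0"
  proof
    assume "Determinant.det A = 0"
    then obtain v where v: "v \<in> carrier_vec d" "v \<noteq> 0\<^sub>v d" "A *\<^sub>v v = 0\<^sub>v d"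
      using det_0_iff_vec_prod_zero[OF A] by auto
    define u where "u = (\<lambda>i. v $ i)"
    have "mapp d W u i = 0" if "i < d" for i
    proof -
      have "mapp d W u i = (A *\<^sub>v v) $ i"
        using that v(1) by (simp add: mapp_def A_def u_def scalar_prod_def atLeast0LessThan)
      then show ?thesis using v that by simp
    qed
    then have 0: "ip d u (mapp d W u) = 0" by (simp add: ip_def)
    obtain i where i: "i < d" "v $ i \<noteq> 0"
      using v by (metis carrier_vecD eq_vecI index_zero_vec(1,2))
    have "0 < (\<Sum>i<d. u i * u i)"
      by (rule sum_pos2[of _ i]) (use i in \<open>auto simp: u_def zero_less_mult_iff linorder_neq_iff\<close>)
    then have "0 < nrm d u" by (simp add: nrm_def ip_def)
    from pd[OF this] 0 show False by simp
  qed
  then have "A \<in> Units (ring_mat TYPE(real) d ())"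
    by (rule det_non_zero_imp_unit[OF A])
  then obtain B where "mat_inverse A = Some B"
    using mat_inverse(1)[OF A, where b="()"] by (cases "mat_inverse A") auto
  then have B: "A * B = 1\<^sub>m d" "B * A = 1\<^sub>m d" "B \<in> carrier_mat d d"
    using mat_inverse(2)[OF A] by auto
  have At: "transpose_mat A = A" using sym by (intro eq_matI) (auto simp: A_def)
  have "transpose_mat B * A = transpose_mat (A * B)"
    using transpose_mult[OF A B(3)] At by simp
  then have BtA: "transpose_mat B * A = 1\<^sub>m d" using B(1) by simp
  have "transpose_mat B = transpose_mat B * (A * B)" using B by simp
  also have "\<dots> = (transpose_mat B * A) * B" using A B(3) by (simp add: assoc_mult_mat[of _ d d _ d _ d])
  also have "\<dots> = B" using BtA B(3) by simp
  finally have Bt: "transpose_mat B = B" .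
  show ?thesis
  proof (intro exI[of _ "\<lambda>i k. B $$ (i, k)"] conjI allI impI)
    fix i k assume ik: "i < d" "k < d"
    show "B $$ (i, k) = B $$ (k, i)"
      using ik B(3) arg_cong[OF Bt, of "\<lambda>C. C $$ (i, k)"] by simp
    have "(\<Sum>l<d. W i l * B $$ (l, k)) = (A * B) $$ (i, k)"
      using ik B(3) by (simp add: A_def scalar_prod_def atLeast0LessThan)
    then show "(\<Sum>l<d. W i l * B $$ (l, k)) = (if i = k then 1 else 0)"
      using ik B(1) by simp
  qed
qed

lemma mapp_inverse:
  assumes "\<And>i k. i < d \<Longrightarrow> k < d \<Longrightarrow> (\<Sum>l<d. W i l * P l k) = (if i = k then 1 else 0)" "i < d"
  shows "mapp d W (mapp d P v) i = v i"
proof -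
  have "mapp d W (mapp d P v) i = (\<Sum>l<d. \<Sum>k<d. W i l * P l k * v k)"
    by (simp add: mapp_def sum_distrib_left mult.assoc)
  also have "\<dots> = (\<Sum>k<d. (\<Sum>l<d. W i l * P l k) * v k)"
    unfolding sum_distrib_right by (rule sum.swap)
  also have "\<dots> = (\<Sum>k<d. if k = i then v k else 0)"
    by (intro sum.cong refl) (simp add: assms)
  finally show ?thesis using assms(2) by simp
qed

section \<open>Third order expansion of the logarithm, weak duality and feasible weights\<close>

lemma ln_one_plus_third_order:
  fixes y :: real
  assumes "\<bar>y\<bar> \<le> 1/2"
  shows "\<bar>ln (1 + y) - y + y\<^sup>2 / 2\<bar> \<le> \<bar>y\<bar> ^ 3"
proof -
  define g where "g = (\<lambda>y::real. ln (1 + y) - y + y\<^sup>2 / 2)"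
  have der: "(g has_real_derivative z\<^sup>2 / (1 + z)) (at z)" if "-1 < z" for z
    unfolding g_def using that
    by (auto intro!: derivative_eq_intros simp: field_simps power2_eq_square)
  have g0: "g 0 = 0" by (simp add: g_def)
  consider "y = 0" | "0 < y" | "y < 0" by linarith
  then have "\<bar>g y\<bar> \<le> \<bar>y\<bar> ^ 3"
  proof cases
    case 1 then show ?thesis using g0 by simp
  next
    case 2
    then obtain z where z: "0 < z" "z < y" "g y - g 0 = (y - 0) * (z\<^sup>2 / (1 + z))"
      using MVT2[of 0 y g "\<lambda>z. z\<^sup>2 / (1 + z)"] der by auto
    have "z\<^sup>2 / (1 + z) \<le> z\<^sup>2" using z by (simp add: field_simps power2_eq_square)
    also have "\<dots> \<le> y\<^sup>2" using z by (intro power_mono) auto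
    finally have "y * (z\<^sup>2 / (1 + z)) \<le> y * y\<^sup>2" using 2 by (intro mult_left_mono) auto
    then have "g y \<le> y * y\<^sup>2" using z(3) g0 by simp
    moreover have "0 \<le> g y" using z 2 g0 by simp
    ultimately show ?thesis using 2 by (simp add: power3_eq_cube power2_eq_square)
  next
    case 3
    then obtain z where z: "y < z" "z < 0" "g 0 - g y = (0 - y) * (z\<^sup>2 / (1 + z))"
      using MVT2[of y 0 g "\<lambda>z. z\<^sup>2 / (1 + z)"] der assms by force
    have "0 \<le> g 0 - g y"
      unfolding z(3) using z assms by (intro mult_nonneg_nonneg divide_nonneg_nonneg) auto
    moreover have "g 0 - g y \<le> \<bar>y\<bar> ^ 3"
    proof -
      \<comment> \<open>The mean value theorem for \<open>g\<close> alone would only give the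
        constant 2. Subtracting \<open>2 * y ^ 3 / 3\<close> amounts to integrating the bound
        \<open>2 * z ^ 2\<close> for the derivative and brings the constant below 1.\<close>
      define h where "h = (\<lambda>y::real. g y - 2 * y ^ 3 / 3)"
      have derh: "(h has_real_derivative z\<^sup>2 / (1 + z) - 2 * z\<^sup>2) (at z)" if "-1 < z" for z
        unfolding h_def using der[OF that]
        by (auto intro!: derivative_eq_intros)
      obtain z where z: "y < z" "z < 0" "h 0 - h y = (0 - y) * (z\<^sup>2 / (1 + z) - 2 * z\<^sup>2)"
        using MVT2[of y 0 h "\<lambda>z. z\<^sup>2 / (1 + z) - 2 * z\<^sup>2"] derh assms 3 by force
      have "z\<^sup>2 / (1 + z) \<le> z\<^sup>2 / (1/2)" using z assms by (intro divide_left_mono) auto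
      then have "h 0 - h y \<le> 0" unfolding z(3) using 3 by (intro mult_nonneg_nonpos) auto
      then have "g 0 - g y \<le> - 2 * y ^ 3 / 3" by (simp add: h_def)
      also have "\<dots> \<le> - (y ^ 3)" using 3 by (simp add: power_less_zero_eq_numeral)
      also have "\<dots> = \<bar>y\<bar> ^ 3" using 3 by simp
      finally show ?thesis .
    qed
    ultimately show ?thesis using g0 by simp
  qed
  then show ?thesis by (simp add: g_def)
qed

text \<open>The inequality \<open>a \<le> exp (a - 1)\<close> is applied to each factor
  \<open>n * p j * (1 + y j)\<close>; the two constraints make the exponents add up to 0. The case
  \<open>y = 0\<close> bounds every product of weights by 1.\<close>

lemma el_weight_bound:
  assumes "\<And>j. j \<in> {1..n} \<Longrightarrow> 0 \<le> p j" "(\<Sum>j=1..n. p j) = 1"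
    and "(\<Sum>j=1..n. p j * y j) = (0::real)" and y: "\<And>j. j \<in> {1..n} \<Longrightarrow> 0 < 1 + y j"
  shows "(\<Prod>j=1..n. real n * p j) * (\<Prod>j=1..n. 1 + y j) \<le> 1"
proof -
  have "(\<Prod>j=1..n. real n * p j) * (\<Prod>j=1..n. 1 + y j) = (\<Prod>j=1..n. real n * p j * (1 + y j))"
    by (simp add: prod.distrib)
  also have "\<dots> \<le> (\<Prod>j=1..n. exp (real n * p j * (1 + y j) - 1))"
  proof (rule prod_mono)
    fix j assume j: "j \<in> {1..n}"
    have "0 \<le> real n * p j * (1 + y j)" using assms(1)[OF j] y[OF j] by simp
    moreover have "real n * p j * (1 + y j) \<le> exp (real n * p j * (1 + y j) - 1)"
      using exp_ge_add_one_self[of "real n * p j * (1 + y j) - 1"] by simp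
    ultimately show "0 \<le> real n * p j * (1 + y j) \<and>
        real n * p j * (1 + y j) \<le> exp (real n * p j * (1 + y j) - 1)" by simp
  qed
  also have "\<dots> = exp (\<Sum>j=1..n. real n * p j * (1 + y j) - 1)"
    by (simp add: exp_sum)
  also have "(\<Sum>j=1..n. real n * p j * (1 + y j) - 1)
      = real n * ((\<Sum>j=1..n. p j) + (\<Sum>j=1..n. p j * y j)) - real n"
    by (simp add: sum_subtractf sum.distrib sum_distrib_left algebra_simps)
  also have "\<dots> = 0" using assms by simp
  finally show ?thesis by simp
qed

text \<open>\<open>el_ratio\<close> in coordinates. The factor \<open>1 / n\<close> of
  \<open>vmean\<close> is dropped, which leaves the constraint unchanged for
  \<open>n \<ge> 1\<close>.\<close>

definition elr :: "nat \<Rightarrow> nat \<Rightarrow> (nat \<Rightarrow> nat \<Rightarrow> real) \<Rightarrow> real" where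
  "elr d n x = Sup (insert 0 {(\<Prod>j=1..n. real n * p j) | p.
     p \<in> prob_weights n \<and> (\<forall>i<d. (\<Sum>j=1..n. p j * x j i) = 0)})"

text \<open>Exchanging the sums merges the \<open>d\<close> constraints into the single one required
  by \<open>el_weight_bound\<close>, with \<open>y j\<close> the inner product of \<open>u\<close>
  and \<open>x j\<close>. The multiplier \<open>u\<close> need not be optimal.\<close>

lemma elr_le:
  assumes "\<And>j. j \<in> {1..n} \<Longrightarrow> 0 < 1 + ip d u (x j)"
  shows "elr d n x \<le> 1 / (\<Prod>j=1..n. 1 + ip d u (x j))"
  unfolding elr_def
proof (rule cSup_least)
  have pos: "0 < (\<Prod>j=1..n. 1 + ip d u (x j))" by (rule prod_pos) (use assms in auto)
  fix r assume "r \<in> insert 0 {(\<Prod>j=1..n. real n * p j) | p.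
     p \<in> prob_weights n \<and> (\<forall>i<d. (\<Sum>j=1..n. p j * x j i) = 0)}"
  then show "r \<le> 1 / (\<Prod>j=1..n. 1 + ip d u (x j))"
  proof safe
    show "0 \<le> 1 / (\<Prod>j=1..n. 1 + ip d u (x j))" using pos by simp
  next
    fix p assume p: "p \<in> prob_weights n" "\<forall>i<d. (\<Sum>j=1..n. p j * x j i) = 0"
    have "(\<Sum>j=1..n. p j * ip d u (x j)) = (\<Sum>i<d. u i * (\<Sum>j=1..n. p j * x j i))"
      unfolding ip_def sum_distrib_left by (subst sum.swap) (simp add: algebra_simps)
    also have "\<dots> = 0" using p by simp
    finally have "(\<Prod>j=1..n. real n * p j) * (\<Prod>j=1..n. 1 + ip d u (x j)) \<le> 1"
      using p assms by (intro el_weight_bound) (auto simp: prob_weights_def PiE_iff)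
    then show "(\<Prod>j=1..n. real n * p j) \<le> 1 / (\<Prod>j=1..n. 1 + ip d u (x j))"
      using pos by (simp add: field_simps)
  qed
qed simp

lemma elr_ge:
  assumes p: "p \<in> prob_weights n" "\<And>i. i < d \<Longrightarrow> (\<Sum>j=1..n. p j * x j i) = 0"
  shows "(\<Prod>j=1..n. real n * p j) \<le> elr d n x"
  unfolding elr_def
proof (rule cSup_upper)
  show "bdd_above (insert 0 {(\<Prod>j=1..n. real n * p j) | p.
     p \<in> prob_weights n \<and> (\<forall>i<d. (\<Sum>j=1..n. p j * x j i) = 0)})"
  proof (rule bdd_aboveI[of _ 1], safe)
    fix p assume "p \<in> prob_weights n"
    then show "(\<Prod>j=1..n. real n * p j) \<le> 1"
      using el_weight_bound[of n p "\<lambda>_. 0"] by (auto simp: prob_weights_def PiE_iff)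
  qed simp
qed (use p in auto)

section \<open>Expansion of the empirical log-likelihood ratio\<close>

text \<open>A deterministic statement about one sample. \<open>kap\<close> measures the distance of
  the sample second moments from \<open>W\<close>, \<open>tau\<close> the size of the cubic sums,
  and \<open>rho\<close> bounds both multipliers: \<open>z\<close>, from the inverse of
  \<open>W\<close>, in the dual bound, and \<open>y\<close>, from the inverse of the sample
  covariance, in the feasible weights. Condition \<open>max\<close> keeps all arguments of the
  logarithm within 1/2 of 1.\<close>

lemma el_expansion:
  fixes x :: "nat \<Rightarrow> nat \<Rightarrow> real" and W P :: "nat \<Rightarrow> nat \<Rightarrow> real"
  assumes xm: "\<And>i. xm i = (\<Sum>j=1..n. x j i) / real n"
  and n: "n \<ge> 1" and lam: "lam > 0"
  and symW: "\<And>i k. i < d \<Longrightarrow> k < d \<Longrightarrow> W i k = W k i"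
  and inv: "\<And>i k. i < d \<Longrightarrow> k < d \<Longrightarrow> (\<Sum>l<d. W i l * P l k) = (if i = k then 1 else 0)"
  and pd: "\<And>u. lam * (nrm d u)\<^sup>2 \<le> ip d u (mapp d W u)"
  and kap: "\<And>u v. \<bar>(\<Sum>j=1..n. ip d u (x j) * ip d v (x j)) / real n - ip d u (mapp d W v)\<bar>
      \<le> kap * nrm d u * nrm d v"
  and small: "kap + (nrm d xm)\<^sup>2 \<le> lam / 2"
  and rho: "rho = 2 * nrm d xm / lam"
  and max: "\<And>j. j \<in> {1..n} \<Longrightarrow> rho * (nrm d (x j) + nrm d xm) \<le> 1 / 2"
  and cub: "\<And>u. (\<Sum>j=1..n. \<bar>ip d u (x j)\<bar> ^ 3) \<le> real n * tau * nrm d u ^ 3"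
  and kap0: "0 \<le> kap" and tau0: "0 \<le> tau"
  shows "0 < elr d n x"
    and "\<bar>- 2 * ln (elr d n x) - real n * ip d xm (mapp d P xm)\<bar>
      \<le> real n * rho\<^sup>2 * (kap + (nrm d xm)\<^sup>2) + 8 * real n * rho ^ 3 * (tau + nrm d xm ^ 3)"
proof -
  have cancel: "c * a \<le> b" if "c * a\<^sup>2 \<le> a * b" "0 \<le> a" "0 \<le> b" for a b c :: real
  proof (cases "a = 0")
    case False
    then have "a * (c * a) \<le> a * b" "0 < a" using that by (auto simp: power2_eq_square mult_ac)
    then show ?thesis by simp
  qed (use that in simp)
  have rho0: "0 \<le> rho" using lam by (simp add: rho)
  have ipm: "(\<Sum>j=1..n. ip d u (x j)) = real n * ip d u xm" for u
  proof -
    have "(\<Sum>j=1..n. ip d u (x j)) = ip d u (\<lambda>i. \<Sum>j=1..n. x j i)"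
      by (simp add: ip_sum_right)
    also have "\<dots> = ip d u (\<lambda>i. real n * xm i)" using n by (simp add: xm)
    finally show ?thesis by (simp add: ip_scale_right)
  qed
  define S where "S = (\<lambda>u v. (\<Sum>j=1..n. ip d u (x j) * ip d v (x j)) / real n)"
  have kap: "\<bar>S u v - ip d u (mapp d W v)\<bar> \<le> kap * nrm d u * nrm d v" for u v
    using kap[of u v] by (simp add: S_def)
  \<comment> \<open>The dual bound accepts any multiplier, so the population inverse can be used
    here and no sample matrix has to be inverted on this side.\<close>
  define z where "z = mapp d P xm"
  have Wz: "mapp d W z i = xm i" if "i < d" for i
    unfolding z_def by (rule mapp_inverse[OF inv that]) 
  have uWz: "ip d u (mapp d W z) = ip d u xm" for u
    by (rule ip_cong) (use Wz in auto)
  have nz: "nrm d z \<le> rho"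
  proof -
    have "lam * (nrm d z)\<^sup>2 \<le> nrm d z * nrm d xm"
      using pd[of z] ip_Cauchy_Schwarz[of d z xm] by (simp add: uWz)
    then have "lam * nrm d z \<le> nrm d xm"
      by (rule cancel) simp_all
    then have "nrm d z \<le> nrm d xm / lam" using lam by (simp add: field_simps)
    also have "\<dots> \<le> rho" using lam by (simp add: rho divide_right_mono)
    finally show ?thesis .
  qed
  have zx: "\<bar>ip d z (x j)\<bar> \<le> 1/2" if "j \<in> {1..n}" for j
  proof -
    have "\<bar>ip d z (x j)\<bar> \<le> rho * nrm d (x j)"
      using ip_Cauchy_Schwarz[of d z "x j"] mult_right_mono[OF nz, of "nrm d (x j)"] by simp
    also have "\<dots> \<le> 1/2" using max[OF that] mult_nonneg_nonneg[OF rho0 nrm_nonneg[of d xm]]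
      unfolding distrib_left by linarith
    finally show ?thesis .
  qed
  \<comment> \<open>With the centred \<open>t\<close> below, the weights
    \<open>(1 - t j) / n\<close> have total 1 for every \<open>y\<close>, and their constraint
    becomes \<open>Sc y = xm\<close>. Exact feasibility thus forces the inverse of the sample
    covariance in place of that of \<open>W\<close>.\<close>
  define Sc where "Sc = (\<lambda>i k. (\<Sum>j=1..n. x j i * x j k) / real n - xm i * xm k)"
  have Sc_form: "ip d u (mapp d Sc v) = S u v - ip d u xm * ip d v xm" for u v
  proof -
    have "mapp d Sc v i = (\<Sum>j=1..n. x j i * ip d v (x j)) / real n - xm i * ip d v xm" for i
    proof -
      have "mapp d Sc v i = (\<Sum>k<d. (\<Sum>j=1..n. x j i * x j k) / real n * v k) - (\<Sum>k<d. xm i * xm k * v k)"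
        by (simp add: mapp_def Sc_def left_diff_distrib sum_subtractf)
      also have "(\<Sum>k<d. (\<Sum>j=1..n. x j i * x j k) / real n * v k) = (\<Sum>k<d. \<Sum>j=1..n. x j i * (v k * x j k)) / real n"
        unfolding sum_divide_distrib sum_distrib_right by (intro sum.cong refl) simp
      also have "(\<Sum>k<d. \<Sum>j=1..n. x j i * (v k * x j k)) = (\<Sum>j=1..n. x j i * ip d v (x j))"
        by (subst sum.swap) (simp add: ip_def sum_distrib_left)
      also have "(\<Sum>k<d. xm i * xm k * v k) = xm i * ip d v xm"
        by (simp add: ip_def sum_distrib_left algebra_simps)
      finally show ?thesis .
    qed
    then have "ip d u (mapp d Sc v) =
        (\<Sum>i<d. u i * ((\<Sum>j=1..n. x j i * ip d v (x j)) / real n)) - (\<Sum>i<d. u i * (xm i * ip d v xm))"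
      by (simp add: ip_def[of d u] right_diff_distrib sum_subtractf)
    also have "(\<Sum>i<d. u i * ((\<Sum>j=1..n. x j i * ip d v (x j)) / real n)) = S u v"
    proof -
      have "(\<Sum>i<d. u i * ((\<Sum>j=1..n. x j i * ip d v (x j)) / real n))
          = (\<Sum>i<d. \<Sum>j=1..n. u i * x j i * ip d v (x j)) / real n"
        by (simp add: sum_divide_distrib sum_distrib_left mult.assoc)
      also have "(\<Sum>i<d. \<Sum>j=1..n. u i * x j i * ip d v (x j)) = (\<Sum>j=1..n. ip d u (x j) * ip d v (x j))"
        by (subst sum.swap) (simp add: ip_def[of d u] sum_distrib_right)
      finally show ?thesis by (simp add: S_def)
    qed
    also have "(\<Sum>i<d. u i * (xm i * ip d v xm)) = ip d u xm * ip d v xm"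
      by (simp add: ip_def[of d u] sum_distrib_right mult.assoc)
    finally show ?thesis .
  qed
  \<comment> \<open>Passing from \<open>W\<close> to \<open>Sc\<close> costs \<open>kap\<close> for
    the sampling error and the squared norm of \<open>xm\<close> for the centring;
    \<open>small\<close> grants half of \<open>lam\<close> for the two together.\<close>
  have Sc_pd: "lam / 2 * (nrm d u)\<^sup>2 \<le> ip d u (mapp d Sc u)" for u
  proof -
    have "ip d u xm * ip d u xm \<le> (nrm d u * nrm d xm)\<^sup>2"
      using power_mono[OF ip_Cauchy_Schwarz[of d u xm] abs_ge_zero, of 2] by (simp add: power2_eq_square)
    moreover have "S u u \<ge> ip d u (mapp d W u) - kap * (nrm d u)\<^sup>2"
      using kap[of u u] by (simp add: power2_eq_square abs_le_iff mult.assoc)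
    moreover have "(kap + (nrm d xm)\<^sup>2) * (nrm d u)\<^sup>2 \<le> lam / 2 * (nrm d u)\<^sup>2"
      by (rule mult_right_mono[OF small]) simp
    ultimately show ?thesis using pd[of u] unfolding Sc_form by (simp add: algebra_simps power_mult_distrib)
  qed
  have Sc_sym: "Sc i k = Sc k i" for i k by (simp add: Sc_def mult.commute)
  have Sc_pos: "0 < ip d u (mapp d Sc u)" if "0 < nrm d u" for u
  proof -
    have "0 < lam / 2 * (nrm d u)\<^sup>2" using that lam by simp
    then show ?thesis using Sc_pd[of u] by linarith
  qed
  obtain Pc where Pc: "\<And>i k. i < d \<Longrightarrow> k < d \<Longrightarrow> (\<Sum>l<d. Sc i l * Pc l k) = (if i = k then 1 else 0)"
    using posdef_inverse_exists[where d=d and W=Sc, OF Sc_sym Sc_pos] by blast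
  define y where "y = mapp d Pc xm"
  have "mapp d Sc y i = xm i" if "i < d" for i
    unfolding y_def by (rule mapp_inverse[OF Pc that])
  then have uScy: "ip d u (mapp d Sc y) = ip d u xm" for u
    by (intro ip_cong) auto
  \<comment> \<open>\<open>Sc\<close> retains only the lower bound \<open>lam / 2\<close>, whence
    the factor 2 in \<open>rho\<close>.\<close>
  have ny: "nrm d y \<le> rho"
  proof -
    have "lam / 2 * (nrm d y)\<^sup>2 \<le> nrm d y * nrm d xm"
      using Sc_pd[of y] ip_Cauchy_Schwarz[of d y xm] by (simp add: uScy)
    then have "lam / 2 * nrm d y \<le> nrm d xm"
      by (rule cancel) simp_all
    then show ?thesis using lam by (simp add: field_simps rho)
  qed
  define t where "t = (\<lambda>j. ip d y (x j) - ip d y xm)"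
  have tb: "\<bar>t j\<bar> \<le> 1/2" if "j \<in> {1..n}" for j
  proof -
    have "\<bar>t j\<bar> \<le> \<bar>ip d y (x j)\<bar> + \<bar>ip d y xm\<bar>" by (simp add: t_def)
    also have "\<dots> \<le> nrm d y * nrm d (x j) + nrm d y * nrm d xm"
      by (intro add_mono ip_Cauchy_Schwarz)
    also have "\<dots> \<le> rho * nrm d (x j) + rho * nrm d xm"
      by (intro add_mono mult_right_mono ny nrm_nonneg)
    also have "\<dots> \<le> 1/2" using max[OF that] by (simp add: distrib_left)
    finally show ?thesis .
  qed
  have sumt: "(\<Sum>j=1..n. t j) = 0"
    by (simp add: t_def sum_subtractf ipm)
  define p where "p = (\<lambda>j\<in>{1..n}. (1 - t j) / real n)"
  have p1: "p \<in> prob_weights n"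
  proof -
    have "(1 - t j) / real n \<in> {0..1}" if "j \<in> {1..n}" for j
    \<comment> \<open>The bound 1/2 for \<open>t j\<close> only makes a weight at most
      \<open>3 / (2 * n)\<close>, which is below 1 from \<open>n = 2\<close> on. For
      \<open>n = 1\<close> the centring forces \<open>t 1 = 0\<close>.\<close>
    proof (cases "n = 1")
      case True
      then have "t 1 = 0" using sumt by simp
      then show ?thesis using True that by simp
    next
      case False
      then have "real n \<ge> 2" using n by simp
      moreover have "- (1/2) \<le> t j" "t j \<le> 1/2" using tb[OF that] by (auto simp: abs_le_iff)
      ultimately show ?thesis by (simp add: field_simps)
    qed
    moreover have "(\<Sum>j=1..n. p j) = (\<Sum>j=1..n. 1 - t j) / real n"
      by (simp add: p_def sum_divide_distrib)
    then have "(\<Sum>j=1..n. p j) = 1" using n by (simp add: sum_subtractf sumt)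
    ultimately show ?thesis by (auto simp: prob_weights_def p_def PiE_iff)
  qed
  have p2: "(\<Sum>j=1..n. p j * x j i) = 0" if i: "i < d" for i
  proof -
    have ipi: "ip d (\<lambda>k. if k = i then 1 else 0) v = v i" for v
      using i by (simp add: ip_def if_distrib[of "\<lambda>a. a * _"] cong: if_cong)
    have "(\<Sum>j=1..n. p j * x j i) = (\<Sum>j=1..n. (x j i - (ip d y (x j) * x j i - ip d y xm * x j i))) / real n"
      unfolding p_def sum_divide_distrib by (intro sum.cong refl) (simp add: t_def field_simps)
    also have "\<dots> = xm i - ((\<Sum>j=1..n. ip d y (x j) * x j i) / real n - ip d y xm * xm i)"
      using n by (simp add: sum_subtractf xm sum_distrib_left[symmetric] diff_divide_distrib)
    also have "(\<Sum>j=1..n. ip d y (x j) * x j i) / real n - ip d y xm * xm i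
        = ip d (\<lambda>k. if k = i then 1 else 0) (mapp d Sc y)"
      unfolding Sc_form unfolding S_def ipi by (simp add: mult.commute)
    also have "\<dots> = ip d (\<lambda>k. if k = i then 1 else 0) xm" by (rule uScy)
    also have "\<dots> = xm i" by (rule ipi)
    finally show ?thesis by simp
  qed
  have ge: "(\<Prod>j=1..n. 1 - t j) \<le> elr d n x"
  proof -
    have "(\<Prod>j=1..n. 1 - t j) = (\<Prod>j=1..n. real n * p j)"
      using n by (intro prod.cong refl) (auto simp: p_def)
    then show ?thesis using elr_ge[OF p1 p2] by simp
  qed
  have tpos: "0 < 1 - t j" if "j \<in> {1..n}" for j using tb[OF that] by linarith
  have prodpos: "0 < (\<Prod>j=1..n. 1 - t j)" by (rule prod_pos) (use tpos in auto)
  show elpos: "0 < elr d n x" using ge prodpos by simp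
  have zpos: "0 < 1 + ip d z (x j)" if "j \<in> {1..n}" for j using zx[OF that] by linarith
  have "ln (elr d n x) \<le> ln (1 / (\<Prod>j=1..n. 1 + ip d z (x j)))"
    using elr_le[of n d z x] zpos elpos by (intro ln_mono) auto
  also have "\<dots> = - (\<Sum>j=1..n. ln (1 + ip d z (x j)))"
  proof -
    have ln_prod': "ln (\<Prod>j=1..n. 1 + ip d z (x j)) = (\<Sum>j=1..n. ln (1 + ip d z (x j)))"
      by (rule ln_prod) (use zpos in fastforce)+
    have "ln (1 / a) = - ln a" if "0 < a" for a :: real using that by (simp add: ln_div)
    moreover have "0 < (\<Prod>j=1..n. 1 + ip d z (x j))" by (rule prod_pos) (use zpos in auto)
    ultimately show ?thesis unfolding ln_prod'[symmetric] by blast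
  qed
  finally have low: "2 * (\<Sum>j=1..n. ln (1 + ip d z (x j))) \<le> - 2 * ln (elr d n x)" by simp
  have low1: "(\<Sum>j=1..n. ip d z (x j) - (ip d z (x j))\<^sup>2 / 2 - \<bar>ip d z (x j)\<bar> ^ 3) \<le> (\<Sum>j=1..n. ln (1 + ip d z (x j)))"
  proof (rule sum_mono)
    fix j assume "j \<in> {1..n}"
    from ln_one_plus_third_order[OF zx[OF this]]
    show "ip d z (x j) - (ip d z (x j))\<^sup>2 / 2 - \<bar>ip d z (x j)\<bar> ^ 3 \<le> ln (1 + ip d z (x j))" by linarith
  qed
  have low2: "(\<Sum>j=1..n. ip d z (x j) - (ip d z (x j))\<^sup>2 / 2 - \<bar>ip d z (x j)\<bar> ^ 3)
      = real n * ip d z xm - real n * S z z / 2 - (\<Sum>j=1..n. \<bar>ip d z (x j)\<bar> ^ 3)"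
    using n by (simp add: sum_subtractf ipm S_def power2_eq_square sum_divide_distrib[symmetric])
  have cubz: "(\<Sum>j=1..n. \<bar>ip d z (x j)\<bar> ^ 3) \<le> real n * tau * rho ^ 3"
    using cub[of z] power_mono[OF nz nrm_nonneg, of 3]
      mult_left_mono[of "nrm d z ^ 3" "rho ^ 3" "real n * tau"] tau0 by simp
  \<comment> \<open>Since \<open>W z = xm\<close>, the quadratic term \<open>S z z\<close> equals
    the inner product of \<open>z\<close> and \<open>xm\<close> up to \<open>kap\<close>. It cancels
    half of the linear term of the expansion, and the other half is the main term.\<close>
  have Szz: "S z z \<le> ip d z xm + kap * rho\<^sup>2"
  proof -
    have "S z z \<le> ip d z xm + kap * (nrm d z * nrm d z)"
      using kap[of z z] by (simp add: uWz)
    also have "kap * (nrm d z * nrm d z) \<le> kap * (rho * rho)"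
      by (intro mult_left_mono mult_mono nz kap0 rho0) auto
    finally show ?thesis by (simp add: power2_eq_square)
  qed
  have Szz': "real n * S z z \<le> real n * ip d z xm + real n * kap * rho\<^sup>2"
    using mult_left_mono[OF Szz, of "real n"] by (simp add: algebra_simps)
  have lower: "real n * ip d z xm - real n * kap * rho\<^sup>2 - 2 * real n * tau * rho ^ 3 \<le> - 2 * ln (elr d n x)"
    using low low1 low2 cubz Szz' by linarith
  have "- 2 * ln (elr d n x) \<le> - 2 * ln (\<Prod>j=1..n. 1 - t j)"
    using ge prodpos by (simp add: ln_mono)
  also have "ln (\<Prod>j=1..n. 1 - t j) = (\<Sum>j=1..n. ln (1 + - t j))"
    by (subst ln_prod) (use tpos in fastforce)+
  finally have up: "- 2 * ln (elr d n x) \<le> - 2 * (\<Sum>j=1..n. ln (1 + - t j))" .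
  have "(\<Sum>j=1..n. - t j - (t j)\<^sup>2 / 2 - \<bar>t j\<bar> ^ 3) \<le> (\<Sum>j=1..n. ln (1 + - t j))"
  proof (rule sum_mono)
    fix j assume "j \<in> {1..n}"
    then have "\<bar>- t j\<bar> \<le> 1/2" using tb by simp
    from ln_one_plus_third_order[OF this]
    show "- t j - (t j)\<^sup>2 / 2 - \<bar>t j\<bar> ^ 3 \<le> ln (1 + - t j)" by simp
  qed
  also have "(\<Sum>j=1..n. - t j - (t j)\<^sup>2 / 2 - \<bar>t j\<bar> ^ 3) = - (\<Sum>j=1..n. (t j)\<^sup>2) / 2 - (\<Sum>j=1..n. \<bar>t j\<bar> ^ 3)"
    by (simp add: sum_subtractf sum_negf sumt sum_divide_distrib[symmetric])
  finally have up2: "- 2 * ln (elr d n x) \<le> (\<Sum>j=1..n. (t j)\<^sup>2) + 2 * (\<Sum>j=1..n. \<bar>t j\<bar> ^ 3)"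
    using up by linarith
  \<comment> \<open>The linear term vanishes by \<open>sumt\<close>, and because
    \<open>Sc y = xm\<close> the quadratic term is exactly \<open>n\<close> times the inner product
    of \<open>y\<close> and \<open>xm\<close>; no error arises before the cubic term.\<close>
  have sumt2: "(\<Sum>j=1..n. (t j)\<^sup>2) = real n * ip d y xm"
  proof -
    have "(\<Sum>j=1..n. (t j)\<^sup>2) = (\<Sum>j=1..n. (ip d y (x j))\<^sup>2) - 2 * ip d y xm * (\<Sum>j=1..n. ip d y (x j)) + real n * (ip d y xm)\<^sup>2"
      by (simp add: t_def power2_diff sum_subtractf sum.distrib sum_distrib_left algebra_simps)
    also have "\<dots> = real n * ip d y (mapp d Sc y)"
      using n unfolding Sc_form S_def ipm by (simp add: power2_eq_square algebra_simps)
    finally show ?thesis by (simp add: uScy)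
  qed
  have yxm: "\<bar>ip d y xm\<bar> \<le> rho * nrm d xm"
    using ip_Cauchy_Schwarz[of d y xm] mult_right_mono[OF ny, of "nrm d xm"] by simp
  have zxm: "\<bar>ip d z xm\<bar> \<le> rho * nrm d xm"
    using ip_Cauchy_Schwarz[of d z xm] mult_right_mono[OF nz, of "nrm d xm"] by simp
  have sumt3: "(\<Sum>j=1..n. \<bar>t j\<bar> ^ 3) \<le> 4 * real n * rho ^ 3 * (tau + nrm d xm ^ 3)"
  proof -
    have cube: "(a + b) ^ 3 \<le> 4 * a ^ 3 + 4 * b ^ 3" if "0 \<le> a" "0 \<le> b" for a b :: real
    proof -
      have "0 \<le> 3 * (a + b) * (a - b)\<^sup>2" using that by simp
      then show ?thesis by (simp add: power2_eq_square power3_eq_cube algebra_simps)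
    qed
    have "(\<Sum>j=1..n. \<bar>t j\<bar> ^ 3) \<le> (\<Sum>j=1..n. 4 * \<bar>ip d y (x j)\<bar> ^ 3 + 4 * (rho * nrm d xm) ^ 3)"
    proof (rule sum_mono)
      fix j
      have "\<bar>t j\<bar> \<le> \<bar>ip d y (x j)\<bar> + rho * nrm d xm" using yxm by (simp add: t_def)
      then have "\<bar>t j\<bar> ^ 3 \<le> (\<bar>ip d y (x j)\<bar> + rho * nrm d xm) ^ 3" by (rule power_mono) simp
      also have "\<dots> \<le> 4 * \<bar>ip d y (x j)\<bar> ^ 3 + 4 * (rho * nrm d xm) ^ 3"
        by (rule cube) (use rho0 in auto)
      finally show "\<bar>t j\<bar> ^ 3 \<le> 4 * \<bar>ip d y (x j)\<bar> ^ 3 + 4 * (rho * nrm d xm) ^ 3" .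
    qed
    also have "\<dots> = 4 * (\<Sum>j=1..n. \<bar>ip d y (x j)\<bar> ^ 3) + 4 * real n * (rho * nrm d xm) ^ 3"
      by (simp add: sum.distrib sum_distrib_left)
    also have "(\<Sum>j=1..n. \<bar>ip d y (x j)\<bar> ^ 3) \<le> real n * tau * rho ^ 3"
      using cub[of y] power_mono[OF ny nrm_nonneg, of 3]
        mult_left_mono[of "nrm d y ^ 3" "rho ^ 3" "real n * tau"] tau0 by simp
    finally show ?thesis by (simp add: algebra_simps power_mult_distrib)
  qed
  \<comment> \<open>As \<open>xm\<close> is both \<open>W z\<close> and \<open>Sc y\<close>, the
    difference is the bilinear form of \<open>W - Sc\<close> at \<open>z\<close> and
    \<open>y\<close>. The error is therefore of second order in \<open>rho\<close>.\<close>
  have diff: "ip d y xm - ip d z xm \<le> rho\<^sup>2 * (kap + (nrm d xm)\<^sup>2)"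
  proof -
    have e1: "ip d y xm = ip d z (mapp d W y)"
      using ip_mapp_sym[of d W y z] symW uWz[of y] by simp
    have e2: "ip d z xm = S z y - ip d z xm * ip d y xm"
      using uScy[of z] Sc_form[of z y] by simp
    have "ip d y xm - ip d z xm = ip d z (mapp d W y) - S z y + ip d z xm * ip d y xm"
      using e1 e2 by linarith
    also have "\<dots> \<le> kap * nrm d z * nrm d y + \<bar>ip d z xm\<bar> * \<bar>ip d y xm\<bar>"
      using kap[of z y] abs_ge_self[of "ip d z xm * ip d y xm"] by (simp add: abs_mult)
    also have "\<dots> \<le> kap * rho * rho + (rho * nrm d xm) * (rho * nrm d xm)"
      using nz ny yxm zxm rho0 kap0 by (intro add_mono mult_mono) auto
    finally show ?thesis by (simp add: power2_eq_square algebra_simps)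
  qed
  have "- 2 * ln (elr d n x) \<le> real n * ip d y xm + 8 * real n * rho ^ 3 * (tau + nrm d xm ^ 3)"
    using up2 sumt2 sumt3 by linarith
  moreover have "real n * ip d y xm \<le> real n * ip d z xm + real n * (rho\<^sup>2 * (kap + (nrm d xm)\<^sup>2))"
    using mult_left_mono[OF diff, of "real n"] by (simp add: algebra_simps)
  ultimately have upper: "- 2 * ln (elr d n x) \<le> real n * ip d z xm + real n * rho\<^sup>2 * (kap + (nrm d xm)\<^sup>2) + 8 * real n * rho ^ 3 * (tau + nrm d xm ^ 3)"
    by (simp add: mult.assoc)
  have "real n * kap * rho\<^sup>2 \<le> real n * rho\<^sup>2 * (kap + (nrm d xm)\<^sup>2)"
    by (simp add: algebra_simps)
  moreover have "2 * real n * tau * rho ^ 3 \<le> 8 * real n * rho ^ 3 * (tau + nrm d xm ^ 3)"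
  proof -
    have "2 * (real n * rho ^ 3 * tau) \<le> 8 * (real n * rho ^ 3 * (tau + nrm d xm ^ 3))"
      using rho0 tau0 by (intro mult_mono) (auto intro!: mult_left_mono)
    then show ?thesis by (simp add: mult_ac)
  qed
  ultimately have lower': "real n * ip d z xm - (real n * rho\<^sup>2 * (kap + (nrm d xm)\<^sup>2) + 8 * real n * rho ^ 3 * (tau + nrm d xm ^ 3)) \<le> - 2 * ln (elr d n x)"
    using lower by linarith
  have abs_diff_leI: "\<bar>a - b\<bar> \<le> e + e'" if "a \<le> b + e + e'" "b - (e + e') \<le> a" for a b e e' :: real
    using that by linarith
  have "ip d xm (mapp d P xm) = ip d z xm" by (simp add: z_def ip_commute)
  then show "\<bar>- 2 * ln (elr d n x) - real n * ip d xm (mapp d P xm)\<bar>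
      \<le> real n * rho\<^sup>2 * (kap + (nrm d xm)\<^sup>2) + 8 * real n * rho ^ 3 * (tau + nrm d xm ^ 3)"
    using abs_diff_leI[OF upper lower'] by simp
qed

section \<open>From the true constraints to the estimated ones\<close>

lemma sum_Cauchy_Schwarz:
  fixes a b :: "'i \<Rightarrow> real"
  assumes "(\<Sum>j\<in>J. (a j)\<^sup>2) \<le> A\<^sup>2" "(\<Sum>j\<in>J. (b j)\<^sup>2) \<le> B\<^sup>2" "0 \<le> A" "0 \<le> B"
  shows "(\<Sum>j\<in>J. \<bar>a j\<bar> * \<bar>b j\<bar>) \<le> A * B"
proof -
  have "L2_set a J \<le> A" "L2_set b J \<le> B"
    using assms by (auto simp: L2_set_def intro: real_le_lsqrt sum_nonneg)
  then have "L2_set a J * L2_set b J \<le> A * B" by (intro mult_mono) (use assms in auto)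
  then show ?thesis using L2_set_mult_ineq[of a b J] by linarith
qed

text \<open>\<open>w\<close> stands for the true constraints, \<open>dl\<close> for the estimation
  errors and \<open>s\<close> for the root of their mean square. Expanding the product leaves two
  mixed sums and one pure error sum; Cauchy-Schwarz over the sample makes them \<open>L * s\<close>,
  twice, and \<open>s ^ 2\<close>.\<close>

lemma perturbed_quadratic_form:
  fixes w dl :: "nat \<Rightarrow> nat \<Rightarrow> real"
  assumes n: "n \<ge> 1"
    and kap: "\<And>u v. \<bar>(\<Sum>j=1..n. ip d u (w j) * ip d v (w j)) / real n - ip d u (mapp d W v)\<bar>
      \<le> kw * nrm d u * nrm d v"
    and ub: "\<And>u. ip d u (mapp d W u) \<le> Lam * (nrm d u)\<^sup>2"
    and L: "Lam + kw \<le> L\<^sup>2" "0 \<le> L"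
    and s: "(\<Sum>j=1..n. (nrm d (dl j))\<^sup>2) \<le> real n * s\<^sup>2" "0 \<le> s"
  shows "(\<Sum>j=1..n. (ip d u (w j))\<^sup>2) \<le> real n * L\<^sup>2 * (nrm d u)\<^sup>2" (is ?A)
    and "\<bar>(\<Sum>j=1..n. ip d u (\<lambda>i. w j i + dl j i) * ip d v (\<lambda>i. w j i + dl j i)) / real n - ip d u (mapp d W v)\<bar>
      \<le> (kw + 2 * L * s + s\<^sup>2) * nrm d u * nrm d v" (is ?B)
proof -
  have A: "(\<Sum>j=1..n. (ip d u (w j))\<^sup>2) \<le> real n * L\<^sup>2 * (nrm d u)\<^sup>2" for u
  proof -
    have "(\<Sum>j=1..n. ip d u (w j) * ip d u (w j)) / real n \<le> Lam * (nrm d u)\<^sup>2 + kw * (nrm d u)\<^sup>2"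
      using kap[of u u] ub[of u] by (simp add: abs_le_iff power2_eq_square mult.assoc)
    also have "\<dots> \<le> L\<^sup>2 * (nrm d u)\<^sup>2"
      using mult_right_mono[OF L(1), of "(nrm d u)\<^sup>2"] by (simp add: distrib_right)
    finally show ?thesis using n by (simp add: field_simps power2_eq_square)
  qed
  then show ?A .
  have A': "(\<Sum>j=1..n. (ip d u (w j))\<^sup>2) \<le> (sqrt n * L * nrm d u)\<^sup>2" for u
    using A[of u] by (simp add: power_mult_distrib)
  have D': "(\<Sum>j=1..n. (ip d u (dl j))\<^sup>2) \<le> (sqrt n * s * nrm d u)\<^sup>2" for u
  proof -
    have "(\<Sum>j=1..n. (ip d u (dl j))\<^sup>2) \<le> (\<Sum>j=1..n. (nrm d u)\<^sup>2 * (nrm d (dl j))\<^sup>2)"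
    proof (rule sum_mono)
      fix j
      show "(ip d u (dl j))\<^sup>2 \<le> (nrm d u)\<^sup>2 * (nrm d (dl j))\<^sup>2"
        using power_mono[OF ip_Cauchy_Schwarz[of d u "dl j"] abs_ge_zero, of 2] by (simp add: power_mult_distrib)
    qed
    also have "\<dots> \<le> (nrm d u)\<^sup>2 * (real n * s\<^sup>2)"
      unfolding sum_distrib_left[symmetric] by (rule mult_left_mono[OF s(1)]) simp
    finally show ?thesis by (simp add: power_mult_distrib mult_ac)
  qed
  have nn: "0 \<le> sqrt n * L * nrm d u" "0 \<le> sqrt n * s * nrm d u" for u using L s by auto
  have div_n: "\<bar>a / real n - b / real n\<bar> \<le> c" if "\<bar>a - b\<bar> \<le> real n * c" for a b c :: real
  proof -
    have "\<bar>a / real n - b / real n\<bar> = \<bar>a - b\<bar> / real n" by (simp add: diff_divide_distrib[symmetric])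
    then show ?thesis using that n by (simp add: pos_divide_le_eq mult.commute)
  qed
  have c1: "(\<Sum>j=1..n. \<bar>ip d u (w j)\<bar> * \<bar>ip d v (dl j)\<bar>) \<le> (sqrt n * L * nrm d u) * (sqrt n * s * nrm d v)"
    by (rule sum_Cauchy_Schwarz[OF A' D' nn])
  have c2: "(\<Sum>j=1..n. \<bar>ip d u (dl j)\<bar> * \<bar>ip d v (w j)\<bar>) \<le> (sqrt n * s * nrm d u) * (sqrt n * L * nrm d v)"
    by (rule sum_Cauchy_Schwarz[OF D' A' nn(2,1)])
  have c3: "(\<Sum>j=1..n. \<bar>ip d u (dl j)\<bar> * \<bar>ip d v (dl j)\<bar>) \<le> (sqrt n * s * nrm d u) * (sqrt n * s * nrm d v)"
    by (rule sum_Cauchy_Schwarz[OF D' D' nn(2,2)])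
  have c0: "\<bar>(\<Sum>j=1..n. ip d u (\<lambda>i. w j i + dl j i) * ip d v (\<lambda>i. w j i + dl j i)) - (\<Sum>j=1..n. ip d u (w j) * ip d v (w j))\<bar>
      \<le> (\<Sum>j=1..n. \<bar>ip d u (w j)\<bar> * \<bar>ip d v (dl j)\<bar>) + (\<Sum>j=1..n. \<bar>ip d u (dl j)\<bar> * \<bar>ip d v (w j)\<bar>)
        + (\<Sum>j=1..n. \<bar>ip d u (dl j)\<bar> * \<bar>ip d v (dl j)\<bar>)"
  proof -
    have tri: "\<bar>(a + b) * (c + e) - a * c\<bar> \<le> \<bar>a\<bar> * \<bar>e\<bar> + \<bar>b\<bar> * \<bar>c\<bar> + \<bar>b\<bar> * \<bar>e\<bar>" for a b c e :: real
    proof -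
      have "(a + b) * (c + e) - a * c = a * e + b * c + b * e" by (simp add: algebra_simps)
      also have "\<bar>\<dots>\<bar> \<le> \<bar>a * e\<bar> + \<bar>b * c\<bar> + \<bar>b * e\<bar>" by linarith
      finally show ?thesis by (simp add: abs_mult)
    qed
    have "\<bar>\<Sum>j=1..n. (ip d u (w j) + ip d u (dl j)) * (ip d v (w j) + ip d v (dl j)) - ip d u (w j) * ip d v (w j)\<bar>
      \<le> (\<Sum>j=1..n. \<bar>ip d u (w j)\<bar> * \<bar>ip d v (dl j)\<bar> + \<bar>ip d u (dl j)\<bar> * \<bar>ip d v (w j)\<bar>
        + \<bar>ip d u (dl j)\<bar> * \<bar>ip d v (dl j)\<bar>)"
      by (rule order_trans[OF sum_abs sum_mono[OF tri]])
    then show ?thesis by (simp only: sum_subtractf sum.distrib ip_add_right)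
  qed
  have "\<bar>(\<Sum>j=1..n. ip d u (\<lambda>i. w j i + dl j i) * ip d v (\<lambda>i. w j i + dl j i)) - (\<Sum>j=1..n. ip d u (w j) * ip d v (w j))\<bar>
      \<le> (sqrt n * L * nrm d u) * (sqrt n * s * nrm d v) + (sqrt n * s * nrm d u) * (sqrt n * L * nrm d v) + (sqrt n * s * nrm d u) * (sqrt n * s * nrm d v)"
    by (rule order_trans[OF c0 add_mono[OF add_mono[OF c1 c2] c3]])
  also have "\<dots> = real n * ((2 * L * s + s\<^sup>2) * nrm d u * nrm d v)"
  proof -
    have "(r * L * a) * (r * s * b) + (r * s * a) * (r * L * b) + (r * s * a) * (r * s * b) = r * r * ((2 * L * s + s\<^sup>2) * a * b)"
      for r a b :: real by (simp add: power2_eq_square algebra_simps)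
    note this[of "sqrt n" "nrm d u" "nrm d v"]
    moreover have "sqrt n * sqrt n = real n" by simp
    ultimately show ?thesis by (simp only:)
  qed
  finally have "\<bar>(\<Sum>j=1..n. ip d u (\<lambda>i. w j i + dl j i) * ip d v (\<lambda>i. w j i + dl j i)) / real n - (\<Sum>j=1..n. ip d u (w j) * ip d v (w j)) / real n\<bar>
      \<le> (2 * L * s + s\<^sup>2) * nrm d u * nrm d v"
    by (rule div_n)
  moreover have "\<bar>x - z\<bar> \<le> (k + l + m) * a * b"
    if "\<bar>x - y\<bar> \<le> (l + m) * a * b" "\<bar>y - z\<bar> \<le> k * a * b" for x y z k l m a b :: real
  proof -
    have "\<bar>x - z\<bar> \<le> \<bar>x - y\<bar> + \<bar>y - z\<bar>" by linarith
    also have "\<dots> \<le> (l + m) * a * b + k * a * b" by (intro add_mono that)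
    finally show ?thesis by (simp add: algebra_simps)
  qed
  ultimately show ?B using kap[of u v] by blast
qed

lemma cube_add_le:
  fixes a b :: real
  assumes "0 \<le> a" "0 \<le> b"
  shows "(a + b) ^ 3 \<le> 4 * a ^ 3 + 4 * b ^ 3"
proof -
  have "0 \<le> 3 * (a + b) * (a - b)\<^sup>2" using assms by simp
  then show ?thesis by (simp add: power2_eq_square power3_eq_cube algebra_simps)
qed

text \<open>One summand is at most the whole sum. This crude bound for the largest observation is
  where the fourth root \<open>h\<close> of \<open>n\<close> comes from.\<close>

lemma nrm_le_of_fourth_moment:
  assumes "j \<in> {1..n}" "(\<Sum>j=1..n. nrm d (w j) ^ 4) \<le> real n * b ^ 4" "real n = h ^ 4" "0 \<le> b" "0 \<le> h"
  shows "nrm d (w j) \<le> h * b"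
proof -
  have "nrm d (w j) ^ 4 \<le> (\<Sum>j=1..n. nrm d (w j) ^ 4)"
    by (rule member_le_sum) (use assms in auto)
  also have "\<dots> \<le> (h * b) ^ 4" using assms by (simp add: power_mult_distrib)
  finally show ?thesis using assms by (subst (asm) power_mono_iff) auto
qed

lemma nrm_le_of_second_moment:
  assumes "j \<in> {1..n}" "(\<Sum>j=1..n. (nrm d (dl j))\<^sup>2) \<le> real n * s\<^sup>2" "real n = h ^ 4" "0 \<le> s"
  shows "nrm d (dl j) \<le> h\<^sup>2 * s"
proof -
  have "(nrm d (dl j))\<^sup>2 \<le> (\<Sum>j=1..n. (nrm d (dl j))\<^sup>2)"
    by (rule member_le_sum) (use assms in auto)
  also have "\<dots> \<le> (h\<^sup>2 * s)\<^sup>2" using assms by (simp add: power_mult_distrib power_mult[symmetric])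
  finally show ?thesis using assms by (subst (asm) power_mono_iff) auto
qed

text \<open>In the cubes of the errors \<open>dl\<close> no fourth moment is available: one factor
  is bounded by its maximum \<open>h ^ 2 * s\<close>, the other two by the second moment. This
  produces the summand \<open>4 * h ^ 2 * s ^ 3\<close>.\<close>

lemma perturbed_cubic_form:
  fixes w dl :: "nat \<Rightarrow> nat \<Rightarrow> real"
  assumes sec: "(\<Sum>j=1..n. (ip d u (w j))\<^sup>2) \<le> real n * L\<^sup>2 * (nrm d u)\<^sup>2"
    and b: "(\<Sum>j=1..n. nrm d (w j) ^ 4) \<le> real n * b ^ 4"
    and s: "(\<Sum>j=1..n. (nrm d (dl j))\<^sup>2) \<le> real n * s\<^sup>2"
    and h: "real n = h ^ 4"
    and nn: "0 \<le> L" "0 \<le> b" "0 \<le> s" "0 \<le> h"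
  shows "(\<Sum>j=1..n. \<bar>ip d u (\<lambda>i. w j i + dl j i)\<bar> ^ 3) \<le> real n * (4 * L * b\<^sup>2 + 4 * h\<^sup>2 * s ^ 3) * nrm d u ^ 3"
proof -
  have "(\<Sum>j=1..n. \<bar>ip d u (w j)\<bar> * \<bar>(ip d u (w j))\<^sup>2\<bar>) \<le> (h\<^sup>2 * L * nrm d u) * (h\<^sup>2 * b\<^sup>2 * (nrm d u)\<^sup>2)"
  proof (rule sum_Cauchy_Schwarz)
    show "(\<Sum>j=1..n. (ip d u (w j))\<^sup>2) \<le> (h\<^sup>2 * L * nrm d u)\<^sup>2"
      using sec by (simp add: h power_mult_distrib power_mult[symmetric])
    have "(\<Sum>j=1..n. ((ip d u (w j))\<^sup>2)\<^sup>2) \<le> (\<Sum>j=1..n. nrm d u ^ 4 * nrm d (w j) ^ 4)"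
    proof (rule sum_mono)
      fix j
      show "((ip d u (w j))\<^sup>2)\<^sup>2 \<le> nrm d u ^ 4 * nrm d (w j) ^ 4"
        using power_mono[OF ip_Cauchy_Schwarz[of d u "w j"] abs_ge_zero, of 4]
        by (simp add: power_mult_distrib power_mult[symmetric])
    qed
    also have "\<dots> \<le> nrm d u ^ 4 * (real n * b ^ 4)"
      unfolding sum_distrib_left[symmetric] by (rule mult_left_mono[OF b]) simp
    finally show "(\<Sum>j=1..n. ((ip d u (w j))\<^sup>2)\<^sup>2) \<le> (h\<^sup>2 * b\<^sup>2 * (nrm d u)\<^sup>2)\<^sup>2"
      by (simp add: h power_mult_distrib power_mult[symmetric] mult_ac)
  qed (use nn in auto)
  then have 1: "(\<Sum>j=1..n. \<bar>ip d u (w j)\<bar> ^ 3) \<le> real n * L * b\<^sup>2 * nrm d u ^ 3"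
    by (simp add: h power3_eq_cube power2_eq_square power4_eq_xxxx mult_ac)
  have "(\<Sum>j=1..n. \<bar>ip d u (dl j)\<bar> ^ 3) \<le> (\<Sum>j=1..n. nrm d u ^ 3 * (h\<^sup>2 * s) * (nrm d (dl j))\<^sup>2)"
  proof (rule sum_mono)
    fix j assume j: "j \<in> {1..n}"
    have "\<bar>ip d u (dl j)\<bar> ^ 3 \<le> (nrm d u * nrm d (dl j)) ^ 3"
      by (rule power_mono[OF ip_Cauchy_Schwarz]) simp
    also have "\<dots> = nrm d u ^ 3 * nrm d (dl j) * (nrm d (dl j))\<^sup>2"
      by (simp add: power_mult_distrib power3_eq_cube power2_eq_square)
    also have "\<dots> \<le> nrm d u ^ 3 * (h\<^sup>2 * s) * (nrm d (dl j))\<^sup>2"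
      by (intro mult_right_mono mult_left_mono nrm_le_of_second_moment[OF j s h nn(3)]) auto
    finally show "\<bar>ip d u (dl j)\<bar> ^ 3 \<le> nrm d u ^ 3 * (h\<^sup>2 * s) * (nrm d (dl j))\<^sup>2" .
  qed
  also have "\<dots> \<le> nrm d u ^ 3 * (h\<^sup>2 * s) * (real n * s\<^sup>2)"
    unfolding sum_distrib_left[symmetric] by (rule mult_left_mono[OF s]) (use nn in auto)
  finally have 2: "(\<Sum>j=1..n. \<bar>ip d u (dl j)\<bar> ^ 3) \<le> real n * h\<^sup>2 * s ^ 3 * nrm d u ^ 3"
    by (simp add: power3_eq_cube power2_eq_square mult_ac)
  have "(\<Sum>j=1..n. \<bar>ip d u (\<lambda>i. w j i + dl j i)\<bar> ^ 3) \<le> (\<Sum>j=1..n. 4 * \<bar>ip d u (w j)\<bar> ^ 3 + 4 * \<bar>ip d u (dl j)\<bar> ^ 3)"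
  proof (rule sum_mono)
    fix j
    have "\<bar>ip d u (\<lambda>i. w j i + dl j i)\<bar> ^ 3 \<le> (\<bar>ip d u (w j)\<bar> + \<bar>ip d u (dl j)\<bar>) ^ 3"
      by (rule power_mono) (auto simp: ip_add_right)
    also have "\<dots> \<le> 4 * \<bar>ip d u (w j)\<bar> ^ 3 + 4 * \<bar>ip d u (dl j)\<bar> ^ 3"
      by (rule cube_add_le) auto
    finally show "\<bar>ip d u (\<lambda>i. w j i + dl j i)\<bar> ^ 3 \<le> 4 * \<bar>ip d u (w j)\<bar> ^ 3 + 4 * \<bar>ip d u (dl j)\<bar> ^ 3" .
  qed
  also have "\<dots> = 4 * (\<Sum>j=1..n. \<bar>ip d u (w j)\<bar> ^ 3) + 4 * (\<Sum>j=1..n. \<bar>ip d u (dl j)\<bar> ^ 3)"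
    by (simp add: sum.distrib sum_distrib_left)
  also have "\<dots> \<le> 4 * (real n * L * b\<^sup>2 * nrm d u ^ 3) + 4 * (real n * h\<^sup>2 * s ^ 3 * nrm d u ^ 3)"
    using 1 2 by linarith
  finally show ?thesis by (simp add: algebra_simps)
qed

lemma mapp_add: "mapp d P (\<lambda>i. u i + v i) = (\<lambda>i. mapp d P u i + mapp d P v i)"
  by (simp add: mapp_def distrib_left sum.distrib)

lemma nrm_mapp_inverse_le:
  assumes lam: "0 < lam"
    and inv: "\<And>i k. i < d \<Longrightarrow> k < d \<Longrightarrow> (\<Sum>l<d. W i l * P l k) = (if i = k then 1 else 0)"
    and pd: "\<And>u. lam * (nrm d u)\<^sup>2 \<le> ip d u (mapp d W u)"
  shows "nrm d (mapp d P v) \<le> nrm d v / lam"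
proof -
  let ?z = "mapp d P v"
  have "ip d ?z (mapp d W ?z) = ip d ?z v"
    by (rule ip_cong) (use mapp_inverse[OF inv] in auto)
  then have "lam * (nrm d ?z)\<^sup>2 \<le> nrm d ?z * nrm d v"
    using pd[of ?z] ip_Cauchy_Schwarz[of d ?z v] by linarith
  then have *: "nrm d ?z * (lam * nrm d ?z) \<le> nrm d ?z * nrm d v"
    by (simp add: power2_eq_square mult_ac)
  have "lam * nrm d ?z \<le> nrm d v"
  proof (cases "nrm d ?z = 0")
    case False
    then have "0 < nrm d ?z" using nrm_nonneg[of d ?z] by linarith
    then show ?thesis using * by (rule mult_left_le_imp_le[rotated])
  qed simp
  then show ?thesis using lam by (simp add: pos_le_divide_eq mult.commute)
qed

text \<open>To be read with \<open>mu = sqrt m\<close> and \<open>h\<close> the fourth root of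
  \<open>n\<close>; \<open>A1\<close> is then \<open>m ^ 4 \<le> e ^ 16 * n\<close> and
  \<open>A2\<close> is \<open>1 \<le> e ^ 8 * m\<close>. The powers of \<open>e\<close> in the
  hypotheses are chosen so that every error ends below a constant times \<open>e * mu\<close>.
  Condition \<open>cross\<close> is stated separately: the norm bounds \<open>wmb\<close> and
  \<open>rb\<close> alone would only give the order \<open>mu / e ^ 2\<close>.\<close>

lemma el_quadratic_approximation:
  fixes w dl :: "nat \<Rightarrow> nat \<Rightarrow> real" and W P :: "nat \<Rightarrow> nat \<Rightarrow> real" and e h mu lam L c :: real
  assumes n: "n \<ge> 1" and lam: "0 < lam"
    and symW: "\<And>i k. i < d \<Longrightarrow> k < d \<Longrightarrow> W i k = W k i"
    and symP: "\<And>i k. i < d \<Longrightarrow> k < d \<Longrightarrow> P i k = P k i"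
    and inv: "\<And>i k. i < d \<Longrightarrow> k < d \<Longrightarrow> (\<Sum>l<d. W i l * P l k) = (if i = k then 1 else 0)"
    and pd: "\<And>u. lam * (nrm d u)\<^sup>2 \<le> ip d u (mapp d W u)"
    and ub: "\<And>u. ip d u (mapp d W u) \<le> Lam * (nrm d u)\<^sup>2"
    and L: "Lam + 1 \<le> L\<^sup>2" "0 \<le> L" and c: "0 \<le> c"
    and h: "real n = h ^ 4" "0 < h" and mu: "1 \<le> mu" and e: "0 < e" "e \<le> 1"
    and A1: "mu\<^sup>2 \<le> e ^ 4 * h" and A2: "1 \<le> e ^ 4 * mu"
    and kap: "\<And>u v. \<bar>(\<Sum>j=1..n. ip d u (w j) * ip d v (w j)) / real n - ip d u (mapp d W v)\<bar>
      \<le> mu\<^sup>2 / (h\<^sup>2 * e) * nrm d u * nrm d v"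
    and s: "(\<Sum>j=1..n. (nrm d (dl j))\<^sup>2) \<le> real n * (e ^ 4 / mu)\<^sup>2"
    and b: "(\<Sum>j=1..n. nrm d (w j) ^ 4) \<le> real n * (mu / e) ^ 4"
    and wm: "\<And>i. wm i = (\<Sum>j=1..n. w j i) / real n"
    and xm: "\<And>i. xm i = (\<Sum>j=1..n. w j i + dl j i) / real n"
    and wmb: "nrm d wm \<le> mu / (h\<^sup>2 * e)"
    and rb: "nrm d (\<lambda>i. xm i - wm i) \<le> c / (h\<^sup>2 * e)"
    and cross: "\<bar>real n * ip d (\<lambda>i. xm i - wm i) (mapp d P wm)\<bar> \<le> c * e * mu"
    and C1: "C1 = 2 + 2 * L + (1 + c)\<^sup>2" and C2: "C2 = 2 * (1 + c) / lam"
    and esmall: "C1 * e \<le> lam / 2" "C2 * (3 + c) * e \<le> 1 / 2"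
  shows "0 < elr d n (\<lambda>j i. w j i + dl j i)"
    and "\<bar>- 2 * ln (elr d n (\<lambda>j i. w j i + dl j i)) - real n * ip d wm (mapp d P wm)\<bar>
      \<le> (C2\<^sup>2 * C1 + 8 * C2 ^ 3 * (4 * L + 4 + (1 + c) ^ 3) + 2 * c + c\<^sup>2 / lam) * e * mu"
proof -
  \<comment> \<open>The order of the mean \<open>wm\<close>, that is \<open>sqrt (m / n)\<close> up
    to the factor \<open>1 / e\<close>.\<close>
  define t where "t = mu / (h\<^sup>2 * e)"
  define a where "a = nrm d xm"
  have t0: "0 \<le> t" using mu e h by (simp add: t_def)
  have h2t: "h\<^sup>2 * t = mu / e" using h e by (simp add: t_def field_simps)
  have e4: "e ^ 4 \<le> e" using power_decreasing[of 1 4 e] e by simp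
  have ed: "e ^ 4 / e\<^sup>2 = e\<^sup>2" "e ^ 7 / e ^ 4 = e ^ 3" "e ^ 7 / e\<^sup>2 = e ^ 5"
    using power_diff[of e 2 4] power_diff[of e 4 7] power_diff[of e 2 7] e by simp_all
  have lem: "e ^ k \<le> e * mu" if "1 \<le> k" for k
    using mult_mono[of "e ^ k" e 1 mu] power_decreasing[of 1 k e] that e mu by simp
  \<comment> \<open>\<open>A1\<close> is squared here. The leading part of the cubic remainder is of
    order \<open>mu ^ 4 * t / e ^ 4\<close>, which is \<open>mu\<close> times
    \<open>mu ^ 3 * t\<close> over \<open>e ^ 4\<close>, hence at most
    \<open>e ^ 3 * mu\<close>.\<close>
  have F4: "mu ^ 3 * t \<le> e ^ 7"
  proof -
    have "mu ^ 4 \<le> (e ^ 4 * h)\<^sup>2"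
      using power_mono[OF A1, of 2] by (simp add: power_mult[symmetric])
    then have "mu ^ 4 / (h\<^sup>2 * e) \<le> (e ^ 4 * h)\<^sup>2 / (h\<^sup>2 * e)"
      using h e by (intro divide_right_mono) auto
    also have "\<dots> = e ^ 7"
    proof -
      have "(e ^ 4)\<^sup>2 = e ^ 7 * e" by (simp flip: power_mult power_Suc2)
      then show ?thesis using h e by (simp add: power_mult_distrib)
    qed
    finally have "mu ^ 4 / (h\<^sup>2 * e) \<le> e ^ 7" .
    moreover have "mu ^ 3 * t = mu ^ 4 / (h\<^sup>2 * e)" by (simp add: t_def flip: power_Suc2)
    ultimately show ?thesis by simp
  qed
  have mupos: "0 < mu" using mu by simp
  \<comment> \<open>The sampling error \<open>mu * t\<close> of the second moments is brought below
    \<open>e ^ 4 / mu\<close>, the size of the estimation error, so that one quantity serves for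
    both.\<close>
  have F1: "mu * t \<le> e ^ 4 / mu"
  proof -
    have "mu * t * mu \<le> mu ^ 3 * t"
      using mult_right_mono[OF power_increasing[of 2 3 mu] t0] mu by (simp add: power2_eq_square mult_ac)
    also have "\<dots> \<le> e ^ 4" using F4 power_decreasing[of 4 7 e] e by simp
    finally show ?thesis using mupos by (simp add: pos_le_divide_eq)
  qed
  have tmu: "t \<le> mu * t" using mult_right_mono[OF mu t0] by simp
  have s1: "e ^ 4 / mu \<le> e ^ 4" using mu e by (simp add: pos_divide_le_eq mult_le_cancel_left1)
  have s0: "0 \<le> e ^ 4 / mu" using mu e by simp
  have t1: "t \<le> 1" using tmu F1 s1 e4 e by linarith
  have t2: "t\<^sup>2 \<le> e ^ 4 / mu"
  proof -
    have "t\<^sup>2 \<le> t" using mult_left_mono[OF t1 t0] by (simp add: power2_eq_square)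
    then show ?thesis using tmu F1 by linarith
  qed
  have muteq: "mu * t = mu\<^sup>2 / (h\<^sup>2 * e)" by (simp add: t_def power2_eq_square)
  note kap = kap[folded muteq]
  have Lk: "Lam + mu * t \<le> L\<^sup>2" using L F1 s1 e4 e by linarith
  have nt2: "real n * t\<^sup>2 = mu\<^sup>2 / e\<^sup>2"
  proof -
    have "real n * t\<^sup>2 = (h\<^sup>2 * t)\<^sup>2" by (simp add: h power_mult_distrib power_mult[symmetric])
    then show ?thesis by (simp add: h2t power_divide)
  qed
  have ab: "a \<le> (1 + c) * t"
  proof -
    have "a \<le> nrm d wm + nrm d (\<lambda>i. xm i - wm i)"
      unfolding a_def using nrm_triangle[of d wm "\<lambda>i. xm i - wm i"] by simp
    also have "\<dots> \<le> mu / (h\<^sup>2 * e) + c * mu / (h\<^sup>2 * e)"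
    proof (intro add_mono wmb order_trans[OF rb] divide_right_mono)
      show "c \<le> c * mu" using c mu by (simp add: mult_le_cancel_left1)
    qed (use h e in auto)
    also have "\<dots> = (1 + c) * t" by (simp add: t_def distrib_right add_divide_distrib)
    finally show ?thesis .
  qed
  have a0: "0 \<le> a" by (simp add: a_def)
  have a2: "a\<^sup>2 \<le> (1 + c)\<^sup>2 * (e ^ 4 / mu)"
  proof -
    have "a\<^sup>2 \<le> ((1 + c) * t)\<^sup>2" by (rule power_mono[OF ab a0])
    also have "\<dots> \<le> (1 + c)\<^sup>2 * (e ^ 4 / mu)"
      unfolding power_mult_distrib by (rule mult_left_mono[OF t2]) simp
    finally show ?thesis .
  qed
  define kp where "kp = mu * t + 2 * L * (e ^ 4 / mu) + (e ^ 4 / mu)\<^sup>2"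
  have kp0: "0 \<le> kp" unfolding kp_def using mu t0 L s0 by simp
  have kpa: "kp + a\<^sup>2 \<le> C1 * (e ^ 4 / mu)"
  proof -
    have "(e ^ 4 / mu)\<^sup>2 \<le> e ^ 4 / mu"
      using mult_left_mono[of "e ^ 4 / mu" 1 "e ^ 4 / mu"] s0 s1 e4 e by (simp add: power2_eq_square)
    then show ?thesis using F1 a2 unfolding kp_def C1 distrib_right by linarith
  qed
  have C1pos: "0 \<le> C1" using L by (simp add: C1)
  have C2pos: "0 \<le> C2" using c lam by (simp add: C2)
  have small: "kp + a\<^sup>2 \<le> lam / 2"
  proof -
    have "C1 * (e ^ 4 / mu) \<le> C1 * e" using s1 e4 by (intro mult_left_mono C1pos) linarith
    then show ?thesis using kpa esmall by linarith
  qed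
  define rho where "rho = 2 * a / lam"
  have rho0: "0 \<le> rho" using a0 lam by (simp add: rho_def)
  have rhob: "rho \<le> C2 * t"
  proof -
    have "2 * a / lam \<le> 2 * ((1 + c) * t) / lam"
      using ab lam by (intro divide_right_mono) auto
    then show ?thesis by (simp add: rho_def C2 mult_ac)
  qed
  define tau where "tau = 4 * L * (mu / e)\<^sup>2 + 4 * h\<^sup>2 * (e ^ 4 / mu) ^ 3"
  have tau0: "0 \<le> tau" unfolding tau_def using L s0 by simp
  have bnn: "0 \<le> mu / e" using mu e by simp
  have sec: "(\<Sum>j=1..n. (ip d u (w j))\<^sup>2) \<le> real n * L\<^sup>2 * (nrm d u)\<^sup>2" for u
    by (rule perturbed_quadratic_form(1)[OF n kap ub Lk L(2) s s0])
  have quad: "\<bar>(\<Sum>j=1..n. ip d u (\<lambda>i. w j i + dl j i) * ip d v (\<lambda>i. w j i + dl j i)) / real n - ip d u (mapp d W v)\<bar>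
      \<le> kp * nrm d u * nrm d v" for u v
    unfolding kp_def by (rule perturbed_quadratic_form(2)[OF n kap ub Lk L(2) s s0])
  have cub: "(\<Sum>j=1..n. \<bar>ip d u (\<lambda>i. w j i + dl j i)\<bar> ^ 3) \<le> real n * tau * nrm d u ^ 3" for u
    unfolding tau_def by (rule perturbed_cubic_form[OF sec b s h(1) L(2) bnn s0 less_imp_le[OF h(2)]])
  have mx: "rho * (nrm d (\<lambda>i. w j i + dl j i) + a) \<le> 1 / 2" if j: "j \<in> {1..n}" for j
  proof -
    have "nrm d (\<lambda>i. w j i + dl j i) \<le> nrm d (w j) + nrm d (dl j)" by (rule nrm_triangle)
    also have "\<dots> \<le> h * (mu / e) + h\<^sup>2 * (e ^ 4 / mu)"
      by (intro add_mono nrm_le_of_fourth_moment[OF j b h(1) bnn] nrm_le_of_second_moment[OF j s h(1) s0])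
        (use h in simp)
    finally have "nrm d (\<lambda>i. w j i + dl j i) + a \<le> h * (mu / e) + h\<^sup>2 * (e ^ 4 / mu) + (1 + c) * t"
      using ab by linarith
    then have "rho * (nrm d (\<lambda>i. w j i + dl j i) + a) \<le> C2 * t * (h * (mu / e) + h\<^sup>2 * (e ^ 4 / mu) + (1 + c) * t)"
      using rhob a0 t0 C2pos by (intro mult_mono) auto
    also have "\<dots> = C2 * (h * t * (mu / e) + h\<^sup>2 * t * (e ^ 4 / mu) + (1 + c) * t\<^sup>2)"
      by (simp add: power2_eq_square algebra_simps)
    also have "\<dots> \<le> C2 * (e + e + (1 + c) * e)"
    proof (intro mult_left_mono add_mono C2pos)
      \<comment> \<open>The largest observation times the multiplier: in terms of \<open>n\<close>
        this is \<open>m\<close> divided by the fourth root of \<open>n\<close>, up to powers of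
        \<open>e\<close>, and \<open>A1\<close> is the assertion that it is small.\<close>
      have "h * t * (mu / e) = mu\<^sup>2 / (h * e\<^sup>2)" using h e by (simp add: t_def power2_eq_square)
      also have "\<dots> \<le> e ^ 4 * h / (h * e\<^sup>2)" using A1 h e by (intro divide_right_mono) auto
      also have "\<dots> = e\<^sup>2" using h ed(1) by simp
      also have "\<dots> \<le> e" using power_decreasing[of 1 2 e] e by simp
      finally show "h * t * (mu / e) \<le> e" .
      have "h\<^sup>2 * t * (e ^ 4 / mu) = e ^ 3" unfolding h2t using mupos e power_add[of e 1 3] by simp
      also have "\<dots> \<le> e" using power_decreasing[of 1 3 e] e by simp
      finally show "h\<^sup>2 * t * (e ^ 4 / mu) \<le> e" .
      show "t\<^sup>2 \<le> e" using t2 s1 e4 by linarith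
    qed (use c in auto)
    also have "\<dots> = C2 * (3 + c) * e" by (simp add: algebra_simps)
    finally show ?thesis using esmall by linarith
  qed
  note E = el_expansion[OF xm n lam symW inv pd quad small[unfolded a_def] rho_def[unfolded a_def]
      mx[unfolded a_def] cub kp0 tau0]
  show "0 < elr d n (\<lambda>j i. w j i + dl j i)" by (rule E(1))
  let ?X = "- 2 * ln (elr d n (\<lambda>j i. w j i + dl j i))"
  have E2: "\<bar>?X - real n * ip d xm (mapp d P xm)\<bar> \<le> real n * rho\<^sup>2 * (kp + a\<^sup>2) + 8 * real n * rho ^ 3 * (tau + a ^ 3)"
    using E(2) by (simp add: a_def)
  have emu: "e\<^sup>2 * mu \<le> e * mu"
    using power_decreasing[of 1 2 e] e mu by (intro mult_right_mono) auto
  have T1: "real n * rho\<^sup>2 * (kp + a\<^sup>2) \<le> C2\<^sup>2 * C1 * e * mu"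
  proof -
    have "real n * rho\<^sup>2 \<le> real n * (C2 * t)\<^sup>2" using rhob rho0 by (intro mult_left_mono power_mono) auto
    also have "\<dots> = C2\<^sup>2 * (real n * t\<^sup>2)" by (simp add: power_mult_distrib)
    finally have "real n * rho\<^sup>2 * (kp + a\<^sup>2) \<le> C2\<^sup>2 * (mu\<^sup>2 / e\<^sup>2) * (C1 * (e ^ 4 / mu))"
      unfolding nt2 by (rule mult_mono[OF _ kpa]) (use kp0 in auto)
    also have "\<dots> = C2\<^sup>2 * C1 * ((e ^ 4 / e\<^sup>2) * (mu\<^sup>2 / mu))" by simp
    also have "\<dots> = C2\<^sup>2 * C1 * (e\<^sup>2 * mu)" unfolding ed using mupos by (simp add: power2_eq_square[of mu])
    also have "\<dots> \<le> C2\<^sup>2 * C1 * (e * mu)" by (rule mult_left_mono[OF emu]) (use C1pos in simp)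
    finally show ?thesis by (simp add: mult.assoc)
  qed
  have T2: "real n * rho ^ 3 * (tau + a ^ 3) \<le> C2 ^ 3 * ((4 * L + 4 + (1 + c) ^ 3) * (e * mu))"
  proof -
    have "real n * rho ^ 3 \<le> real n * (C2 * t) ^ 3" using rhob rho0 by (intro mult_left_mono power_mono) auto
    also have "\<dots> = C2 ^ 3 * (real n * t\<^sup>2 * t)"
      by (simp add: power_mult_distrib power3_eq_cube power2_eq_square)
    finally have nr: "real n * rho ^ 3 \<le> C2 ^ 3 * (mu\<^sup>2 / e\<^sup>2 * t)" by (simp add: nt2)
    have a3: "a ^ 3 \<le> (1 + c) ^ 3"
    proof (rule power_mono[OF _ a0])
      have "(1 + c) * t \<le> (1 + c) * 1" using t1 c by (intro mult_left_mono) auto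
      then show "a \<le> 1 + c" using ab by simp
    qed
    have "real n * rho ^ 3 * (tau + a ^ 3) \<le> C2 ^ 3 * (mu\<^sup>2 / e\<^sup>2 * t) * (tau + (1 + c) ^ 3)"
      by (rule mult_mono[OF nr add_left_mono[OF a3]]) (use tau0 a0 C2pos t0 in auto)
    also have "\<dots> = C2 ^ 3 * (mu\<^sup>2 / e\<^sup>2 * t * (4 * L * (mu / e)\<^sup>2) + mu\<^sup>2 / e\<^sup>2 * t * (4 * h\<^sup>2 * (e ^ 4 / mu) ^ 3)
        + mu\<^sup>2 / e\<^sup>2 * t * (1 + c) ^ 3)"
      unfolding tau_def by (simp only: distrib_left mult.assoc)
    also have "\<dots> \<le> C2 ^ 3 * (4 * L * (e * mu) + 4 * (e * mu) + (1 + c) ^ 3 * (e * mu))"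
    proof (intro mult_left_mono add_mono)
      have "mu\<^sup>2 / e\<^sup>2 * t * (4 * L * (mu / e)\<^sup>2) = 4 * L * (mu ^ 3 * t) * mu / e ^ 4"
        by (simp add: power_divide power2_eq_square power3_eq_cube power4_eq_xxxx mult_ac)
      also have "\<dots> \<le> 4 * L * e ^ 7 * mu / e ^ 4"
        using F4 L e mu by (intro divide_right_mono mult_right_mono mult_left_mono) auto
      also have "\<dots> = 4 * L * (e ^ 3 * mu)"
        unfolding ed(2)[symmetric] by simp
      also have "\<dots> \<le> 4 * L * (e * mu)"
        using power_decreasing[of 1 3 e] e mu L by (intro mult_left_mono mult_right_mono) auto
      finally show "mu\<^sup>2 / e\<^sup>2 * t * (4 * L * (mu / e)\<^sup>2) \<le> 4 * L * (e * mu)" .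
      have mus: "mu * (e ^ 4 / mu) = e ^ 4" using mupos by simp
      have "mu\<^sup>2 / e\<^sup>2 * t * (4 * h\<^sup>2 * s ^ 3) = 4 * (h\<^sup>2 * t) * ((mu * s)\<^sup>2 * s) / e\<^sup>2" for s
        by (simp add: power2_eq_square power3_eq_cube)
      from this[of "e ^ 4 / mu"]
      have "mu\<^sup>2 / e\<^sup>2 * t * (4 * h\<^sup>2 * (e ^ 4 / mu) ^ 3) = 4 * (mu / e) * ((e ^ 4)\<^sup>2 * (e ^ 4 / mu)) / e\<^sup>2"
        unfolding h2t mus .
      also have "\<dots> = 4 * (e ^ 9)"
      proof -
        have "(e ^ 4)\<^sup>2 * e ^ 4 = e ^ 9 * e * e\<^sup>2"
          by (simp flip: power_mult power_add power_Suc2)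
        then show ?thesis using mupos e by (simp add: field_simps)
      qed
      also have "\<dots> \<le> 4 * (e * mu)"
        using lem[of 9] by simp
      finally show "mu\<^sup>2 / e\<^sup>2 * t * (4 * h\<^sup>2 * (e ^ 4 / mu) ^ 3) \<le> 4 * (e * mu)" .
      have "mu\<^sup>2 * t \<le> mu ^ 3 * t"
        using power_increasing[of 2 3 mu] mu t0 by (intro mult_right_mono) auto
      then have "mu\<^sup>2 * t \<le> e ^ 7" using F4 by linarith
      then have "mu\<^sup>2 * t / e\<^sup>2 \<le> e ^ 7 / e\<^sup>2" by (rule divide_right_mono) simp
      also have "\<dots> = e ^ 5" by (rule ed)
      also have "\<dots> \<le> e * mu" using lem[of 5] by simp
      finally have "mu\<^sup>2 * t / e\<^sup>2 * (1 + c) ^ 3 \<le> e * mu * (1 + c) ^ 3" using c by (intro mult_right_mono) auto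
      then show "mu\<^sup>2 / e\<^sup>2 * t * (1 + c) ^ 3 \<le> (1 + c) ^ 3 * (e * mu)" by (simp add: mult_ac)
    qed (use C2pos in auto)
    finally show ?thesis by (simp add: distrib_right)
  qed
  define r where "r = (\<lambda>i. xm i - wm i)"
  have T3: "\<bar>real n * ip d r (mapp d P r)\<bar> \<le> c\<^sup>2 / lam * (e * mu)"
  proof -
    have r1: "nrm d r \<le> c / (h\<^sup>2 * e)" using rb by (simp add: r_def)
    have "\<bar>ip d r (mapp d P r)\<bar> \<le> nrm d r * (nrm d r / lam)"
      by (rule order_trans[OF ip_Cauchy_Schwarz mult_left_mono[OF nrm_mapp_inverse_le[OF lam inv pd]]]) auto
    also have "\<dots> \<le> (c / (h\<^sup>2 * e)) * ((c / (h\<^sup>2 * e)) / lam)"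
      using r1 lam c e by (intro mult_mono divide_right_mono) auto
    finally have "real n * \<bar>ip d r (mapp d P r)\<bar> \<le> real n * ((c / (h\<^sup>2 * e)) * ((c / (h\<^sup>2 * e)) / lam))"
      by (rule mult_left_mono) simp
    also have "\<dots> = c\<^sup>2 / lam * (1 / e\<^sup>2)"
    proof -
      have nh: "real n = h\<^sup>2 * h\<^sup>2" by (simp add: h(1) power2_eq_square power4_eq_xxxx)
      have gl: "g * g * (c / (g * e) * (c / (g * e) / lam)) = c\<^sup>2 / lam * (1 / e\<^sup>2)" if "g \<noteq> 0" for g
        using that by (simp add: power2_eq_square)
      have "h\<^sup>2 * h\<^sup>2 * (c / (h\<^sup>2 * e) * (c / (h\<^sup>2 * e) / lam)) = c\<^sup>2 / lam * (1 / e\<^sup>2)"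
        by (rule gl) (use h(2) in simp)
      with nh show ?thesis by (simp only:)
    qed
    also have "\<dots> \<le> c\<^sup>2 / lam * (e * mu)"
    proof (rule mult_left_mono)
      \<comment> \<open>The quadratic form in \<open>r\<close> is merely bounded, of order
        \<open>1 / e ^ 2\<close>. It becomes negligible against \<open>mu\<close> only through
        \<open>A2\<close>, that is, through the growth of the dimension.\<close>
      have "1 / e\<^sup>2 \<le> e ^ 4 * mu / e\<^sup>2" using A2 by (intro divide_right_mono) auto
      also have "\<dots> = e ^ 4 / e\<^sup>2 * mu" by simp
      also have "\<dots> = e\<^sup>2 * mu" unfolding ed ..
      finally show "1 / e\<^sup>2 \<le> e * mu" using emu by linarith
    qed (use lam in simp)
    finally show ?thesis by (simp add: abs_mult)
  qed
  have quadx: "real n * ip d xm (mapp d P xm) = real n * ip d wm (mapp d P wm) + 2 * (real n * ip d r (mapp d P wm)) + real n * ip d r (mapp d P r)"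
  proof -
    have x: "xm = (\<lambda>i. wm i + r i)" by (simp add: r_def)
    have "ip d wm (mapp d P r) = ip d r (mapp d P wm)" by (rule ip_mapp_sym[OF symP])
    then have "ip d xm (mapp d P xm) = ip d wm (mapp d P wm) + 2 * ip d r (mapp d P wm) + ip d r (mapp d P r)"
      unfolding x mapp_add ip_add_left ip_add_right by linarith
    then show ?thesis by (simp add: distrib_left)
  qed
  have comb: "\<bar>X - q\<bar> \<le> (k1 + 8 * k2 * k3 + 2 * c + k4) * e * mu"
    if "\<bar>X - Y\<bar> \<le> u1 + 8 * n * u2 * u3" "u1 \<le> k1 * e * mu" "n * u2 * u3 \<le> k2 * (k3 * (e * mu))"
      "Y = q + 2 * y + z" "\<bar>y\<bar> \<le> c * e * mu" "\<bar>z\<bar> \<le> k4 * (e * mu)"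
    for X Y q u1 u2 u3 n k1 k2 k3 k4 y z :: real
  proof -
    have "\<bar>X - q\<bar> \<le> u1 + 8 * (n * u2 * u3) + 2 * \<bar>y\<bar> + \<bar>z\<bar>" using that(1,4) by linarith
    also have "\<dots> \<le> k1 * e * mu + 8 * (k2 * (k3 * (e * mu))) + 2 * (c * e * mu) + k4 * (e * mu)"
      using that by (intro add_mono mult_left_mono) auto
    finally show ?thesis by (simp add: algebra_simps)
  qed
  show "\<bar>?X - real n * ip d wm (mapp d P wm)\<bar>
      \<le> (C2\<^sup>2 * C1 + 8 * C2 ^ 3 * (4 * L + 4 + (1 + c) ^ 3) + 2 * c + c\<^sup>2 / lam) * e * mu"
    by (rule comb[OF E2 T1 T2 quadx cross[folded r_def] T3])
qed

section \<open>Measurability of the likelihood ratio\<close>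

text \<open>Tychonoff's theorem. The weights are extensional functions, so outside
  \<open>{1..n}\<close> the factor is the singleton of \<open>undefined\<close>, which is compact as
  well; the sum condition cuts out a closed set.\<close>

lemma compact_prob_weights: "compact (prob_weights n)"
proof -
  have "compactin (product_topology (\<lambda>i::nat. euclidean :: real topology) UNIV)
      (PiE UNIV (\<lambda>j. if j \<in> {1..n} then {0..1} else {undefined}))"
    by (subst compactin_PiE) auto
  then have 1: "compact (PiE UNIV (\<lambda>j. if j \<in> {1..n} then {0..1} else {undefined :: real}))"
    by (simp add: euclidean_product_topology)
  have "closed {p::nat \<Rightarrow> real. (\<Sum>j=1..n. p j) = 1}"
    by (intro closed_Collect_eq continuous_intros continuous_on_product_coordinates)
  from compact_Int_closed[OF 1 this] show ?thesis
    by (rule back_subst[of compact])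
       (auto simp: prob_weights_def PiE_iff extensional_def split: if_splits)
qed

text \<open>The feasible weights vary with \<open>\<omega>\<close> and may avoid any fixed countable
  set, so this is no countable supremum. For \<open>c > 0\<close>, however,
  \<open>c \<le> elr\<close> says that the penalty \<open>g\<close> vanishes somewhere on the
  compact set \<open>K\<close> of weights with product at least \<open>c\<close>. By continuity and
  compactness this means that \<open>g\<close> becomes arbitrarily small on a countable dense subset
  of \<open>K\<close>.\<close>

lemma elr_measurable:
  fixes X :: "'a \<Rightarrow> nat \<Rightarrow> nat \<Rightarrow> real"
  assumes X: "\<And>j i. j \<in> {1..n} \<Longrightarrow> i < d \<Longrightarrow> (\<lambda>\<omega>. X \<omega> j i) \<in> borel_measurable M"
  shows "(\<lambda>\<omega>. elr d n (X \<omega>)) \<in> borel_measurable M"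
proof (rule borel_measurableI_ge)
  fix c :: real
  define f where "f = (\<lambda>p::nat \<Rightarrow> real. \<Prod>j=1..n. real n * p j)"
  define g where "g = (\<lambda>\<omega> (p::nat \<Rightarrow> real). \<Sum>i<d. \<bar>\<Sum>j=1..n. p j * X \<omega> j i\<bar>)"
  have contf: "continuous_on A f" for A
    unfolding f_def by (intro continuous_intros continuous_on_subset[OF continuous_on_product_coordinates]) auto
  have contg: "continuous_on A (g \<omega>)" for A \<omega>
    unfolding g_def by (intro continuous_intros continuous_on_subset[OF continuous_on_product_coordinates]) auto
  have g0: "g \<omega> p = 0 \<longleftrightarrow> (\<forall>i<d. (\<Sum>j=1..n. p j * X \<omega> j i) = 0)" for \<omega> p
    unfolding g_def by (subst sum_nonneg_eq_0_iff) auto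
  have gnn: "0 \<le> g \<omega> p" for \<omega> p by (simp add: g_def sum_nonneg)
  have elr_eq: "elr d n (X \<omega>) = Sup (insert 0 (f ` {p \<in> prob_weights n. g \<omega> p = 0}))" for \<omega>
    unfolding elr_def g0 f_def by (rule arg_cong[of _ _ Sup]) auto
  have comp0: "compact {p \<in> prob_weights n. g \<omega> p = 0}" for \<omega>
  proof -
    have "closed {p. g \<omega> p = 0}"
      by (intro closed_Collect_eq contg continuous_on_const)
    from compact_Int_closed[OF compact_prob_weights this] show ?thesis
      by (rule back_subst[of compact]) auto
  qed
  have bdd: "bdd_above (insert 0 (f ` {p \<in> prob_weights n. g \<omega> p = 0}))" for \<omega>
    using compact_imp_bounded[OF compact_continuous_image[OF contf comp0[of \<omega>]]]
    by (simp add: bounded_imp_bdd_above)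
  show "{\<omega> \<in> space M. c \<le> elr d n (X \<omega>)} \<in> sets M"
  proof (cases "c \<le> 0")
    case True
    have "0 \<le> elr d n (X \<omega>)" for \<omega>
      unfolding elr_eq by (rule cSup_upper[OF _ bdd]) simp
    then have "{\<omega> \<in> space M. c \<le> elr d n (X \<omega>)} = space M" using True order_trans by blast
    then show ?thesis by simp
  next
    case False
    define K where "K = {p \<in> prob_weights n. c \<le> f p}"
    have compK: "compact K"
    proof -
      have "closed {p. c \<le> f p}"
        by (intro closed_Collect_le contf continuous_on_const)
      from compact_Int_closed[OF compact_prob_weights this] show ?thesis
        by (rule back_subst[of compact]) (auto simp: K_def)
    qed
    obtain D where D: "countable D" "D \<subseteq> K" "K \<subseteq> closure D" using separable by blast
    \<comment> \<open>The supremum over the compact feasible set is attained, and since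
      \<open>c\<close> is positive the inserted 0 never accounts for
      \<open>c \<le> elr\<close>.\<close>
    have ge_iff: "c \<le> elr d n (X \<omega>) \<longleftrightarrow> (\<exists>p\<in>K. g \<omega> p = 0)" for \<omega>
    proof
      assume c: "c \<le> elr d n (X \<omega>)"
      have ne: "{p \<in> prob_weights n. g \<omega> p = 0} \<noteq> {}"
      proof
        assume "{p \<in> prob_weights n. g \<omega> p = 0} = {}"
        then have "elr d n (X \<omega>) = 0" unfolding elr_eq by (simp only: image_empty cSup_singleton)
        then show False using c False by simp
      qed
      obtain p where p: "p \<in> prob_weights n" "g \<omega> p = 0"
        and pmax: "\<And>p'. p' \<in> prob_weights n \<Longrightarrow> g \<omega> p' = 0 \<Longrightarrow> f p' \<le> f p"
        using continuous_attains_sup[OF comp0 ne contf] by blast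
      have "elr d n (X \<omega>) \<le> max 0 (f p)"
        unfolding elr_eq by (rule cSup_least) (auto simp: le_max_iff_disj pmax)
      then have "c \<le> f p" using c False by auto
      then show "\<exists>p\<in>K. g \<omega> p = 0" using p by (auto simp: K_def)
    next
      assume "\<exists>p\<in>K. g \<omega> p = 0"
      then obtain p where p: "p \<in> prob_weights n" "c \<le> f p" "g \<omega> p = 0" by (auto simp: K_def)
      have "f p \<le> elr d n (X \<omega>)" unfolding elr_eq by (rule cSup_upper[OF _ bdd]) (use p in auto)
      then show "c \<le> elr d n (X \<omega>)" using p by simp
    qed
    have dense_iff: "(\<exists>p\<in>K. g \<omega> p = 0) \<longleftrightarrow> (\<forall>k::nat. \<exists>p\<in>D. g \<omega> p < 1 / real (Suc k))" for \<omega>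
    proof
      assume "\<exists>p\<in>K. g \<omega> p = 0"
      then obtain p where p: "p \<in> K" "g \<omega> p = 0" by auto
      show "\<forall>k::nat. \<exists>p\<in>D. g \<omega> p < 1 / real (Suc k)"
      proof
        fix k :: nat
        have "open {p. g \<omega> p < 1 / real (Suc k)}"
          by (intro open_Collect_less contg continuous_on_const)
        moreover have "p \<in> {p. g \<omega> p < 1 / real (Suc k)} \<inter> closure D" using p D by auto
        ultimately have "{p. g \<omega> p < 1 / real (Suc k)} \<inter> D \<noteq> {}"
          using open_Int_closure_eq_empty[of "{p. g \<omega> p < 1 / real (Suc k)}" D] by blast
        then show "\<exists>p\<in>D. g \<omega> p < 1 / real (Suc k)" by blast
      qed
    next
      assume D0: "\<forall>k::nat. \<exists>p\<in>D. g \<omega> p < 1 / real (Suc k)"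
      then have "K \<noteq> {}" using D by blast
      obtain p where p: "p \<in> K" "\<And>p'. p' \<in> K \<Longrightarrow> g \<omega> p \<le> g \<omega> p'"
        using continuous_attains_inf[OF compK \<open>K \<noteq> {}\<close> contg] by blast
      have "g \<omega> p < 1 / real (Suc k)" for k
        using D0 p(2) D(2) by (meson order_le_less_trans subsetD)
      then have "\<not> 0 < g \<omega> p" using nat_approx_posE by (metis less_asym)
      then show "\<exists>p\<in>K. g \<omega> p = 0" using gnn[of \<omega> p] p(1) by force
    qed
    have gm: "(\<lambda>\<omega>. g \<omega> p) \<in> borel_measurable M" for p
      unfolding g_def by (intro borel_measurable_sum borel_measurable_abs borel_measurable_times borel_measurable_const X) auto
    have "{\<omega> \<in> space M. c \<le> elr d n (X \<omega>)} = {\<omega> \<in> space M. \<forall>k::nat. \<exists>p\<in>D. g \<omega> p < 1 / real (Suc k)}"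
      by (simp add: ge_iff dense_iff)
    also have "\<dots> \<in> sets M"
      using D(1) gm by measurable
    finally show ?thesis .
  qed
qed

declare One_nat_def [simp]

section \<open>Transfer of asymptotic normality\<close>

text \<open>Limits for each fixed tolerance are merged into one sequence of tolerances.
  \<open>K n\<close> is the largest \<open>k \<le> n\<close> whose tolerance
  \<open>1 / (k + 1)\<close> is already met from \<open>n\<close> on, and the sequence is
  \<open>1 / (K n + 1)\<close>.\<close>

lemma diagonal_rate:
  fixes p :: "real \<Rightarrow> nat \<Rightarrow> real"
  assumes lim: "\<And>e. 0 < e \<Longrightarrow> (\<lambda>n. p e n) \<longlonglongrightarrow> 0"
  obtains e where "\<And>n. 0 < e n" "e \<longlonglongrightarrow> 0" "(\<lambda>n. p (e n) n) \<longlonglongrightarrow> 0"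
proof -
  define A where "A = (\<lambda>n. {k. k \<le> n \<and> (k = 0 \<or> (\<forall>n'\<ge>n. \<bar>p (1 / real (Suc k)) n'\<bar> < 1 / real (Suc k)))})"
  define K where "K = (\<lambda>n. Max (A n))"
  have fin: "finite (A n)" for n by (simp add: A_def)
  have KA: "K n \<in> A n" for n
    unfolding K_def by (rule Max_in[OF fin]) (auto simp: A_def)
  have ev: "\<forall>\<^sub>F n in sequentially. k \<le> K n" for k
  proof -
    have "\<forall>\<^sub>F n in sequentially. \<bar>p (1 / real (Suc k)) n\<bar> < 1 / real (Suc k)"
      using order_tendstoD(2)[OF tendsto_rabs_zero[OF lim[of "1 / real (Suc k)"]], of "1 / real (Suc k)"] by simp
    then obtain N where "\<And>n. n \<ge> N \<Longrightarrow> \<bar>p (1 / real (Suc k)) n\<bar> < 1 / real (Suc k)"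
      unfolding eventually_sequentially by blast
    then have "k \<in> A n" if "n \<ge> N + k" for n using that by (auto simp: A_def)
    then have "k \<le> K n" if "n \<ge> N + k" for n unfolding K_def using that fin by (intro Max_ge) auto
    then show ?thesis unfolding eventually_sequentially by blast
  qed
  then have "filterlim K at_top sequentially" by (simp add: filterlim_at_top)
  then have lim0: "(\<lambda>n. 1 / real (Suc (K n))) \<longlonglongrightarrow> 0"
    using filterlim_compose[OF LIMSEQ_Suc[OF lim_1_over_n]] by blast
  show ?thesis
  proof (rule that[of "\<lambda>n. 1 / real (Suc (K n))"])
    show "(\<lambda>n. p (1 / real (Suc (K n))) n) \<longlonglongrightarrow> 0"
    proof (rule Lim_null_comparison[OF _ lim0])
      \<comment> \<open>Once \<open>K n \<ge> 1\<close>, membership in \<open>A n\<close> carries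
        the bound on \<open>p\<close>; for \<open>K n = 0\<close> it says nothing.\<close>
      show "\<forall>\<^sub>F n in sequentially. norm (p (1 / real (Suc (K n))) n) \<le> 1 / real (Suc (K n))"
        using ev[of 1]
      proof eventually_elim
        case (elim n)
        then show ?case using KA[of n] by (auto simp: A_def intro: less_imp_le)
      qed
    qed
  qed (use lim0 in auto)
qed

lemma isCont_cdf_std_normal: "isCont (cdf std_normal_distribution) x"
proof -
  interpret real_distribution std_normal_distribution by (rule real_dist_normal_dist)
  have "emeasure std_normal_distribution {x} = (\<integral>\<^sup>+ y. ennreal (std_normal_density y) * indicator {x} y \<partial>lborel)"
    by (subst emeasure_density) auto
  also have "\<dots> = 0"
    by (subst nn_integral_0_iff_AE)
       (use AE_lborel_singleton[of x] in \<open>auto simp: indicator_def elim!: eventually_rev_mp\<close>)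
  finally have "measure std_normal_distribution {x} = 0" by (simp add: measure_def)
  then show ?thesis by (simp add: isCont_cdf)
qed

text \<open>Slutsky's argument for a statistic that may be infinite: finiteness is asked only on
  events \<open>G n\<close> of probability tending to 1. There \<open>T n \<le> x\<close> implies
  \<open>Y n \<le> (x + b n) / al n\<close>, whose right side tends to \<open>x\<close>, and
  similarly from below. Continuity of the normal distribution function closes the gap.\<close>

lemma asymp_std_normal_transfer:
  fixes T :: "nat \<Rightarrow> 'a \<Rightarrow> ereal" and Y :: "nat \<Rightarrow> 'a \<Rightarrow> real"
  assumes "prob_space M"
    and T: "\<And>n. n \<ge> 1 \<Longrightarrow> T n \<in> borel_measurable M"
    and Y: "\<And>n. n \<ge> 1 \<Longrightarrow> Y n \<in> borel_measurable M"
    and conv: "\<And>x. (\<lambda>n. measure M {\<omega> \<in> space M. Y n \<omega> \<le> x}) \<longlonglongrightarrow> cdf std_normal_distribution x"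
    and al: "al \<longlonglongrightarrow> (1::real)" and b: "b \<longlonglongrightarrow> (0::real)"
    and G: "\<And>n. G n \<in> sets M" and Glim: "(\<lambda>n. measure M (G n)) \<longlonglongrightarrow> 1"
    and ev: "\<forall>\<^sub>F n in sequentially. \<forall>\<omega>\<in>G n. \<exists>t. T n \<omega> = ereal t \<and> \<bar>t - al n * Y n \<omega>\<bar> \<le> b n"
  shows "asymp_std_normal M T"
  unfolding asymp_std_normal_def weak_conv_def
proof (intro conjI allI impI)
  interpret prob_space M by fact
  let ?F = "cdf std_normal_distribution"
  fix x
  have up: "\<forall>\<^sub>F n in sequentially. prob {\<omega> \<in> space M. T n \<omega> \<le> ereal x} \<le> prob {\<omega> \<in> space M. Y n \<omega> \<le> x + \<epsilon>} + (1 - prob (G n)) \<and>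
      prob {\<omega> \<in> space M. Y n \<omega> \<le> x - \<epsilon>} \<le> prob {\<omega> \<in> space M. T n \<omega> \<le> ereal x} + (1 - prob (G n))"
    if e: "0 < \<epsilon>" for \<epsilon>
  proof -
    have "(\<lambda>n. (x + b n) / al n) \<longlonglongrightarrow> (x + 0) / 1" "(\<lambda>n. (x - b n) / al n) \<longlonglongrightarrow> (x - 0) / 1"
      by (intro tendsto_intros al b; simp)+
    then have "\<forall>\<^sub>F n in sequentially. (x + b n) / al n < x + \<epsilon>" "\<forall>\<^sub>F n in sequentially. x - \<epsilon> < (x - b n) / al n"
      using order_tendstoD(2)[of "\<lambda>n. (x + b n) / al n" x _ "x + \<epsilon>"]
        order_tendstoD(1)[of "\<lambda>n. (x - b n) / al n" x _ "x - \<epsilon>"] e by simp_all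
    moreover have "\<forall>\<^sub>F n in sequentially. 0 < al n" using order_tendstoD(1)[OF al] by simp
    ultimately show ?thesis using ev eventually_ge_at_top[of 1]
    proof eventually_elim
      case (elim n)
      have [measurable]: "T n \<in> borel_measurable M" "Y n \<in> borel_measurable M" "G n \<in> sets M"
        using elim T Y G by auto
      have compl: "prob (space M - G n) = 1 - prob (G n)" by (rule prob_compl[OF G])
      have "{\<omega> \<in> space M. T n \<omega> \<le> ereal x} \<subseteq> {\<omega> \<in> space M. Y n \<omega> \<le> x + \<epsilon>} \<union> (space M - G n)"
      proof safe
        fix \<omega> assume w: "\<omega> \<in> G n" "T n \<omega> \<le> ereal x"
        then obtain t where "T n \<omega> = ereal t" "\<bar>t - al n * Y n \<omega>\<bar> \<le> b n" using elim by blast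
        then have "al n * Y n \<omega> \<le> x + b n" using w by auto
        then have "Y n \<omega> \<le> (x + b n) / al n" using elim by (simp add: pos_le_divide_eq mult.commute)
        then show "Y n \<omega> \<le> x + \<epsilon>" using elim by simp
      qed
      then have "prob {\<omega> \<in> space M. T n \<omega> \<le> ereal x} \<le> prob ({\<omega> \<in> space M. Y n \<omega> \<le> x + \<epsilon>} \<union> (space M - G n))"
        by (rule finite_measure_mono) measurable
      also have "\<dots> \<le> prob {\<omega> \<in> space M. Y n \<omega> \<le> x + \<epsilon>} + prob (space M - G n)"
        by (rule measure_Un_le) measurable
      finally have 1: "prob {\<omega> \<in> space M. T n \<omega> \<le> ereal x} \<le> prob {\<omega> \<in> space M. Y n \<omega> \<le> x + \<epsilon>} + (1 - prob (G n))"
        by (simp add: compl)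
      have "{\<omega> \<in> space M. Y n \<omega> \<le> x - \<epsilon>} \<subseteq> {\<omega> \<in> space M. T n \<omega> \<le> ereal x} \<union> (space M - G n)"
      proof safe
        fix \<omega> assume w: "\<omega> \<in> G n" "Y n \<omega> \<le> x - \<epsilon>"
        then obtain t where t: "T n \<omega> = ereal t" "\<bar>t - al n * Y n \<omega>\<bar> \<le> b n" using elim by blast
        have "Y n \<omega> \<le> (x - b n) / al n" using elim w by simp
        then have "al n * Y n \<omega> \<le> x - b n" using elim by (simp add: pos_le_divide_eq mult.commute)
        then show "T n \<omega> \<le> ereal x" using t by auto
      qed
      then have "prob {\<omega> \<in> space M. Y n \<omega> \<le> x - \<epsilon>} \<le> prob ({\<omega> \<in> space M. T n \<omega> \<le> ereal x} \<union> (space M - G n))"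
        by (rule finite_measure_mono) measurable
      also have "\<dots> \<le> prob {\<omega> \<in> space M. T n \<omega> \<le> ereal x} + prob (space M - G n)"
        by (rule measure_Un_le) measurable
      finally show ?case using 1 by (simp add: compl)
    qed
  qed
  have G0: "(\<lambda>n. 1 - prob (G n)) \<longlonglongrightarrow> 0" using tendsto_diff[OF tendsto_const[of 1] Glim] by simp
  have F: "(\<lambda>k. ?F (x + 1 / real (Suc k))) \<longlonglongrightarrow> ?F x" "(\<lambda>k. ?F (x - 1 / real (Suc k))) \<longlonglongrightarrow> ?F x"
  proof -
    have "(\<lambda>k. x + 1 / real (Suc k)) \<longlonglongrightarrow> x + 0" "(\<lambda>k. x - 1 / real (Suc k)) \<longlonglongrightarrow> x - 0"
      by (intro tendsto_intros LIMSEQ_Suc[OF lim_1_over_n])+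
    then show "(\<lambda>k. ?F (x + 1 / real (Suc k))) \<longlonglongrightarrow> ?F x" "(\<lambda>k. ?F (x - 1 / real (Suc k))) \<longlonglongrightarrow> ?F x"
      using isCont_tendsto_compose[OF isCont_cdf_std_normal] by fastforce+
  qed
  show "(\<lambda>n. prob {\<omega> \<in> space M. T n \<omega> \<le> ereal x}) \<longlonglongrightarrow> ?F x"
  proof (rule order_tendstoI)
    fix a assume "?F x < a"
    from order_tendstoD(2)[OF F(1) this] obtain k where k: "?F (x + 1 / real (Suc k)) < a"
      using eventually_happens'[OF sequentially_bot] by blast
    have "(\<lambda>n. prob {\<omega> \<in> space M. Y n \<omega> \<le> x + 1 / real (Suc k)} + (1 - prob (G n))) \<longlonglongrightarrow> ?F (x + 1 / real (Suc k)) + 0"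
      by (intro tendsto_add conv G0)
    then have "\<forall>\<^sub>F n in sequentially. prob {\<omega> \<in> space M. Y n \<omega> \<le> x + 1 / real (Suc k)} + (1 - prob (G n)) < a"
      using k by (auto dest: order_tendstoD)
    moreover have "0 < 1 / real (Suc k)" by simp
    note up[OF this]
    ultimately show "\<forall>\<^sub>F n in sequentially. prob {\<omega> \<in> space M. T n \<omega> \<le> ereal x} < a"
      by eventually_elim simp
  next
    fix a assume "a < ?F x"
    from order_tendstoD(1)[OF F(2) this] obtain k where k: "a < ?F (x - 1 / real (Suc k))"
      using eventually_happens'[OF sequentially_bot] by blast
    have "(\<lambda>n. prob {\<omega> \<in> space M. Y n \<omega> \<le> x - 1 / real (Suc k)} - (1 - prob (G n))) \<longlonglongrightarrow> ?F (x - 1 / real (Suc k)) - 0"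
      by (intro tendsto_diff conv G0)
    then have "\<forall>\<^sub>F n in sequentially. a < prob {\<omega> \<in> space M. Y n \<omega> \<le> x - 1 / real (Suc k)} - (1 - prob (G n))"
      using k by (auto dest: order_tendstoD)
    moreover have "0 < 1 / real (Suc k)" by simp
    note up[OF this]
    ultimately show "\<forall>\<^sub>F n in sequentially. a < prob {\<omega> \<in> space M. T n \<omega> \<le> ereal x}"
      by eventually_elim linarith
  qed
qed (use T in auto)

section \<open>Characteristic functions of degenerate quadratic forms\<close>

text \<open>The inequality \<open>2 * y \<le> eta + y ^ 2 / eta\<close>, multiplied by
  \<open>y ^ 2\<close>. It replaces third moments by second and fourth ones, with a weight
  \<open>eta\<close> that is fixed only when the errors are summed.\<close>

lemma cubic_le_quadratic_quartic:
  fixes y eta :: real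
  assumes "0 < eta" "0 \<le> y"
  shows "y ^ 3 \<le> (eta * y\<^sup>2 + y ^ 4 / eta) / 2"
proof -
  have "0 \<le> (y - eta)\<^sup>2" by simp
  then have "2 * y * eta \<le> eta * eta + y\<^sup>2" by (simp add: power2_eq_square algebra_simps)
  then have "2 * y \<le> eta + y\<^sup>2 / eta" using assms by (simp add: field_simps power2_eq_square)
  then have "y\<^sup>2 * (2 * y) \<le> y\<^sup>2 * (eta + y\<^sup>2 / eta)" by (rule mult_left_mono) simp
  also have "\<dots> = eta * y\<^sup>2 + y ^ 4 / eta" by (simp add: distrib_left flip: power_add)
  finally show ?thesis by (simp add: power3_eq_cube power2_eq_square)
qed

text \<open>Two remainder bounds for one expansion: the cubic one for a part with four moments, the
  quadratic one for a part of which only second moments are controlled.\<close>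

lemma iexp_second_order:
  fixes x :: real
  defines "T \<equiv> 1 + \<i> * complex_of_real x - complex_of_real (x\<^sup>2 / 2)"
  shows "cmod (iexp x - T) \<le> \<bar>x\<bar> ^ 3 / 6" "cmod (iexp x - T) \<le> x\<^sup>2"
proof -
  have T: "(\<Sum>k\<le>2. (\<i> * complex_of_real x) ^ k / fact k) = T"
  proof -
    have "(\<Sum>k\<le>2. g k) = g 0 + g 1 + g 2" for g :: "nat \<Rightarrow> complex"
      by (simp add: numeral_2_eq_2)
    then show ?thesis by (simp add: T_def power_mult_distrib)
  qed
  show "cmod (iexp x - T) \<le> \<bar>x\<bar> ^ 3 / 6"
    using iexp_approx1[of x 2] unfolding T by (simp add: fact_numeral eval_nat_numeral)
  show "cmod (iexp x - T) \<le> x\<^sup>2"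
    using iexp_approx2[of x 2] unfolding T by (simp add: fact_numeral)
qed

text \<open>The sum is at most twice the larger of the two parts. If \<open>l\<close> dominates, the
  cubic bound is used, otherwise the quadratic one, so that only a second moment of \<open>c\<close>
  enters.\<close>

lemma iexp_sum_second_order:
  fixes l c th eta :: real
  assumes "0 < eta"
  shows "cmod (iexp (th * (l + c)) - (1 + \<i> * complex_of_real (th * (l + c)) - complex_of_real ((th * (l + c))\<^sup>2 / 2)))
    \<le> 2 / 3 * (eta * (th * l)\<^sup>2 + (th * l) ^ 4 / eta) + 4 * (th * c)\<^sup>2" (is "?N \<le> _")
proof (cases "\<bar>c\<bar> \<le> \<bar>l\<bar>")
  case True
  have "\<bar>th * (l + c)\<bar> \<le> \<bar>th\<bar> * (2 * \<bar>l\<bar>)"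
    unfolding abs_mult using True by (intro mult_left_mono) auto
  then have "\<bar>th * (l + c)\<bar> ^ 3 \<le> (2 * \<bar>th * l\<bar>) ^ 3"
    by (intro power_mono) (auto simp: abs_mult)
  then have "?N \<le> (2 * \<bar>th * l\<bar>) ^ 3 / 6" using iexp_second_order(1)[of "th * (l + c)"] by linarith
  also have "\<dots> = 4 / 3 * \<bar>th * l\<bar> ^ 3" by (simp add: power_mult_distrib)
  also have "\<dots> \<le> 4 / 3 * ((eta * \<bar>th * l\<bar>\<^sup>2 + \<bar>th * l\<bar> ^ 4 / eta) / 2)"
    by (intro mult_left_mono cubic_le_quadratic_quartic assms) auto
  also have "\<dots> = 2 / 3 * (eta * (th * l)\<^sup>2 + (th * l) ^ 4 / eta)" by simp
  finally show ?thesis by (simp add: add_increasing2)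
next
  case False
  have "\<bar>th * (l + c)\<bar> \<le> \<bar>th\<bar> * (2 * \<bar>c\<bar>)"
    unfolding abs_mult using False by (intro mult_left_mono) auto
  then have "\<bar>th * (l + c)\<bar>\<^sup>2 \<le> (2 * \<bar>th * c\<bar>)\<^sup>2"
    by (intro power_mono) (auto simp: abs_mult)
  then have "?N \<le> 4 * (th * c)\<^sup>2" using iexp_second_order(2)[of "th * (l + c)"] by (simp add: power_mult_distrib)
  moreover have "0 \<le> 2 / 3 * (eta * (th * l)\<^sup>2 + (th * l) ^ 4 / eta)" using assms by simp
  ultimately show ?thesis by linarith
qed

context prob_space
begin

lemma integrable_power_le:
  fixes f :: "'a \<Rightarrow> real"
  assumes [measurable]: "f \<in> borel_measurable M" and "integrable M (\<lambda>x. \<bar>f x\<bar> ^ n)" "k \<le> n"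
  shows "integrable M (\<lambda>x. f x ^ k)"
proof (rule Bochner_Integration.integrable_bound[of M "\<lambda>x. 1 + \<bar>f x\<bar> ^ n"])
  show "AE x in M. norm (f x ^ k) \<le> norm (1 + \<bar>f x\<bar> ^ n)"
  proof (rule AE_I2)
    fix x
    have "\<bar>f x\<bar> ^ k \<le> 1 + \<bar>f x\<bar> ^ n"
    proof (cases "\<bar>f x\<bar> \<le> 1")
      case True
      then have "\<bar>f x\<bar> ^ k \<le> 1" by (simp add: power_le_one)
      then show ?thesis by (simp add: add_increasing2)
    next
      case False
      then have "\<bar>f x\<bar> ^ k \<le> \<bar>f x\<bar> ^ n" using assms by (intro power_increasing) auto
      then show ?thesis by simp
    qed
    then show "norm (f x ^ k) \<le> norm (1 + \<bar>f x\<bar> ^ n)" by (simp add: power_abs)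
  qed
qed (use assms in simp_all)

lemma expectation_affine3:
  fixes X Y Z :: "'a \<Rightarrow> real"
  assumes "integrable M X" "integrable M Y" "integrable M Z"
  shows "expectation (\<lambda>x. a * X x + b * Y x + c * Z x + e) = a * expectation X + b * expectation Y + c * expectation Z + e"
  using assms by (simp add: prob_space)

text \<open>\<open>l\<close> will be the linear and \<open>c\<close> the centred quadratic part of
  an increment. Both have mean 0, so the first order term drops out; in the second order term only
  the variance of \<open>l\<close> is kept as main term, the rest being error.\<close>

lemma charfun_sum_approx:
  fixes l c :: "'a \<Rightarrow> real"
  assumes [measurable]: "l \<in> borel_measurable M" "c \<in> borel_measurable M"
    and l4: "integrable M (\<lambda>x. l x ^ 4)" and c2: "integrable M (\<lambda>x. (c x)\<^sup>2)"
    and l0: "expectation l = 0" and c0: "expectation c = 0" and eta: "0 < eta"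
  shows "cmod ((\<integral>x. iexp (th * (l x + c x)) \<partial>M) - complex_of_real (1 - th\<^sup>2 / 2 * expectation (\<lambda>x. (l x)\<^sup>2)))
    \<le> 2 / 3 * (eta * th\<^sup>2 * expectation (\<lambda>x. (l x)\<^sup>2) + th ^ 4 * expectation (\<lambda>x. l x ^ 4) / eta)
      + 4 * th\<^sup>2 * expectation (\<lambda>x. (c x)\<^sup>2)
      + th\<^sup>2 / 2 * (eta * expectation (\<lambda>x. (l x)\<^sup>2) + (1 / eta + 1) * expectation (\<lambda>x. (c x)\<^sup>2))"
proof -
  have l4': "integrable M (\<lambda>x. \<bar>l x\<bar> ^ 4)" using l4 by (simp add: power_even_abs)
  have il: "integrable M l" using integrable_power_le[OF _ l4', of 1] by simp
  have il2: "integrable M (\<lambda>x. (l x)\<^sup>2)" using integrable_power_le[OF _ l4', of 2] by simp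
  have ic: "integrable M c" using integrable_power_le[of c 2 1] c2 by simp
  have ilc: "integrable M (\<lambda>x. l x * c x)"
  proof (rule Bochner_Integration.integrable_bound[of M "\<lambda>x. (l x)\<^sup>2 + (c x)\<^sup>2"])
    have "\<bar>a * b\<bar> \<le> \<bar>a\<^sup>2 + b\<^sup>2\<bar>" for a b :: real
    proof -
      have "2 * \<bar>a\<bar> * \<bar>b\<bar> \<le> a\<^sup>2 + b\<^sup>2" using sum_squares_bound[of "\<bar>a\<bar>" "\<bar>b\<bar>"] by simp
      moreover have "0 \<le> \<bar>a\<bar> * \<bar>b\<bar>" by simp
      ultimately show ?thesis unfolding abs_mult by linarith
    qed
    then show "AE x in M. norm (l x * c x) \<le> norm ((l x)\<^sup>2 + (c x)\<^sup>2)" by simp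
  qed (use il2 c2 in simp_all)
  define D where "D = (\<lambda>x. l x + c x)"
  have [measurable]: "D \<in> borel_measurable M" by (simp add: D_def)
  have D0: "expectation D = 0" "integrable M D" using il ic l0 c0 by (simp_all add: D_def)
  have D2: "(D x)\<^sup>2 = (l x)\<^sup>2 + 2 * (l x * c x) + (c x)\<^sup>2" for x
    by (simp add: D_def power2_sum)
  have iD2: "integrable M (\<lambda>x. (D x)\<^sup>2)" unfolding D2 using il2 ilc c2 by simp
  have eD2: "expectation (\<lambda>x. (D x)\<^sup>2) = expectation (\<lambda>x. (l x)\<^sup>2) + 2 * expectation (\<lambda>x. l x * c x) + expectation (\<lambda>x. (c x)\<^sup>2)"
    unfolding D2 using il2 ilc c2 by simp
  define T where "T = (\<lambda>x. 1 + \<i> * complex_of_real (th * D x) - complex_of_real ((th * D x)\<^sup>2 / 2))"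
  have iT: "integrable M T"
    unfolding T_def power_mult_distrib using D0 iD2 by (intro Bochner_Integration.integrable_diff Bochner_Integration.integrable_add integrable_mult_right integrable_of_real) auto
  have eT: "(\<integral>x. T x \<partial>M) = complex_of_real (1 - th\<^sup>2 / 2 * expectation (\<lambda>x. (D x)\<^sup>2))"
  proof -
    have "(\<integral>x. T x \<partial>M) = (\<integral>x. 1 + \<i> * complex_of_real (th * D x) \<partial>M) - (\<integral>x. complex_of_real ((th * D x)\<^sup>2 / 2) \<partial>M)"
      unfolding T_def power_mult_distrib using D0 iD2
      by (intro Bochner_Integration.integral_diff Bochner_Integration.integrable_add integrable_mult_right integrable_of_real) auto
    also have "(\<integral>x. 1 + \<i> * complex_of_real (th * D x) \<partial>M) = 1 + \<i> * complex_of_real (th * expectation D)"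
      using D0 by (simp add: prob_space)
    also have "(\<integral>x. complex_of_real ((th * D x)\<^sup>2 / 2) \<partial>M) = complex_of_real (th\<^sup>2 / 2 * expectation (\<lambda>x. (D x)\<^sup>2))"
      unfolding integral_complex_of_real by (simp add: power_mult_distrib)
    finally show ?thesis using D0 by simp
  qed
  have iI: "integrable M (\<lambda>x. iexp (th * D x))"
    by (rule integrable_const_bound[of _ 1]) auto
  define B where "B = (\<lambda>x. 2 / 3 * (eta * (th * l x)\<^sup>2 + (th * l x) ^ 4 / eta) + 4 * (th * c x)\<^sup>2)"
  have iB: "integrable M B" unfolding B_def power_mult_distrib using il2 l4 c2 by simp
  have eB: "expectation B = 2 / 3 * (eta * th\<^sup>2 * expectation (\<lambda>x. (l x)\<^sup>2) + th ^ 4 * expectation (\<lambda>x. l x ^ 4) / eta)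
      + 4 * th\<^sup>2 * expectation (\<lambda>x. (c x)\<^sup>2)"
    unfolding B_def power_mult_distrib using il2 l4 c2 by simp
  have "cmod ((\<integral>x. iexp (th * D x) \<partial>M) - (\<integral>x. T x \<partial>M)) = cmod (\<integral>x. iexp (th * D x) - T x \<partial>M)"
    using iI iT by simp
  also have "\<dots> \<le> (\<integral>x. cmod (iexp (th * D x) - T x) \<partial>M)" by (rule integral_norm_bound)
  also have "\<dots> \<le> expectation B"
  proof (rule integral_mono)
    show "cmod (iexp (th * D x) - T x) \<le> B x" for x
      using iexp_sum_second_order[OF eta, of th "l x" "c x"] by (simp add: D_def T_def B_def)
  qed (use iB iI iT in auto)
  finally have 1: "cmod ((\<integral>x. iexp (th * D x) \<partial>M) - (\<integral>x. T x \<partial>M)) \<le> expectation B" .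
  \<comment> \<open>The covariance is split by the weighted inequality between means, with the same
    \<open>eta\<close> as in the cubic remainder.\<close>
  have lc: "\<bar>2 * expectation (\<lambda>x. l x * c x)\<bar> \<le> eta * expectation (\<lambda>x. (l x)\<^sup>2) + 1 / eta * expectation (\<lambda>x. (c x)\<^sup>2)"
  proof -
    have "\<bar>expectation (\<lambda>x. 2 * (l x * c x))\<bar> \<le> expectation (\<lambda>x. \<bar>2 * (l x * c x)\<bar>)"
      by (rule integral_abs_bound)
    also have "\<dots> \<le> expectation (\<lambda>x. eta * (l x)\<^sup>2 + 1 / eta * (c x)\<^sup>2)"
    proof (rule integral_mono)
      fix x
      have "0 \<le> (eta * \<bar>l x\<bar> - \<bar>c x\<bar>)\<^sup>2" by simp
      then have "eta * (2 * (\<bar>l x\<bar> * \<bar>c x\<bar>)) \<le> eta * (eta * (l x)\<^sup>2) + (c x)\<^sup>2"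
        by (simp add: power2_diff power_mult_distrib) (simp add: power2_eq_square algebra_simps)
      also have "\<dots> = eta * (eta * (l x)\<^sup>2 + 1 / eta * (c x)\<^sup>2)" using eta by (simp add: distrib_left)
      finally show "\<bar>2 * (l x * c x)\<bar> \<le> eta * (l x)\<^sup>2 + 1 / eta * (c x)\<^sup>2" using eta by (simp add: abs_mult)
    qed (use il2 c2 ilc in auto)
    also have "\<dots> = eta * expectation (\<lambda>x. (l x)\<^sup>2) + 1 / eta * expectation (\<lambda>x. (c x)\<^sup>2)"
      using il2 c2 by simp
    finally show ?thesis by simp
  qed
  have ec: "0 \<le> expectation (\<lambda>x. (c x)\<^sup>2)" by simp
  have "cmod ((\<integral>x. T x \<partial>M) - complex_of_real (1 - th\<^sup>2 / 2 * expectation (\<lambda>x. (l x)\<^sup>2)))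
      = \<bar>th\<^sup>2 / 2 * (2 * expectation (\<lambda>x. l x * c x) + expectation (\<lambda>x. (c x)\<^sup>2))\<bar>"
  proof -
    have "(1 - t * (A + 2 * B + C)) - (1 - t * A) = - (t * (2 * B + C))" for t A B C :: real
      by (simp add: algebra_simps)
    then show ?thesis unfolding eT of_real_diff[symmetric] norm_of_real eD2 by (simp only: abs_minus_cancel)
  qed
  also have "\<dots> = th\<^sup>2 / 2 * \<bar>2 * expectation (\<lambda>x. l x * c x) + expectation (\<lambda>x. (c x)\<^sup>2)\<bar>"
    by (simp add: abs_mult)
  also have "\<dots> \<le> th\<^sup>2 / 2 * (eta * expectation (\<lambda>x. (l x)\<^sup>2) + (1 / eta + 1) * expectation (\<lambda>x. (c x)\<^sup>2))"
  proof (rule mult_left_mono)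
    have "(1 / eta + 1) * expectation (\<lambda>x. (c x)\<^sup>2) = 1 / eta * expectation (\<lambda>x. (c x)\<^sup>2) + expectation (\<lambda>x. (c x)\<^sup>2)"
      by (simp add: distrib_right)
    then show "\<bar>2 * expectation (\<lambda>x. l x * c x) + expectation (\<lambda>x. (c x)\<^sup>2)\<bar>
        \<le> eta * expectation (\<lambda>x. (l x)\<^sup>2) + (1 / eta + 1) * expectation (\<lambda>x. (c x)\<^sup>2)"
      using lc ec by linarith
  qed simp
  finally have 2: "cmod ((\<integral>x. T x \<partial>M) - complex_of_real (1 - th\<^sup>2 / 2 * expectation (\<lambda>x. (l x)\<^sup>2)))
      \<le> th\<^sup>2 / 2 * (eta * expectation (\<lambda>x. (l x)\<^sup>2) + (1 / eta + 1) * expectation (\<lambda>x. (c x)\<^sup>2))" .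
  show ?thesis
    using norm_diff_triangle_le[OF 1 2] unfolding eB D_def .
qed

end

section \<open>Whitened quadratic forms and their change by one further observation\<close>

lemma abs_le_nrm: "i < d \<Longrightarrow> \<bar>u i\<bar> \<le> nrm d u"
proof -
  assume "i < d"
  then have "u i * u i \<le> ip d u u" unfolding ip_def by (intro member_le_sum) auto
  then show ?thesis unfolding nrm_def by (intro real_le_rsqrt) (simp add: power2_eq_square)
qed

lemma nrm_sum: "nrm d (\<lambda>i. \<Sum>j\<in>J. x j i) \<le> (\<Sum>j\<in>J. nrm d (x j))"
proof (induction J rule: infinite_finite_induct)
  case (insert j J)
  then show ?case using nrm_triangle[of d "x j" "\<lambda>i. \<Sum>j\<in>J. x j i"] by simp
qed (simp_all add: nrm_def ip_def)

text \<open>Each \<open>a j\<close> is at most the fourth root of the sum of fourth powers. The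
  constant is not sharp; the bound serves integrability only.\<close>

lemma sum_power4_le:
  fixes a :: "'i \<Rightarrow> real"
  assumes "finite J" "\<And>j. j \<in> J \<Longrightarrow> 0 \<le> a j"
  shows "(\<Sum>j\<in>J. a j) ^ 4 \<le> real (card J) ^ 4 * (\<Sum>j\<in>J. a j ^ 4)"
proof -
  let ?G = "\<Sum>j\<in>J. a j ^ 4"
  have G0: "0 \<le> ?G" by (intro sum_nonneg) auto
  have "a j \<le> root 4 ?G" if "j \<in> J" for j
  proof -
    have "a j ^ 4 \<le> ?G" using assms that by (intro member_le_sum) auto
    also have "\<dots> = root 4 ?G ^ 4" using G0 by (simp add: real_root_pow_pos2)
    finally show ?thesis using G0 by (subst (asm) power_mono_iff) (use assms that in auto)
  qed
  then have "(\<Sum>j\<in>J. a j) \<le> real (card J) * root 4 ?G" by (rule sum_bounded_above)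
  then have "(\<Sum>j\<in>J. a j) ^ 4 \<le> (real (card J) * root 4 ?G) ^ 4"
    by (intro power_mono sum_nonneg assms)
  then show ?thesis using G0 by (simp add: power_mult_distrib real_root_pow_pos2)
qed

lemma exp_minus_second_order:
  fixes x :: real
  assumes "0 \<le> x"
  shows "\<bar>1 - x - exp (- x)\<bar> \<le> x\<^sup>2"
proof -
  have "1 - x \<le> exp (- x)" using exp_ge_add_one_self[of "-x"] by simp
  moreover have "exp (- x) \<le> 1 - x + x\<^sup>2"
  proof -
    have "exp (- x) * exp x = 1" by (simp flip: exp_add)
    moreover have "exp (- x) * (1 + x) \<le> exp (- x) * exp x"
      using exp_ge_add_one_self[of x] by (intro mult_left_mono) auto
    ultimately have "exp (- x) * (1 + x) \<le> 1" by linarith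
    \<comment> \<open>The product on the right is \<open>1 + x ^ 3\<close>.\<close>
    also have "1 \<le> (1 - x + x\<^sup>2) * (1 + x)"
      using assms by (simp add: algebra_simps power2_eq_square)
    finally show ?thesis using assms by (subst (asm) mult_le_cancel_right) auto
  qed
  ultimately show ?thesis by (simp add: abs_le_iff)
qed

locale whitened_quadratic_form = prob_space Q for Q :: "'z measure" +
  fixes d :: nat and f :: "'z \<Rightarrow> nat \<Rightarrow> real" and W P :: "nat \<Rightarrow> nat \<Rightarrow> real" and lam :: real
  assumes f_meas: "\<And>i. i < d \<Longrightarrow> (\<lambda>z. f z i) \<in> borel_measurable Q"
    and f_fourth: "integrable Q (\<lambda>z. nrm d (f z) ^ 4)"
    and f_mean: "\<And>i. i < d \<Longrightarrow> (\<integral>z. f z i \<partial>Q) = 0"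
    and f_cov: "\<And>i k. i < d \<Longrightarrow> k < d \<Longrightarrow> (\<integral>z. f z i * f z k \<partial>Q) = W i k"
    and P_sym: "\<And>i k. i < d \<Longrightarrow> k < d \<Longrightarrow> P i k = P k i"
    and P_inv: "\<And>i k. i < d \<Longrightarrow> k < d \<Longrightarrow> (\<Sum>l<d. W i l * P l k) = (if i = k then 1 else 0)"
    and lam: "0 < lam"
    and W_pd: "\<And>u. lam * (nrm d u)\<^sup>2 \<le> ip d u (mapp d W u)"
begin

lemma W_sym: "i < d \<Longrightarrow> k < d \<Longrightarrow> W i k = W k i"
  by (simp add: f_cov[symmetric] mult.commute)

lemma ip_meas [measurable]: "(\<lambda>z. ip d u (f z)) \<in> borel_measurable Q"
  unfolding ip_def using f_meas by measurable

lemma nrm_meas [measurable]: "(\<lambda>z. nrm d (f z)) \<in> borel_measurable Q"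
  unfolding nrm_def ip_def using f_meas by measurable

lemma quad_meas [measurable]: "(\<lambda>z. ip d (f z) (mapp d P (f z))) \<in> borel_measurable Q"
  unfolding mapp_def ip_def using f_meas by measurable

lemma nrm_integrable: "k \<le> 4 \<Longrightarrow> integrable Q (\<lambda>z. nrm d (f z) ^ k)"
  by (rule integrable_power_le[of _ 4]) (use f_fourth in simp_all)

lemma ff_integrable:
  assumes "i < d" "k < d" shows "integrable Q (\<lambda>z. f z i * f z k)"
proof (rule Bochner_Integration.integrable_bound[OF nrm_integrable[of 2]])
  show "AE z in Q. norm (f z i * f z k) \<le> norm ((nrm d (f z))\<^sup>2)"
    using mult_mono[OF abs_le_nrm[OF assms(1)] abs_le_nrm[OF assms(2)]]
    by (simp add: abs_mult power2_eq_square)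
  show "(\<lambda>z. f z i * f z k) \<in> borel_measurable Q" using f_meas assms by measurable
qed simp

lemma f_integrable: "i < d \<Longrightarrow> integrable Q (\<lambda>z. f z i)"
  by (rule Bochner_Integration.integrable_bound[OF nrm_integrable[of 1]]) (use f_meas in \<open>auto simp: abs_le_nrm\<close>)

lemma ip_mean: "(\<integral>z. ip d u (f z) \<partial>Q) = 0" "integrable Q (\<lambda>z. ip d u (f z))"
proof -
  have int: "integrable Q (\<lambda>z. u i * f z i)" if "i < d" for i using f_integrable[OF that] by simp
  show "integrable Q (\<lambda>z. ip d u (f z))"
    unfolding ip_def by (rule Bochner_Integration.integrable_sum) (use int in auto)
  have "(\<integral>z. ip d u (f z) \<partial>Q) = (\<Sum>i<d. \<integral>z. u i * f z i \<partial>Q)"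
    unfolding ip_def by (rule Bochner_Integration.integral_sum) (use int in auto)
  then show "(\<integral>z. ip d u (f z) \<partial>Q) = 0" by (simp add: f_mean)
qed

lemma double_sum_expectation:
  "(\<integral>z. (\<Sum>i<d. \<Sum>k<d. a i k * (f z i * f z k)) \<partial>Q) = (\<Sum>i<d. \<Sum>k<d. a i k * W i k)"
proof -
  have int: "integrable Q (\<lambda>z. a i k * (f z i * f z k))" if "i < d" "k < d" for i k
    using ff_integrable[OF that] by simp
  have "(\<integral>z. (\<Sum>i<d. \<Sum>k<d. a i k * (f z i * f z k)) \<partial>Q) = (\<Sum>i<d. \<integral>z. (\<Sum>k<d. a i k * (f z i * f z k)) \<partial>Q)"
    by (intro Bochner_Integration.integral_sum Bochner_Integration.integrable_sum int) auto
  also have "\<dots> = (\<Sum>i<d. \<Sum>k<d. \<integral>z. a i k * (f z i * f z k) \<partial>Q)"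
    by (intro sum.cong refl Bochner_Integration.integral_sum int) auto
  also have "\<dots> = (\<Sum>i<d. \<Sum>k<d. a i k * W i k)"
    by (intro sum.cong refl) (simp add: f_cov)
  finally show ?thesis .
qed

lemma ip_cov: "(\<integral>z. ip d u (f z) * ip d v (f z) \<partial>Q) = ip d u (mapp d W v)"
proof -
  have "(\<integral>z. ip d u (f z) * ip d v (f z) \<partial>Q) = (\<integral>z. (\<Sum>i<d. \<Sum>k<d. u i * v k * (f z i * f z k)) \<partial>Q)"
    unfolding ip_def sum_product by (simp only: mult_ac)
  also have "\<dots> = (\<Sum>i<d. \<Sum>k<d. u i * v k * W i k)"
    by (rule double_sum_expectation)
  also have "\<dots> = ip d u (mapp d W v)"
    unfolding ip_def mapp_def sum_distrib_left by (intro sum.cong refl) simp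
  finally show ?thesis .
qed

text \<open>The squared norm of \<open>W^(-1/2) s\<close>, written with the inverse of
  \<open>W\<close> so that no matrix square root is formed.\<close>

definition quad :: "(nat \<Rightarrow> real) \<Rightarrow> real" where "quad s = ip d s (mapp d P s)"
definition lin :: "(nat \<Rightarrow> real) \<Rightarrow> 'z \<Rightarrow> real" where "lin s z = 2 * ip d (mapp d P s) (f z)"
text \<open>It dominates the second moment of \<open>quad (f z)\<close> and, multiplied by
  \<open>16 * (quad s) ^ 2\<close>, the fourth moment of \<open>lin s\<close>. The two powers of
  \<open>lam\<close> come from bounding \<open>P\<close> by \<open>1 / lam\<close> twice.\<close>

definition K4 :: real where "K4 = (\<integral>z. nrm d (f z) ^ 4 \<partial>Q) / lam\<^sup>2"

text \<open>Brings the form into a shape to which the lower bound for \<open>W\<close> applies, at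
  the vector \<open>P s\<close>. Both \<open>quad_nonneg\<close> and \<open>nrm_P_le\<close> rest on
  it.\<close>

lemma quad_eq: "quad s = ip d (mapp d P s) (mapp d W (mapp d P s))"
proof -
  have "ip d (mapp d P s) (mapp d W (mapp d P s)) = ip d (mapp d P s) s"
    by (rule ip_cong) (auto intro: mapp_inverse P_inv)
  then show ?thesis by (simp add: quad_def ip_commute)
qed

lemma nrm_P_le: "(nrm d (mapp d P s))\<^sup>2 \<le> quad s / lam"
  using W_pd[of "mapp d P s"] lam by (simp add: quad_eq[symmetric] pos_le_divide_eq mult.commute)

lemma quad_nonneg: "0 \<le> quad s"
proof -
  have "0 \<le> lam * (nrm d (mapp d P s))\<^sup>2" using lam by simp
  then show ?thesis using W_pd[of "mapp d P s"] by (simp add: quad_eq)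
qed

lemma quad_le: "quad s \<le> (nrm d s)\<^sup>2 / lam"
proof -
  have "quad s \<le> nrm d s * (nrm d s / lam)"
    unfolding quad_def
    by (rule order_trans[OF order_trans[OF abs_ge_self ip_Cauchy_Schwarz] mult_left_mono[OF nrm_mapp_inverse_le[OF lam P_inv W_pd]]]) auto
  then show ?thesis by (simp add: power2_eq_square)
qed

lemma quad_add: "quad (\<lambda>i. s i + f z i) = quad s + (lin s z + quad (f z))"
proof -
  have "ip d s (mapp d P (f z)) = ip d (f z) (mapp d P s)" by (rule ip_mapp_sym[OF P_sym])
  then show ?thesis
    unfolding quad_def lin_def mapp_add ip_add_left ip_add_right by (simp add: ip_commute[of d "mapp d P s"])
qed

lemma lin_meas [measurable]: "lin s \<in> borel_measurable Q" unfolding lin_def[abs_def] by measurable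
lemma quad_f_meas [measurable]: "(\<lambda>z. quad (f z)) \<in> borel_measurable Q" unfolding quad_def by measurable

lemma lin_mean: "(\<integral>z. lin s z \<partial>Q) = 0" unfolding lin_def by (simp add: ip_mean)

text \<open>The covariance of \<open>f\<close> cancels one of the two factors \<open>P\<close>. The
  variance of the linear part thus depends on the past \<open>s\<close> only through
  \<open>quad s\<close>, which is what closes the recursion.\<close>

lemma lin_second: "(\<integral>z. (lin s z)\<^sup>2 \<partial>Q) = 4 * quad s"
  unfolding lin_def power_mult_distrib by (simp add: power2_eq_square[of "ip _ _ _"] ip_cov quad_eq)

lemma lin_power4_le: "lin s z ^ 4 \<le> 16 * (quad s / lam)\<^sup>2 * nrm d (f z) ^ 4"
proof -
  have "lin s z ^ 4 = 16 * \<bar>ip d (mapp d P s) (f z)\<bar> ^ 4" by (simp add: lin_def power_mult_distrib power_even_abs)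
  also have "\<dots> \<le> 16 * (nrm d (mapp d P s) * nrm d (f z)) ^ 4"
    by (intro mult_left_mono power_mono ip_Cauchy_Schwarz) auto
  also have "\<dots> = 16 * ((nrm d (mapp d P s))\<^sup>2)\<^sup>2 * nrm d (f z) ^ 4"
    by (simp add: power_mult_distrib flip: power_mult)
  also have "\<dots> \<le> 16 * (quad s / lam)\<^sup>2 * nrm d (f z) ^ 4"
    by (intro mult_right_mono mult_left_mono power_mono nrm_P_le) auto
  finally show ?thesis .
qed

lemma lin_fourth: "integrable Q (\<lambda>z. lin s z ^ 4)" "(\<integral>z. lin s z ^ 4 \<partial>Q) \<le> 16 * (quad s)\<^sup>2 * K4"
proof -
  show int: "integrable Q (\<lambda>z. lin s z ^ 4)"
    by (rule Bochner_Integration.integrable_bound[of _ "\<lambda>z. 16 * (quad s / lam)\<^sup>2 * nrm d (f z) ^ 4"])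
      (use f_fourth lin_power4_le in auto)
  have "(\<integral>z. lin s z ^ 4 \<partial>Q) \<le> (\<integral>z. 16 * (quad s / lam)\<^sup>2 * nrm d (f z) ^ 4 \<partial>Q)"
    by (rule integral_mono[OF int]) (use f_fourth lin_power4_le in auto)
  then show "(\<integral>z. lin s z ^ 4 \<partial>Q) \<le> 16 * (quad s)\<^sup>2 * K4"
    by (simp add: K4_def power_divide)
qed

lemma quad_f_sq_le: "(quad (f z))\<^sup>2 \<le> nrm d (f z) ^ 4 / lam\<^sup>2"
proof -
  have "(quad (f z))\<^sup>2 \<le> ((nrm d (f z))\<^sup>2 / lam)\<^sup>2" by (rule power_mono[OF quad_le quad_nonneg])
  then show ?thesis by (simp add: power_divide flip: power_mult)
qed

lemma quad_f_second: "integrable Q (\<lambda>z. (quad (f z))\<^sup>2)" "(\<integral>z. (quad (f z))\<^sup>2 \<partial>Q) \<le> K4"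
proof -
  show int: "integrable Q (\<lambda>z. (quad (f z))\<^sup>2)"
    by (rule Bochner_Integration.integrable_bound[of _ "\<lambda>z. nrm d (f z) ^ 4 / lam\<^sup>2"])
      (use f_fourth quad_f_sq_le in auto)
  have "(\<integral>z. (quad (f z))\<^sup>2 \<partial>Q) \<le> (\<integral>z. nrm d (f z) ^ 4 / lam\<^sup>2 \<partial>Q)"
    by (rule integral_mono[OF int]) (use f_fourth quad_f_sq_le in auto)
  then show "(\<integral>z. (quad (f z))\<^sup>2 \<partial>Q) \<le> K4" by (simp add: K4_def)
qed

lemma quad_f_integrable: "integrable Q (\<lambda>z. quad (f z))"
  using integrable_power_le[of "\<lambda>z. quad (f z)" 2 1] quad_f_second by simp

text \<open>The expectation is the trace of \<open>P W\<close>, that is, of the identity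
  matrix.\<close>

lemma quad_f_mean: "(\<integral>z. quad (f z) \<partial>Q) = real d"
proof -
  have "(\<integral>z. quad (f z) \<partial>Q) = (\<integral>z. (\<Sum>i<d. \<Sum>k<d. P i k * (f z i * f z k)) \<partial>Q)"
    unfolding quad_def ip_def mapp_def sum_distrib_left by (simp only: mult_ac)
  also have "\<dots> = (\<Sum>i<d. \<Sum>k<d. P i k * W i k)"
    by (rule double_sum_expectation)
  also have "\<dots> = (\<Sum>i<d. \<Sum>k<d. W i k * P k i)"
    by (intro sum.cong refl) (simp add: P_sym)
  also have "\<dots> = real d" by (simp add: P_inv)
  finally show ?thesis .
qed

lemma quad_f_centered:
  "(\<integral>z. quad (f z) - real d \<partial>Q) = 0" "integrable Q (\<lambda>z. (quad (f z) - real d)\<^sup>2)"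
  "(\<integral>z. (quad (f z) - real d)\<^sup>2 \<partial>Q) \<le> K4"
proof -
  show "(\<integral>z. quad (f z) - real d \<partial>Q) = 0" using quad_f_integrable quad_f_mean by (simp add: prob_space)
  show "integrable Q (\<lambda>z. (quad (f z) - real d)\<^sup>2)"
    unfolding power2_diff using quad_f_integrable quad_f_second by simp
  have "(\<integral>z. (quad (f z) - real d)\<^sup>2 \<partial>Q) = (\<integral>z. (quad (f z))\<^sup>2 \<partial>Q) - (real d)\<^sup>2"
    unfolding power2_diff using quad_f_integrable quad_f_second quad_f_mean
    by (simp add: prob_space power2_eq_square)
  then show "(\<integral>z. (quad (f z) - real d)\<^sup>2 \<partial>Q) \<le> K4" using quad_f_second(2) zero_le_power2[of "real d"] by linarith
qed

lemma K4_nonneg: "0 \<le> K4" by (simp add: K4_def)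

text \<open>The bound of \<open>charfun_sum_approx\<close> with \<open>4 * x\<close> for the second
  and \<open>16 * x ^ 2 * K4\<close> for the fourth moment of the linear part, and \<open>K4\<close>
  for the variance of the quadratic part; \<open>x\<close> stands for \<open>quad s\<close>.\<close>

definition step_error :: "real \<Rightarrow> real \<Rightarrow> real \<Rightarrow> real" where
  "step_error th eta x = 2 / 3 * (eta * th\<^sup>2 * (4 * x) + th ^ 4 * (16 * x\<^sup>2 * K4) / eta) + 4 * th\<^sup>2 * K4
     + th\<^sup>2 / 2 * (eta * (4 * x) + (1 / eta + 1) * K4)"

lemma charfun_step:
  assumes eta: "0 < eta"
  shows "cmod ((\<integral>z. iexp (th * (lin s z + (quad (f z) - real d))) \<partial>Q) - complex_of_real (1 - 2 * th\<^sup>2 * quad s))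
    \<le> step_error th eta (quad s)"
proof -
  let ?c = "\<lambda>z. quad (f z) - real d"
  have "cmod ((\<integral>z. iexp (th * (lin s z + ?c z)) \<partial>Q) - complex_of_real (1 - th\<^sup>2 / 2 * (\<integral>z. (lin s z)\<^sup>2 \<partial>Q)))
    \<le> 2 / 3 * (eta * th\<^sup>2 * (\<integral>z. (lin s z)\<^sup>2 \<partial>Q) + th ^ 4 * (\<integral>z. lin s z ^ 4 \<partial>Q) / eta)
      + 4 * th\<^sup>2 * (\<integral>z. (?c z)\<^sup>2 \<partial>Q)
      + th\<^sup>2 / 2 * (eta * (\<integral>z. (lin s z)\<^sup>2 \<partial>Q) + (1 / eta + 1) * (\<integral>z. (?c z)\<^sup>2 \<partial>Q))"
    by (rule charfun_sum_approx) (use lin_fourth lin_mean quad_f_centered eta in auto)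
  also have "\<dots> \<le> step_error th eta (quad s)"
    unfolding lin_second step_error_def using eta
    by (intro add_mono mult_left_mono divide_right_mono lin_fourth quad_f_centered order_refl) auto
  finally have *: "cmod ((\<integral>z. iexp (th * (lin s z + ?c z)) \<partial>Q) - complex_of_real (1 - th\<^sup>2 / 2 * (4 * quad s)))
    \<le> step_error th eta (quad s)" unfolding lin_second .
  have "th\<^sup>2 / 2 * (4 * quad s) = 2 * th\<^sup>2 * quad s" by simp
  with * show ?thesis by (simp only:)
qed

lemma increment_second:
  "(\<integral>z. lin s z + (quad (f z) - real d) \<partial>Q) = 0" "integrable Q (\<lambda>z. lin s z + (quad (f z) - real d))"
  "integrable Q (\<lambda>z. (lin s z + (quad (f z) - real d))\<^sup>2)"
  "(\<integral>z. (lin s z + (quad (f z) - real d))\<^sup>2 \<partial>Q) \<le> 8 * quad s + 2 * K4"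
proof -
  let ?c = "\<lambda>z. quad (f z) - real d"
  have il: "integrable Q (lin s)" unfolding lin_def[abs_def] using ip_mean by simp
  have ic: "integrable Q ?c" using quad_f_integrable by simp
  show "integrable Q (\<lambda>z. lin s z + ?c z)" using il ic by (rule Bochner_Integration.integrable_add)
  show "(\<integral>z. lin s z + ?c z \<partial>Q) = 0"
    by (subst Bochner_Integration.integral_add[OF il ic]) (simp only: lin_mean quad_f_centered add_0_left)
  have il2: "integrable Q (\<lambda>z. (lin s z)\<^sup>2)"
    using integrable_power_le[of "lin s" 4 2] lin_fourth by (simp add: power_even_abs)
  have i2: "integrable Q (\<lambda>z. 2 * (lin s z)\<^sup>2 + 2 * (?c z)\<^sup>2)" using il2 quad_f_centered by simp
  have le: "(a + b)\<^sup>2 \<le> 2 * a\<^sup>2 + 2 * b\<^sup>2" for a b :: real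
    using sum_squares_bound[of a b] by (simp add: power2_sum)
  show i: "integrable Q (\<lambda>z. (lin s z + ?c z)\<^sup>2)"
    by (rule Bochner_Integration.integrable_bound[OF i2]) (use le in auto)
  have "(\<integral>z. (lin s z + ?c z)\<^sup>2 \<partial>Q) \<le> (\<integral>z. 2 * (lin s z)\<^sup>2 + 2 * (?c z)\<^sup>2 \<partial>Q)"
    by (rule integral_mono[OF i i2 le])
  also have "\<dots> = 2 * (4 * quad s) + 2 * (\<integral>z. (?c z)\<^sup>2 \<partial>Q)"
    using il2 quad_f_centered by (simp add: lin_second)
  finally show "(\<integral>z. (lin s z + ?c z)\<^sup>2 \<partial>Q) \<le> 8 * quad s + 2 * K4" using quad_f_centered(3) by linarith
qed

end

section \<open>The recursion for characteristic functions on the product space\<close>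

context whitened_quadratic_form
begin

definition sample_space :: "nat \<Rightarrow> (nat \<Rightarrow> 'z) measure" where
  "sample_space k = PiM {1..k} (\<lambda>_. Q)"

definition psum :: "nat \<Rightarrow> (nat \<Rightarrow> 'z) \<Rightarrow> nat \<Rightarrow> real" where
  "psum k x = (\<lambda>i. \<Sum>j=1..k. f (x j) i)"

text \<open>Centred at its mean, this is a martingale in \<open>k\<close>: by
  \<open>dev_Suc_upd\<close> and \<open>increment_second\<close> its increments have mean 0 given
  the past.\<close>

definition dev :: "nat \<Rightarrow> (nat \<Rightarrow> 'z) \<Rightarrow> real" where
  "dev k x = quad (psum k x) - real k * real d"

lemma prob_sample_space: "prob_space (sample_space k)"
  unfolding sample_space_def by (rule prob_space_PiM) (rule prob_space_axioms)

lemma psum_Suc_upd: "psum (Suc k) (x(Suc k := z)) = (\<lambda>i. psum k x i + f z i)"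
  by (simp add: psum_def fun_eq_iff)

lemma dev_Suc_upd: "dev (Suc k) (x(Suc k := z)) = dev k x + (lin (psum k x) z + (quad (f z) - real d))"
  unfolding dev_def psum_Suc_upd quad_add by (simp add: algebra_simps)

lemma component_meas: "j \<in> {1..k} \<Longrightarrow> (\<lambda>x. x j) \<in> measurable (sample_space k) Q"
  unfolding sample_space_def by (rule measurable_component_singleton)

lemma psum_meas: "i < d \<Longrightarrow> (\<lambda>x. psum k x i) \<in> borel_measurable (sample_space k)"
  unfolding psum_def
  by (intro borel_measurable_sum measurable_compose[OF component_meas f_meas]) auto

lemma quad_psum_meas [measurable]: "(\<lambda>x. quad (psum k x)) \<in> borel_measurable (sample_space k)"
  unfolding quad_def ip_def mapp_def using psum_meas by measurable

lemma dev_meas [measurable]: "dev k \<in> borel_measurable (sample_space k)"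
  unfolding dev_def[abs_def] by measurable

text \<open>Fubini's theorem in the product measure takes the place of conditioning on the first
  \<open>k\<close> observations; updating at \<open>Suc k\<close> adjoins the new one.\<close>

lemma sample_integral_Suc:
  fixes F :: "(nat \<Rightarrow> 'z) \<Rightarrow> 'b::{banach, second_countable_topology}"
  assumes "integrable (sample_space (Suc k)) F"
  shows "(\<integral>x. F x \<partial>sample_space (Suc k)) = (\<integral>x. (\<integral>z. F (x(Suc k := z)) \<partial>Q) \<partial>sample_space k)"
proof -
  interpret product_sigma_finite "\<lambda>_::nat. Q"
    by standard
  have "{1..Suc k} = insert (Suc k) {1..k}" by auto
  then show ?thesis
    using product_integral_insert[of "{1..k}" "Suc k" F] assms unfolding sample_space_def by simp
qed

lemma component_integrable:
  fixes g :: "'z \<Rightarrow> real"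
  assumes "j \<in> {1..k}" "integrable Q g"
  shows "integrable (sample_space k) (\<lambda>x. g (x j))"
proof -
  have "distr (sample_space k) Q (\<lambda>x. x j) = Q"
    unfolding sample_space_def by (rule distr_PiM_component) (use assms prob_space_axioms in auto)
  then show ?thesis
    using integrable_distr[OF component_meas[OF assms(1)], of g] assms by simp
qed

lemma quad_psum_sq_integrable: "integrable (sample_space k) (\<lambda>x. (quad (psum k x))\<^sup>2)"
proof (rule Bochner_Integration.integrable_bound[of _ "\<lambda>x. real k ^ 4 * (\<Sum>j=1..k. nrm d (f (x j)) ^ 4) / lam\<^sup>2"])
  show "integrable (sample_space k) (\<lambda>x. real k ^ 4 * (\<Sum>j=1..k. nrm d (f (x j)) ^ 4) / lam\<^sup>2)"
    by (intro integrable_divide integrable_mult_right Bochner_Integration.integrable_sum component_integrable f_fourth)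
  have le: "(quad (psum k x))\<^sup>2 \<le> real k ^ 4 * (\<Sum>j=1..k. nrm d (f (x j)) ^ 4) / lam\<^sup>2" for x
  proof -
    have "(quad (psum k x))\<^sup>2 \<le> ((nrm d (psum k x))\<^sup>2 / lam)\<^sup>2" by (rule power_mono[OF quad_le quad_nonneg])
    also have "\<dots> = nrm d (psum k x) ^ 4 / lam\<^sup>2" by (simp add: power_divide flip: power_mult)
    also have "\<dots> \<le> (\<Sum>j=1..k. nrm d (f (x j))) ^ 4 / lam\<^sup>2"
      unfolding psum_def by (intro divide_right_mono power_mono nrm_sum) auto
    also have "\<dots> \<le> real k ^ 4 * (\<Sum>j=1..k. nrm d (f (x j)) ^ 4) / lam\<^sup>2"
      using sum_power4_le[of "{1..k}" "\<lambda>j. nrm d (f (x j))"] by (intro divide_right_mono) auto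
    finally show ?thesis .
  qed
  show "AE x in sample_space k. norm ((quad (psum k x))\<^sup>2) \<le> norm (real k ^ 4 * (\<Sum>j=1..k. nrm d (f (x j)) ^ 4) / lam\<^sup>2)"
    unfolding real_norm_def abs_of_nonneg[OF zero_le_power2] by (intro AE_I2 order_trans[OF le abs_ge_self])
qed simp

lemma quad_psum_integrable: "integrable (sample_space k) (\<lambda>x. quad (psum k x))"
  using prob_space.integrable_power_le[OF prob_sample_space, of "\<lambda>x. quad (psum k x)" k 2 1]
    quad_psum_sq_integrable by simp

lemma dev_integrable: "integrable (sample_space k) (dev k)" "integrable (sample_space k) (\<lambda>x. (dev k x)\<^sup>2)"
proof -
  interpret S: prob_space "sample_space k" by (rule prob_sample_space)
  show "integrable (sample_space k) (dev k)"
    unfolding dev_def[abs_def] using quad_psum_integrable by simp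
  show "integrable (sample_space k) (\<lambda>x. (dev k x)\<^sup>2)"
    unfolding dev_def power2_diff using quad_psum_integrable quad_psum_sq_integrable by simp
qed

lemma psum_0: "quad (psum 0 x) = 0"
  by (simp add: psum_def quad_def ip_def mapp_def)

lemma quad_psum_mean: "(\<integral>x. quad (psum k x) \<partial>sample_space k) = real k * real d"
proof (induction k)
  case 0
  then show ?case by (simp add: psum_0)
next
  case (Suc k)
  interpret S: prob_space "sample_space k" by (rule prob_sample_space)
  have "(\<integral>x. quad (psum (Suc k) x) \<partial>sample_space (Suc k)) = (\<integral>x. (\<integral>z. quad (psum (Suc k) (x(Suc k := z))) \<partial>Q) \<partial>sample_space k)"
    by (rule sample_integral_Suc[OF quad_psum_integrable])
  also have "\<dots> = (\<integral>x. quad (psum k x) + real d \<partial>sample_space k)"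
  proof (intro Bochner_Integration.integral_cong refl)
    fix x
    have "(\<integral>z. quad (psum (Suc k) (x(Suc k := z))) \<partial>Q)
        = (\<integral>z. (quad (psum k x) + real d) + (lin (psum k x) z + (quad (f z) - real d)) \<partial>Q)"
      unfolding psum_Suc_upd quad_add by (intro Bochner_Integration.integral_cong refl) simp
    also have "\<dots> = quad (psum k x) + real d"
      by (subst Bochner_Integration.integral_add) (simp_all only: increment_second integrable_const lebesgue_integral_const prob_space, simp)
    finally show "(\<integral>z. quad (psum (Suc k) (x(Suc k := z))) \<partial>Q) = quad (psum k x) + real d" .
  qed
  also have "\<dots> = real (Suc k) * real d"
    using quad_psum_integrable Suc by (simp add: S.prob_space algebra_simps)
  finally show ?case .
qed

text \<open>Martingale increments are uncorrelated, and each adds at most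
  \<open>8 * quad + 2 * K4\<close>, where \<open>quad\<close> has mean \<open>k * d\<close>. Since
  \<open>4 * k ^ 2 + 8 * k \<le> 4 * (k + 1) ^ 2\<close>, the claimed form survives the step. The
  deviation is thus of order \<open>k * sqrt d\<close> when \<open>K4\<close> is at most of order
  \<open>d ^ 2\<close> and \<open>d ^ 2\<close> is small against \<open>k * d\<close>, against a
  mean of \<open>k * d\<close>.\<close>

lemma dev_second: "(\<integral>x. (dev k x)\<^sup>2 \<partial>sample_space k) \<le> 4 * (real k)\<^sup>2 * real d + 2 * real k * K4"
proof (induction k)
  case 0
  then show ?case by (simp add: dev_def psum_0)
next
  case (Suc k)
  interpret S: prob_space "sample_space k" by (rule prob_sample_space)
  have "(\<integral>x. (dev (Suc k) x)\<^sup>2 \<partial>sample_space (Suc k)) = (\<integral>x. (\<integral>z. (dev (Suc k) (x(Suc k := z)))\<^sup>2 \<partial>Q) \<partial>sample_space k)"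
    by (rule sample_integral_Suc[OF dev_integrable(2)])
  also have "\<dots> \<le> (\<integral>x. (dev k x)\<^sup>2 + (8 * quad (psum k x) + 2 * K4) \<partial>sample_space k)"
  proof -
    have le: "(\<integral>z. (dev (Suc k) (x(Suc k := z)))\<^sup>2 \<partial>Q) \<le> (dev k x)\<^sup>2 + (8 * quad (psum k x) + 2 * K4)" for x
    proof -
      let ?D = "\<lambda>z. lin (psum k x) z + (quad (f z) - real d)"
      have "(\<integral>z. (dev (Suc k) (x(Suc k := z)))\<^sup>2 \<partial>Q) = (\<integral>z. (dev k x)\<^sup>2 + 2 * dev k x * ?D z + (?D z)\<^sup>2 \<partial>Q)"
        unfolding dev_Suc_upd power2_sum by (intro Bochner_Integration.integral_cong refl) simp
      also have "\<dots> = (\<integral>z. (dev k x)\<^sup>2 + 2 * dev k x * ?D z \<partial>Q) + (\<integral>z. (?D z)\<^sup>2 \<partial>Q)"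
        by (rule Bochner_Integration.integral_add[OF Bochner_Integration.integrable_add[OF _ integrable_mult_right[OF increment_second(2)]] increment_second(3)]) simp
      also have "(\<integral>z. (dev k x)\<^sup>2 + 2 * dev k x * ?D z \<partial>Q) = (\<integral>z. (dev k x)\<^sup>2 \<partial>Q) + (\<integral>z. 2 * dev k x * ?D z \<partial>Q)"
        by (rule Bochner_Integration.integral_add[OF _ integrable_mult_right[OF increment_second(2)]]) simp
      also have "(\<integral>z. 2 * dev k x * ?D z \<partial>Q) = 0"
        by (simp only: integral_mult_right_zero increment_second mult_zero_right)
      also have "(\<integral>z. (dev k x)\<^sup>2 \<partial>Q) = (dev k x)\<^sup>2" by (simp add: prob_space)
      finally show ?thesis using increment_second(4)[of "psum k x"] by linarith
    qed
    have ge: "0 \<le> (\<integral>z. (dev (Suc k) (x(Suc k := z)))\<^sup>2 \<partial>Q)" for x by (rule Bochner_Integration.integral_nonneg) simp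
    have int: "integrable (sample_space k) (\<lambda>x. (dev k x)\<^sup>2 + (8 * quad (psum k x) + 2 * K4))"
      using dev_integrable quad_psum_integrable by simp
    show ?thesis by (rule integral_mono'[OF int le]) (rule order_trans[OF ge le])
  qed
  also have "\<dots> = (\<integral>x. (dev k x)\<^sup>2 \<partial>sample_space k) + (8 * (real k * real d) + 2 * K4)"
    using dev_integrable quad_psum_integrable by (simp add: quad_psum_mean S.prob_space)
  also have "\<dots> \<le> (4 * (real k)\<^sup>2 * real d + 2 * real k * K4) + (8 * (real k * real d) + 2 * K4)"
    using Suc by simp
  also have "\<dots> \<le> 4 * (real (Suc k))\<^sup>2 * real d + 2 * real (Suc k) * K4"
    by (simp add: power2_eq_square algebra_simps)
  finally show ?case .
qed

definition dev_bound :: "nat \<Rightarrow> real" where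
  "dev_bound n = 4 * (real n)\<^sup>2 * real d + 2 * real n * K4"

lemma dev_bound_nonneg: "0 \<le> dev_bound n" using K4_nonneg by (simp add: dev_bound_def)

lemma dev_second_le: "k \<le> n \<Longrightarrow> (\<integral>x. (dev k x)\<^sup>2 \<partial>sample_space k) \<le> dev_bound n"
proof -
  assume k: "k \<le> n"
  have "4 * (real k)\<^sup>2 * real d + 2 * real k * K4 \<le> dev_bound n"
    unfolding dev_bound_def using k K4_nonneg by (intro add_mono mult_right_mono mult_left_mono power_mono) auto
  then show ?thesis using dev_second[of k] by linarith
qed

lemma dev_first_le:
  assumes "k \<le> n" shows "(\<integral>x. \<bar>dev k x\<bar> \<partial>sample_space k) \<le> sqrt (dev_bound n)"
proof -
  interpret S: prob_space "sample_space k" by (rule prob_sample_space)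
  have "0 \<le> S.variance (\<lambda>x. \<bar>dev k x\<bar>)" by (rule S.variance_positive)
  then have "(S.expectation (\<lambda>x. \<bar>dev k x\<bar>))\<^sup>2 \<le> S.expectation (\<lambda>x. (dev k x)\<^sup>2)"
    using dev_integrable by (subst (asm) S.variance_eq) auto
  also have "\<dots> \<le> dev_bound n" by (rule dev_second_le[OF assms])
  finally show ?thesis by (rule real_le_rsqrt)
qed

lemma step_error_eq:
  "step_error th eta x = 14 / 3 * (eta * th\<^sup>2) * x + 32 / 3 * (th ^ 4 * K4 / eta) * x\<^sup>2
     + (4 * th\<^sup>2 * K4 + th\<^sup>2 / 2 * ((1 / eta + 1) * K4))"
proof -
  have 1: "th ^ 4 * (16 * x\<^sup>2 * K4) / eta = 16 * (th ^ 4 * K4 / eta * x\<^sup>2)" by simp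
  have 2: "th\<^sup>2 / 2 * (eta * (4 * x) + R) = 2 * (eta * th\<^sup>2 * x) + th\<^sup>2 / 2 * R" for R by (simp add: distrib_left)
  have 3: "2 / 3 * (a * (4 * x) + 16 * (b * y)) + u + (2 * (a * x) + v) = 14 / 3 * a * x + 32 / 3 * b * y + (u + v)"
    for a b y u v :: real by (simp add: field_simps)
  show ?thesis unfolding step_error_def 1 2 by (rule 3)
qed

text \<open>Error of one step, uniform over \<open>k \<le> n\<close>: the expected
  \<open>step_error\<close>, the cost \<open>2 * th ^ 2\<close> times the mean absolute deviation of
  replacing the quadratic form by its mean, and the square that arises from replacing
  \<open>1 - r\<close> by \<open>exp (- r)\<close>.\<close>

definition step_bound :: "real \<Rightarrow> real \<Rightarrow> nat \<Rightarrow> real" where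
  "step_bound th eta n = 14 / 3 * (eta * th\<^sup>2) * (real n * real d)
     + 32 / 3 * (th ^ 4 * K4 / eta) * (2 * dev_bound n + 2 * (real n * real d)\<^sup>2)
     + 2 * th\<^sup>2 * sqrt (dev_bound n)
     + (4 * th\<^sup>2 * K4 + th\<^sup>2 / 2 * ((1 / eta + 1) * K4) + (2 * th\<^sup>2 * (real n * real d))\<^sup>2)"

definition phi :: "real \<Rightarrow> nat \<Rightarrow> complex" where
  "phi th k = (\<integral>x. iexp (th * dev k x) \<partial>sample_space k)"

text \<open>The conditional characteristic function \<open>G\<close> of an increment is compared
  first with \<open>1 - 2 * th ^ 2 * quad\<close>, still random, and then with the constant
  \<open>exp (- r)\<close>. A constant factor leaves the integral and the recursion for
  \<open>phi\<close> results.\<close>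

lemma phi_step:
  assumes eta: "0 < eta" and k: "k \<le> n"
  shows "cmod (phi th (Suc k) - complex_of_real (exp (- (2 * th\<^sup>2 * (real k * real d)))) * phi th k) \<le> step_bound th eta n"
proof -
  interpret S: prob_space "sample_space k" by (rule prob_sample_space)
  interpret S': prob_space "sample_space (Suc k)" by (rule prob_sample_space)
  define r where "r = 2 * th\<^sup>2 * (real k * real d)"
  define G where "G = (\<lambda>x. \<integral>z. iexp (th * (lin (psum k x) z + (quad (f z) - real d))) \<partial>Q)"
  have "(\<lambda>(x, z). iexp (th * (lin (psum k x) z + (quad (f z) - real d)))) \<in> borel_measurable (sample_space k \<Otimes>\<^sub>M Q)"
    unfolding lin_def ip_def mapp_def using psum_meas f_meas by measurable
  then have Gm [measurable]: "G \<in> borel_measurable (sample_space k)"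
    unfolding G_def by (rule borel_measurable_lebesgue_integral)
  have G1: "cmod (G x) \<le> 1" for x
  proof -
    have "cmod (G x) \<le> (\<integral>z. cmod (iexp (th * (lin (psum k x) z + (quad (f z) - real d)))) \<partial>Q)"
      unfolding G_def by (rule integral_norm_bound)
    then show ?thesis by (simp add: prob_space)
  qed
  have int1: "integrable (sample_space (Suc k)) (\<lambda>x. iexp (th * dev (Suc k) x))"
    by (rule S'.integrable_const_bound[of _ 1]) auto
  have "phi th (Suc k) = (\<integral>x. (\<integral>z. iexp (th * dev (Suc k) (x(Suc k := z))) \<partial>Q) \<partial>sample_space k)"
    unfolding phi_def by (rule sample_integral_Suc[OF int1])
  also have "\<dots> = (\<integral>x. iexp (th * dev k x) * G x \<partial>sample_space k)"
  proof (intro Bochner_Integration.integral_cong refl)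
    fix x
    have "iexp (th * dev (Suc k) (x(Suc k := z))) = iexp (th * dev k x) * iexp (th * (lin (psum k x) z + (quad (f z) - real d)))" for z
      unfolding dev_Suc_upd exp_add[symmetric] by (simp add: distrib_left)
    then show "(\<integral>z. iexp (th * dev (Suc k) (x(Suc k := z))) \<partial>Q) = iexp (th * dev k x) * G x"
      unfolding G_def by (simp only: integral_mult_right_zero)
  qed
  finally have p1: "phi th (Suc k) = (\<integral>x. iexp (th * dev k x) * G x \<partial>sample_space k)" .
  have i1: "integrable (sample_space k) (\<lambda>x. iexp (th * dev k x) * G x)"
    by (rule S.integrable_const_bound[of _ 1]) (use G1 in \<open>auto simp: norm_mult\<close>)
  have i2: "integrable (sample_space k) (\<lambda>x. iexp (th * dev k x) * complex_of_real (exp (- r)))"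
    by (rule S.integrable_const_bound[of _ "exp (- r)"]) (auto simp: norm_mult)
  have eq: "phi th (Suc k) - complex_of_real (exp (- r)) * phi th k
      = (\<integral>x. iexp (th * dev k x) * (G x - complex_of_real (exp (- r))) \<partial>sample_space k)"
  proof -
    have "complex_of_real (exp (- r)) * phi th k = (\<integral>x. iexp (th * dev k x) * complex_of_real (exp (- r)) \<partial>sample_space k)"
      unfolding phi_def by simp
    then show ?thesis unfolding p1 right_diff_distrib by (simp only: Bochner_Integration.integral_diff[OF i1 i2])
  qed
  have "cmod (phi th (Suc k) - complex_of_real (exp (- r)) * phi th k) \<le> (\<integral>x. step_error th eta (quad (psum k x)) + 2 * th\<^sup>2 * \<bar>dev k x\<bar> + r\<^sup>2 \<partial>sample_space k)"
    unfolding eq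
  proof (rule order_trans[OF integral_norm_bound integral_mono])
    show "integrable (sample_space k) (\<lambda>x. cmod (iexp (th * dev k x) * (G x - complex_of_real (exp (- r)))))"
      unfolding right_diff_distrib by (rule integrable_norm[OF Bochner_Integration.integrable_diff[OF i1 i2]])
    show "integrable (sample_space k) (\<lambda>x. step_error th eta (quad (psum k x)) + 2 * th\<^sup>2 * \<bar>dev k x\<bar> + r\<^sup>2)"
      unfolding step_error_eq using quad_psum_integrable quad_psum_sq_integrable dev_integrable(1) by simp
    fix x
    have a: "cmod (G x - complex_of_real (1 - 2 * th\<^sup>2 * quad (psum k x))) \<le> step_error th eta (quad (psum k x))"
      unfolding G_def by (rule charfun_step[OF eta])
    \<comment> \<open>By definition of \<open>dev\<close>, the number
      \<open>2 * th ^ 2 * quad\<close> is \<open>r\<close> plus \<open>2 * th ^ 2 * dev\<close>. The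
      first part enters the expansion of the exponential, the second is controlled by the
      concentration of \<open>dev\<close>.\<close>
    have b: "cmod (complex_of_real (1 - 2 * th\<^sup>2 * quad (psum k x)) - complex_of_real (exp (- r))) \<le> 2 * th\<^sup>2 * \<bar>dev k x\<bar> + r\<^sup>2"
    proof -
      have r0: "0 \<le> r" by (simp add: r_def)
      have "(1 - 2 * th\<^sup>2 * quad (psum k x)) - exp (- r) = (1 - r - exp (- r)) - 2 * th\<^sup>2 * dev k x"
        by (simp add: r_def dev_def right_diff_distrib)
      moreover have "\<bar>2 * th\<^sup>2 * dev k x\<bar> = 2 * th\<^sup>2 * \<bar>dev k x\<bar>" by (simp add: abs_mult)
      ultimately have "\<bar>(1 - 2 * th\<^sup>2 * quad (psum k x)) - exp (- r)\<bar> \<le> \<bar>1 - r - exp (- r)\<bar> + 2 * th\<^sup>2 * \<bar>dev k x\<bar>"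
        by (metis abs_triangle_ineq4)
      also have "\<dots> \<le> 2 * th\<^sup>2 * \<bar>dev k x\<bar> + r\<^sup>2"
        using exp_minus_second_order[OF r0] by simp
      finally have "\<bar>(1 - 2 * th\<^sup>2 * quad (psum k x)) - exp (- r)\<bar> \<le> 2 * th\<^sup>2 * \<bar>dev k x\<bar> + r\<^sup>2" .
      then show ?thesis unfolding of_real_diff[symmetric] norm_of_real .
    qed
    show "cmod (iexp (th * dev k x) * (G x - complex_of_real (exp (- r)))) \<le> step_error th eta (quad (psum k x)) + 2 * th\<^sup>2 * \<bar>dev k x\<bar> + r\<^sup>2"
      using norm_diff_triangle_le[OF a b] by (simp add: norm_mult add.assoc)
  qed
  also have "\<dots> \<le> step_bound th eta n"
  proof -
    define e1 where "e1 = (\<integral>x. quad (psum k x) \<partial>sample_space k)"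
    define e2 where "e2 = (\<integral>x. (quad (psum k x))\<^sup>2 \<partial>sample_space k)"
    define e3 where "e3 = (\<integral>x. \<bar>dev k x\<bar> \<partial>sample_space k)"
    have kn: "real k * real d \<le> real n * real d" using k by (simp add: mult_right_mono)
    have e1: "e1 \<le> real n * real d" unfolding e1_def quad_psum_mean by (rule kn)
    have e3: "e3 \<le> sqrt (dev_bound n)" unfolding e3_def by (rule dev_first_le[OF k])
    have e2: "e2 \<le> 2 * dev_bound n + 2 * (real n * real d)\<^sup>2"
    proof -
      have "e2 \<le> (\<integral>x. 2 * (dev k x)\<^sup>2 + 2 * (real k * real d)\<^sup>2 \<partial>sample_space k)"
        unfolding e2_def
      proof (rule integral_mono[OF quad_psum_sq_integrable])
        show "integrable (sample_space k) (\<lambda>x. 2 * (dev k x)\<^sup>2 + 2 * (real k * real d)\<^sup>2)"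
          using dev_integrable by simp
        fix x
        have "quad (psum k x) = dev k x + real k * real d" by (simp add: dev_def)
        then show "(quad (psum k x))\<^sup>2 \<le> 2 * (dev k x)\<^sup>2 + 2 * (real k * real d)\<^sup>2"
          using sum_squares_bound[of "dev k x" "real k * real d"] by (simp only: power2_sum)
      qed
      also have "\<dots> = 2 * (\<integral>x. (dev k x)\<^sup>2 \<partial>sample_space k) + 2 * (real k * real d)\<^sup>2"
        using dev_integrable by (simp add: S.prob_space)
      also have "\<dots> \<le> 2 * dev_bound n + 2 * (real n * real d)\<^sup>2"
        using power_mono[OF kn, of 2] by (intro add_mono mult_left_mono dev_second_le[OF k]) simp_all
      finally show ?thesis .
    qed
    have "(\<integral>x. step_error th eta (quad (psum k x)) + 2 * th\<^sup>2 * \<bar>dev k x\<bar> + r\<^sup>2 \<partial>sample_space k)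
        = 14 / 3 * (eta * th\<^sup>2) * e1 + 32 / 3 * (th ^ 4 * K4 / eta) * e2
            + 2 * th\<^sup>2 * e3 + (4 * th\<^sup>2 * K4 + th\<^sup>2 / 2 * ((1 / eta + 1) * K4) + r\<^sup>2)"
    proof -
      have eq: "step_error th eta (quad (psum k x)) + 2 * th\<^sup>2 * \<bar>dev k x\<bar> + r\<^sup>2
        = 14 / 3 * (eta * th\<^sup>2) * quad (psum k x) + 32 / 3 * (th ^ 4 * K4 / eta) * (quad (psum k x))\<^sup>2
            + 2 * th\<^sup>2 * \<bar>dev k x\<bar> + (4 * th\<^sup>2 * K4 + th\<^sup>2 / 2 * ((1 / eta + 1) * K4) + r\<^sup>2)" for x
        unfolding step_error_eq by (simp only: add.assoc add.commute[of _ "2 * th\<^sup>2 * \<bar>dev k x\<bar>"])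
      show ?thesis
        unfolding eq e1_def e2_def e3_def
        by (rule S.expectation_affine3) (use quad_psum_integrable quad_psum_sq_integrable dev_integrable(1) in simp_all)
    qed
    also have "\<dots> \<le> step_bound th eta n"
    proof -
      have t1: "14 / 3 * (eta * th\<^sup>2) * e1 \<le> 14 / 3 * (eta * th\<^sup>2) * (real n * real d)"
        by (rule mult_left_mono[OF e1]) (use eta in simp)
      have t2: "32 / 3 * (th ^ 4 * K4 / eta) * e2 \<le> 32 / 3 * (th ^ 4 * K4 / eta) * (2 * dev_bound n + 2 * (real n * real d)\<^sup>2)"
        by (rule mult_left_mono[OF e2]) (use eta K4_nonneg in simp)
      have t3: "2 * th\<^sup>2 * e3 \<le> 2 * th\<^sup>2 * sqrt (dev_bound n)"
        by (rule mult_left_mono[OF e3]) simp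
      have "r \<le> 2 * th\<^sup>2 * (real n * real d)"
        unfolding r_def by (rule mult_left_mono[OF kn]) simp
      then have t4: "c + r\<^sup>2 \<le> c + (2 * th\<^sup>2 * (real n * real d))\<^sup>2" for c
        by (intro add_left_mono power_mono) (simp_all add: r_def)
      show ?thesis
        unfolding step_bound_def by (rule add_mono[OF add_mono[OF add_mono[OF t1 t2] t3] t4])
    qed
    finally show ?thesis .
  qed
  finally show ?thesis unfolding r_def .
qed

text \<open>The exponents \<open>2 * th ^ 2 * d * j\<close> for \<open>j < k\<close> add up to
  \<open>th ^ 2 * d * k * (k - 1)\<close>. All factors are at most 1, so the errors of the steps are
  not amplified and simply add.\<close>

lemma phi_bound:
  assumes eta: "0 < eta"
  shows "cmod (phi th n - complex_of_real (exp (- (th\<^sup>2 * real d * (real n * (real n - 1)))))) \<le> real n * step_bound th eta n"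
proof -
  interpret S: prob_space "sample_space 0" by (rule prob_sample_space)
  have "cmod (phi th k - complex_of_real (exp (- (th\<^sup>2 * real d * (real k * (real k - 1)))))) \<le> real k * step_bound th eta n"
    if "k \<le> n" for k using that
  proof (induction k)
    case 0
    have "phi th 0 = 1" unfolding phi_def by (simp add: dev_def psum_0 S.prob_space)
    then show ?case by simp
  next
    case (Suc k)
    let ?e = "\<lambda>k. exp (- (th\<^sup>2 * real d * (real k * (real k - 1))))"
    let ?g = "exp (- (2 * th\<^sup>2 * (real k * real d)))"
    have eS: "?e (Suc k) = ?g * ?e k" unfolding exp_add[symmetric] by (simp add: algebra_simps)
    have 1: "cmod (phi th (Suc k) - complex_of_real ?g * phi th k) \<le> step_bound th eta n"
      by (rule phi_step[OF eta]) (use Suc in simp)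
    have "cmod (complex_of_real ?g * phi th k - complex_of_real (?e (Suc k))) = ?g * cmod (phi th k - complex_of_real (?e k))"
      unfolding eS of_real_mult right_diff_distrib[symmetric] norm_mult by simp
    also have "\<dots> \<le> 1 * cmod (phi th k - complex_of_real (?e k))"
      by (rule mult_right_mono) simp_all
    also have "\<dots> \<le> real k * step_bound th eta n" using Suc by simp
    finally have 2: "cmod (complex_of_real ?g * phi th k - complex_of_real (?e (Suc k))) \<le> real k * step_bound th eta n" .
    have "step_bound th eta n + real k * step_bound th eta n = real (Suc k) * step_bound th eta n"
      by (simp add: distrib_right)
    then show ?case using norm_diff_triangle_le[OF 1 2] by simp
  qed
  then show ?thesis by simp
qed

end

section \<open>A central limit theorem for quadratic forms\<close>

text \<open>The value of \<open>th\<close> is the argument \<open>t\<close> divided by the scale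
  \<open>n * sqrt (2 * d)\<close>, so \<open>th ^ 2 * n * d = t ^ 2 / (2 * n)\<close>. With
  \<open>K4\<close> of order \<open>d ^ 2\<close>, the terms of the cubic remainder sum to the
  orders \<open>eta\<close> and \<open>d ^ 2 / (n * eta)\<close>; \<open>eta = d / sqrt n\<close>
  balances them. The growth of the dimension enters through the term with
  \<open>sqrt (4 / d + 2 * C / n)\<close>.\<close>

lemma (in whitened_quadratic_form) step_bound_le:
  assumes n: "1 \<le> n" and d: "1 \<le> d" and K: "K4 \<le> C * (real d)\<^sup>2" and C: "0 \<le> C"
  defines "eta \<equiv> real d / sqrt (real n)"
  shows "real n * step_bound (t / (real n * sqrt (2 * real d))) eta n
    \<le> 7 / 3 * t\<^sup>2 * eta + 8 / 3 * (10 + 4 * C) * C * t ^ 4 * eta + t\<^sup>2 * sqrt (4 / real d + 2 * C / real n)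
      + (2 * C * t\<^sup>2 * eta + C * t\<^sup>2 / 4 * (1 / sqrt (real n) + eta) + t ^ 4 / real n)"
proof -
  define N where "N = real n"
  define D where "D = real d"
  define r where "r = sqrt N"
  define y where "y = (t / (N * sqrt (2 * D)))\<^sup>2"
  have N: "1 \<le> N" and D: "1 \<le> D" using n d by (simp_all add: N_def D_def)
  have r: "1 \<le> r" "r * r = N" using N by (simp_all add: r_def)
  have eta: "eta = D / r" by (simp add: eta_def D_def r_def N_def)
  have eta0: "0 < eta" using D r by (simp add: eta)
  have y0: "0 \<le> y" by (simp add: y_def)
  have y: "y * (N * D) = t\<^sup>2 / (2 * N)"
  proof -
    have "y = t\<^sup>2 / (N\<^sup>2 * (2 * D))" using D by (simp add: y_def power_divide power_mult_distrib)
    then show ?thesis using N D by (simp add: field_simps power2_eq_square)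
  qed
  have y4: "(t / (N * sqrt (2 * D))) ^ 4 = y\<^sup>2" by (simp add: y_def flip: power_mult)
  have dN: "D / N \<le> eta"
  proof -
    have "r \<le> N" using r mult_left_mono[of 1 r r] by simp
    then show ?thesis unfolding eta using D r by (intro divide_left_mono) auto
  qed
  define V where "V = dev_bound n"
  have V: "V = 4 * N\<^sup>2 * D + 2 * N * K4" by (simp add: V_def dev_bound_def N_def D_def)
  have K': "K4 \<le> C * D\<^sup>2" using K by (simp add: D_def)
  have V1: "V / (N * D)\<^sup>2 \<le> 4 / D + 2 * C / N"
  proof -
    have "V \<le> 4 * N\<^sup>2 * D + 2 * N * (C * D\<^sup>2)" unfolding V using K' N by (intro add_left_mono mult_left_mono) auto
    then have "V / (N * D)\<^sup>2 \<le> (4 * N\<^sup>2 * D + 2 * N * (C * D\<^sup>2)) / (N * D)\<^sup>2" by (rule divide_right_mono) simp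
    also have "\<dots> = 4 / D + 2 * C / N" using N D by (simp add: field_simps power2_eq_square)
    finally show ?thesis .
  qed
  have ND: "0 < N * D" using N D by simp
  have V2: "2 * V + 2 * (N * D)\<^sup>2 \<le> (10 + 4 * C) * (N * D)\<^sup>2"
  proof -
    have "4 / D \<le> 4" "2 * C / N \<le> 2 * C" using N D C by (simp_all add: pos_divide_le_eq mult_le_cancel_left1)
    then have "V / (N * D)\<^sup>2 \<le> 4 + 2 * C" using V1 by linarith
    moreover have "0 < (N * D)\<^sup>2" by (rule zero_less_power[OF ND])
    ultimately have "V \<le> (4 + 2 * C) * (N * D)\<^sup>2" by (simp only: pos_divide_le_eq)
    then show ?thesis by (simp add: algebra_simps)
  qed
  have a1: "N * (14 / 3 * (eta * y) * (N * D)) = 7 / 3 * t\<^sup>2 * eta"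
  proof -
    have "N * (14 / 3 * (eta * y) * (N * D)) = 14 / 3 * eta * (N * (y * (N * D)))" by simp
    then show ?thesis unfolding y using N by simp
  qed
  have a2: "N * (32 / 3 * (y\<^sup>2 * K4 / eta) * (2 * V + 2 * (N * D)\<^sup>2)) \<le> 8 / 3 * (10 + 4 * C) * C * t ^ 4 * eta"
  proof -
    have Ke: "K4 / eta \<le> C * D * r"
    proof -
      have "K4 / eta \<le> C * D\<^sup>2 / eta" using K' eta0 by (intro divide_right_mono) auto
      also have "\<dots> = C * D * r" unfolding eta using D r by (simp add: power2_eq_square)
      finally show ?thesis .
    qed
    have "N * (32 / 3 * (y\<^sup>2 * K4 / eta) * (2 * V + 2 * (N * D)\<^sup>2)) = 32 / 3 * N * y\<^sup>2 * ((K4 / eta) * (2 * V + 2 * (N * D)\<^sup>2))"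
      by simp
    also have "\<dots> \<le> 32 / 3 * N * y\<^sup>2 * ((C * D * r) * ((10 + 4 * C) * (N * D)\<^sup>2))"
      using Ke V2 N D r C K4_nonneg dev_bound_nonneg[of n] eta0
      by (intro mult_left_mono mult_mono) (auto simp: V_def)
    also have "\<dots> = 32 / 3 * (10 + 4 * C) * C * (D * r) * N * (y * (N * D))\<^sup>2"
    proof -
      have "32 / 3 * N * u * ((C * D * r) * (v * w)) = 32 / 3 * v * C * (D * r) * N * (u * w)" for u v w
        by simp
      then show ?thesis unfolding power_mult_distrib[of y "N * D"] .
    qed
    also have "\<dots> = 8 / 3 * (10 + 4 * C) * C * t ^ 4 * (D * r / N)"
    proof -
      have "N * (t\<^sup>2 / (2 * N))\<^sup>2 = t ^ 4 / (4 * N)"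
        using N by (simp add: power_divide power_mult_distrib power2_eq_square power4_eq_xxxx)
      then have A: "32 / 3 * (10 + 4 * C) * C * (D * r) * (N * (y * (N * D))\<^sup>2) = 32 / 3 * (10 + 4 * C) * C * (D * r) * (t ^ 4 / (4 * N))"
        unfolding y by (simp only:)
      have B: "32 / 3 * a * C * x * (u / (4 * N)) = 8 / 3 * a * C * u * (x / N)" for a x u by simp
      show ?thesis unfolding mult.assoc[of _ N] A by (rule B)
    qed
    also have "D * r / N = eta" unfolding eta r(2)[symmetric] using r(1) by simp
    finally show ?thesis .
  qed
  have a3: "N * (2 * y * sqrt V) \<le> t\<^sup>2 * sqrt (4 / D + 2 * C / N)"
  proof -
    have "sqrt V = (N * D) * sqrt (V / (N * D)\<^sup>2)" 
    proof -
      have "sqrt V = g * sqrt (V / g\<^sup>2)" if "0 < g" for g using that by (simp add: real_sqrt_divide)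
      then show ?thesis using ND .
    qed
    then have "N * (2 * y * sqrt V) = 2 * N * (y * (N * D)) * sqrt (V / (N * D)\<^sup>2)" by simp
    also have "\<dots> = t\<^sup>2 * sqrt (V / (N * D)\<^sup>2)" unfolding y using N by simp
    also have "\<dots> \<le> t\<^sup>2 * sqrt (4 / D + 2 * C / N)" using V1 by (intro mult_left_mono) auto
    finally show ?thesis .
  qed
  have KD: "K4 * y * N \<le> C * t\<^sup>2 / 2 * (D / N)"
  proof -
    have "K4 * y * N \<le> (C * D\<^sup>2) * y * N" using K' y0 N by (intro mult_right_mono) auto
    also have "\<dots> = C * D * (y * (N * D))" by (simp add: power2_eq_square)
    also have "\<dots> = C * t\<^sup>2 / 2 * (D / N)" unfolding y by simp
    finally show ?thesis .
  qed
  have a4: "N * (4 * y * K4) \<le> 2 * C * t\<^sup>2 * eta"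
  proof -
    have "N * (4 * y * K4) = 4 * (K4 * y * N)" by simp
    also have "\<dots> \<le> 4 * (C * t\<^sup>2 / 2 * (D / N))" by (intro mult_left_mono KD) simp
    also have "\<dots> \<le> 4 * (C * t\<^sup>2 / 2 * eta)" using dN C by (intro mult_left_mono) auto
    finally show ?thesis by simp
  qed
  have a5: "N * (y / 2 * ((1 / eta + 1) * K4)) \<le> C * t\<^sup>2 / 4 * (1 / r + eta)"
  proof -
    have "N * (y / 2 * ((1 / eta + 1) * K4)) = (K4 * y * N) * ((1 / eta + 1) / 2)" by simp
    also have "\<dots> \<le> (C * t\<^sup>2 / 2 * (D / N)) * ((1 / eta + 1) / 2)" using KD eta0 by (intro mult_right_mono) auto
    also have "\<dots> = C * t\<^sup>2 / 4 * (D / N * (1 / eta) + D / N)"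
    proof -
      have "(a / 2 * b) * ((c + 1) / 2) = a / 4 * (b * c + b)" for a b c :: real by (simp add: algebra_simps)
      then show ?thesis .
    qed
    also have "D / N * (1 / eta) = 1 / r" unfolding eta r(2)[symmetric] using r(1) D by simp
    also have "C * t\<^sup>2 / 4 * (1 / r + D / N) \<le> C * t\<^sup>2 / 4 * (1 / r + eta)"
      using dN C by (intro mult_left_mono add_left_mono) auto
    finally show ?thesis .
  qed
  have a6: "N * (2 * y * (N * D))\<^sup>2 = t ^ 4 / N"
  proof -
    have "N * (2 * y * (N * D))\<^sup>2 = N * (2 * (y * (N * D)))\<^sup>2" by (simp only: mult.assoc)
    also have "\<dots> = t ^ 4 / N" unfolding y using N by (simp add: power_divide power2_eq_square power4_eq_xxxx)
    finally show ?thesis .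
  qed
  have eq: "real n * step_bound (t / (real n * sqrt (2 * real d))) eta n
     = N * (14 / 3 * (eta * y) * (N * D)) + N * (32 / 3 * (y\<^sup>2 * K4 / eta) * (2 * V + 2 * (N * D)\<^sup>2))
      + N * (2 * y * sqrt V) + (N * (4 * y * K4) + N * (y / 2 * ((1 / eta + 1) * K4)) + N * (2 * y * (N * D))\<^sup>2)"
    unfolding step_bound_def N_def[symmetric] D_def[symmetric] V_def[symmetric] y4 y_def[symmetric] distrib_left[of N] by (rule refl)
  show ?thesis
    unfolding eq unfolding N_def[symmetric] D_def[symmetric] r_def[symmetric] a1 a6
    by (rule add_mono[OF add_mono[OF add_mono[OF order_refl a2] a3] add_mono[OF add_mono[OF a4 a5] order_refl]])
qed

section \<open>Independent samples and convergence to the normal law\<close>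

locale iid_sample = M: prob_space M + Q: prob_space Q for M :: "'a measure" and Q :: "'z measure" +
  fixes Z :: "nat \<Rightarrow> 'a \<Rightarrow> 'z"
  assumes Z_indep: "M.indep_vars (\<lambda>_. Q) Z {1..}"
    and Z_distr: "\<And>j. 1 \<le> j \<Longrightarrow> distr M Q (Z j) = Q"
begin

lemma Z_meas: "1 \<le> j \<Longrightarrow> Z j \<in> measurable M Q"
  using Z_indep unfolding M.indep_vars_def by auto

lemma sample_meas: "sample Z n \<in> measurable M (PiM {1..n} (\<lambda>_. Q))"
  unfolding sample_def[abs_def] by (intro measurable_restrict Z_meas) auto

text \<open>Independence and the common law identify the joint law with the product measure, so that
  statements about the observations on \<open>M\<close> can be computed by Fubini's theorem.\<close>

lemma sample_distr: "1 \<le> n \<Longrightarrow> distr M (PiM {1..n} (\<lambda>_. Q)) (sample Z n) = PiM {1..n} (\<lambda>_. Q)"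
proof -
  assume n: "1 \<le> n"
  have "M.indep_vars (\<lambda>_. Q) Z {1..n}" by (rule M.indep_vars_subset[OF Z_indep]) auto
  then have "distr M (PiM {1..n} (\<lambda>_. Q)) (\<lambda>\<omega>. \<lambda>j\<in>{1..n}. Z j \<omega>) = PiM {1..n} (\<lambda>j. distr M Q (Z j))"
    using n by (subst (asm) M.indep_vars_iff_distr_eq_PiM') (auto intro: Z_meas)
  also have "PiM {1..n} (\<lambda>j. distr M Q (Z j)) = PiM {1..n} (\<lambda>_. Q)"
    by (rule PiM_cong) (auto simp: Z_distr)
  finally show ?thesis unfolding sample_def[abs_def] .
qed

lemma integral_Z:
  fixes g :: "'z \<Rightarrow> real"
  assumes "1 \<le> j" "g \<in> borel_measurable Q"
  shows "(\<integral>\<omega>. g (Z j \<omega>) \<partial>M) = (\<integral>z. g z \<partial>Q)" "integrable M (\<lambda>\<omega>. g (Z j \<omega>)) \<longleftrightarrow> integrable Q g"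
  using integral_distr[OF Z_meas[OF assms(1)] assms(2)] integrable_distr_eq[OF Z_meas[OF assms(1)] assms(2)] Z_distr[OF assms(1)]
  by simp_all

lemma integral_sample:
  fixes F :: "(nat \<Rightarrow> 'z) \<Rightarrow> 'b::{banach, second_countable_topology}"
  assumes "1 \<le> n" "F \<in> borel_measurable (PiM {1..n} (\<lambda>_. Q))"
  shows "(\<integral>\<omega>. F (sample Z n \<omega>) \<partial>M) = (\<integral>x. F x \<partial>PiM {1..n} (\<lambda>_. Q))"
  using integral_distr[OF sample_meas assms(2)] sample_distr[OF assms(1)] by simp

text \<open>Levy's continuity theorem applied to \<open>phi_bound\<close>. The hypotheses hold for
  large \<open>n\<close> only, since the fourth moments of the application are controlled only
  eventually.\<close>

theorem quadratic_form_clt: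
  fixes m :: "nat \<Rightarrow> nat" and f :: "nat \<Rightarrow> 'z \<Rightarrow> nat \<Rightarrow> real" and W P :: "nat \<Rightarrow> nat \<Rightarrow> nat \<Rightarrow> real"
  assumes wq: "\<forall>\<^sub>F n in sequentially. whitened_quadratic_form Q (m n) (f n) (W n) (P n) lam"
    and fourth: "\<forall>\<^sub>F n in sequentially. (\<integral>z. nrm (m n) (f n z) ^ 4 \<partial>Q) \<le> C * (real (m n))\<^sup>2" and C: "0 \<le> C"
    and m_lim: "filterlim m at_top sequentially"
    and m_rate: "(\<lambda>n. real (m n) / sqrt (real n)) \<longlonglongrightarrow> 0"
  defines "S \<equiv> \<lambda>n \<omega> i. \<Sum>j=1..n. f n (Z j \<omega>) i"
  defines "Y \<equiv> \<lambda>n \<omega>. (ip (m n) (S n \<omega>) (mapp (m n) (P n) (S n \<omega>)) / real n - real (m n)) / sqrt (2 * real (m n))"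
  shows "(\<lambda>n. measure M {\<omega> \<in> space M. Y n \<omega> \<le> x}) \<longlonglongrightarrow> cdf std_normal_distribution x"
proof -
  define ok where "ok = (\<lambda>n. 1 \<le> n \<and> 1 \<le> m n \<and> whitened_quadratic_form Q (m n) (f n) (W n) (P n) lam
    \<and> (\<integral>z. nrm (m n) (f n z) ^ 4 \<partial>Q) \<le> C * (real (m n))\<^sup>2)"
  have evok: "\<forall>\<^sub>F n in sequentially. ok n"
  proof -
    have "\<forall>\<^sub>F n in sequentially. 1 \<le> m n" using m_lim by (simp add: filterlim_at_top)
    then show ?thesis using wq fourth eventually_ge_at_top[of 1]
      by eventually_elim (simp add: ok_def)
  qed
  have Y_dev: "Y n \<omega> = whitened_quadratic_form.dev (m n) (f n) (P n) n (sample Z n \<omega>) / (real n * sqrt (2 * real (m n)))"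
    if "ok n" for n \<omega>
  proof -
    interpret F: whitened_quadratic_form Q "m n" "f n" "W n" "P n" lam using that by (simp add: ok_def)
    have "F.psum n (sample Z n \<omega>) = S n \<omega>"
      unfolding F.psum_def S_def sample_def by (intro ext sum.cong) auto
    then have "F.dev n (sample Z n \<omega>) = ip (m n) (S n \<omega>) (mapp (m n) (P n) (S n \<omega>)) - real n * real (m n)"
      by (simp add: F.dev_def F.quad_def)
    moreover have "real n \<noteq> 0" using that by (simp add: ok_def)
    ultimately show ?thesis unfolding Y_def by (simp add: diff_divide_distrib)
  qed
  have Ym: "Y n \<in> borel_measurable M" if "ok n" for n
  proof -
    interpret F: whitened_quadratic_form Q "m n" "f n" "W n" "P n" lam using that by (simp add: ok_def)
    have "(\<lambda>\<omega>. F.dev n (sample Z n \<omega>)) \<in> borel_measurable M"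
      by (rule measurable_compose[OF sample_meas F.dev_meas[unfolded F.sample_space_def]])
    then show ?thesis unfolding Y_dev[OF that, abs_def] by measurable
  qed
  \<comment> \<open>The continuity theorem wants a probability law at every index; the normal law is
    a filler where the hypotheses may still fail.\<close>
  define mu where "mu = (\<lambda>n. if ok n then distr M borel (Y n) else std_normal_distribution)"
  have rd: "real_distribution (mu n)" for n
    unfolding mu_def using real_dist_normal_dist M.real_distribution_distr[OF Ym] by auto
  define R where "R = (\<lambda>t n. let eta = real (m n) / sqrt (real n); K = C / lam\<^sup>2 in
      7 / 3 * t\<^sup>2 * eta + 8 / 3 * (10 + 4 * K) * K * t ^ 4 * eta + t\<^sup>2 * sqrt (4 / real (m n) + 2 * K / real n)
      + (2 * K * t\<^sup>2 * eta + K * t\<^sup>2 / 4 * (1 / sqrt (real n) + eta) + t ^ 4 / real n))"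
  have bound: "cmod (char (mu n) t - complex_of_real (exp (- (t\<^sup>2 / 2 * (1 - 1 / real n))))) \<le> R t n" if ok: "ok n" for n t
  proof -
    interpret F: whitened_quadratic_form Q "m n" "f n" "W n" "P n" lam using ok by (simp add: ok_def)
    have n: "1 \<le> n" and d: "1 \<le> m n" using ok by (simp_all add: ok_def)
    define th where "th = t / (real n * sqrt (2 * real (m n)))"
    have "char (mu n) t = (\<integral>\<omega>. iexp (t * Y n \<omega>) \<partial>M)"
      using ok unfolding mu_def char_def by (simp add: integral_distr[OF Ym[OF ok]])
    also have "\<dots> = (\<integral>\<omega>. iexp (th * F.dev n (sample Z n \<omega>)) \<partial>M)"
      unfolding Y_dev[OF ok] th_def by (intro Bochner_Integration.integral_cong refl) simp
    also have "\<dots> = F.phi th n"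
      unfolding F.phi_def F.sample_space_def
      by (rule integral_sample[OF n]) (use F.dev_meas[of n, unfolded F.sample_space_def] in measurable)
    finally have ch: "char (mu n) t = F.phi th n" .
    define eta where "eta = real (m n) / sqrt (real n)"
    have eta: "0 < eta" using n d by (simp add: eta_def)
    \<comment> \<open>The deterministic recursion reaches the normal exponent up to the factor
      \<open>1 - 1 / n\<close>, which stems from summing the indices below \<open>n\<close>.\<close>
    have ex: "th\<^sup>2 * real (m n) * (real n * (real n - 1)) = t\<^sup>2 / 2 * (1 - 1 / real n)"
      using n d unfolding th_def by (simp add: power_divide power_mult_distrib field_simps power2_eq_square)
    have "cmod (F.phi th n - complex_of_real (exp (- (th\<^sup>2 * real (m n) * (real n * (real n - 1)))))) \<le> real n * F.step_bound th eta n"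
      by (rule F.phi_bound[OF eta])
    also have "\<dots> \<le> R t n"
    proof -
      have K: "F.K4 \<le> C / lam\<^sup>2 * (real (m n))\<^sup>2"
        using ok F.lam unfolding F.K4_def ok_def by (simp add: divide_right_mono)
      show ?thesis unfolding R_def Let_def th_def eta_def
        by (rule F.step_bound_le[OF n d K]) (use C in simp)
    qed
    finally show ?thesis unfolding ch ex .
  qed
  have R0: "R t \<longlonglongrightarrow> 0" for t
  proof -
    have md: "(\<lambda>n. 4 / real (m n)) \<longlonglongrightarrow> 0"
      by (rule tendsto_divide_0[OF tendsto_const]) (rule filterlim_at_top_imp_at_infinity[OF filterlim_compose[OF filterlim_real_sequentially m_lim]])
    have n1: "(\<lambda>n. c / real n) \<longlonglongrightarrow> 0" for c by (rule lim_const_over_n)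
    have n2: "(\<lambda>n. 1 / sqrt (real n)) \<longlonglongrightarrow> 0"
      by (rule tendsto_divide_0[OF tendsto_const]) (rule filterlim_at_top_imp_at_infinity[OF filterlim_compose[OF sqrt_at_top filterlim_real_sequentially]])
    have "R t \<longlonglongrightarrow> 7 / 3 * t\<^sup>2 * 0 + 8 / 3 * (10 + 4 * (C / lam\<^sup>2)) * (C / lam\<^sup>2) * t ^ 4 * 0 + t\<^sup>2 * sqrt (0 + 0)
      + (2 * (C / lam\<^sup>2) * t\<^sup>2 * 0 + (C / lam\<^sup>2) * t\<^sup>2 / 4 * (0 + 0) + 0)"
      unfolding R_def Let_def by (intro tendsto_intros m_rate md n1 n2)
    then show ?thesis by simp
  qed
  have "weak_conv_m mu std_normal_distribution"
  proof (rule levy_continuity[OF rd real_dist_normal_dist])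
    fix t
    have 1: "(\<lambda>n. char (mu n) t - complex_of_real (exp (- (t\<^sup>2 / 2 * (1 - 1 / real n))))) \<longlonglongrightarrow> 0"
      by (rule Lim_null_comparison[OF _ R0[of t]]) (use evok bound in \<open>auto elim: eventually_mono\<close>)
    have 2: "(\<lambda>n. complex_of_real (exp (- (t\<^sup>2 / 2 * (1 - 1 / real n))))) \<longlonglongrightarrow> complex_of_real (exp (- (t\<^sup>2 / 2 * (1 - 0))))"
      by (intro tendsto_intros lim_const_over_n)
    show "(\<lambda>n. char (mu n) t) \<longlonglongrightarrow> char std_normal_distribution t"
      using tendsto_add[OF 1 2] by (simp add: char_std_normal_distribution)
  qed
  then have "(\<lambda>n. cdf (mu n) x) \<longlonglongrightarrow> cdf std_normal_distribution x"
    using isCont_cdf_std_normal unfolding weak_conv_m_def weak_conv_def by blast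
  moreover have "\<forall>\<^sub>F n in sequentially. cdf (mu n) x = measure M {\<omega> \<in> space M. Y n \<omega> \<le> x}"
    using evok
  proof eventually_elim
    case (elim n)
    then show ?case unfolding mu_def cdf_def using Ym[OF elim]
      by (simp add: measure_distr vimage_def Int_def conj_commute)
  qed
  ultimately show ?thesis by (rule Lim_transform_eventually)
qed

end

section \<open>Moment bounds and exceptional events\<close>

lemma (in prob_space) prob_greater_le:
  fixes X :: "'a \<Rightarrow> real"
  assumes "integrable M X" "\<And>x. x \<in> space M \<Longrightarrow> 0 \<le> X x" "expectation X \<le> c" "0 < K"
  shows "prob {x \<in> space M. K < X x} \<le> c / K"
proof -
  have [measurable]: "X \<in> borel_measurable M" using assms(1) by auto
  have "prob {x \<in> space M. K < X x} \<le> prob {x \<in> space M. X x \<ge> K}"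
    by (rule finite_measure_mono) (auto, measurable)
  also have "\<dots> \<le> expectation X / K"
    by (rule integral_Markov_inequality_measure[where A = "{}"]) (use assms in auto)
  also have "\<dots> \<le> c / K" using assms by (intro divide_right_mono) auto
  finally show ?thesis .
qed

text \<open>The operator norm is replaced by the larger Frobenius norm, whose expected square is a
  sum of variances of entries and can be computed directly.\<close>

lemma frobenius_bound:
  "\<bar>ip d u (mapp d D v)\<bar> \<le> sqrt (\<Sum>i<d. \<Sum>k<d. (D i k)\<^sup>2) * nrm d u * nrm d v"
proof -
  have "(nrm d (mapp d D v))\<^sup>2 \<le> (\<Sum>i<d. (\<Sum>k<d. (D i k)\<^sup>2) * (nrm d v)\<^sup>2)"
  proof -
    have "(nrm d (mapp d D v))\<^sup>2 = (\<Sum>i<d. (ip d (D i) v)\<^sup>2)"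
      unfolding nrm_sq by (simp add: ip_def mapp_def power2_eq_square)
    also have "\<dots> \<le> (\<Sum>i<d. (\<Sum>k<d. (D i k)\<^sup>2) * (nrm d v)\<^sup>2)"
    proof (rule sum_mono)
      fix i
      have "(ip d (D i) v)\<^sup>2 \<le> (nrm d (D i) * nrm d v)\<^sup>2"
        using power_mono[OF ip_Cauchy_Schwarz[of d "D i" v] abs_ge_zero, of 2] by simp
      also have "\<dots> = (\<Sum>k<d. (D i k)\<^sup>2) * (nrm d v)\<^sup>2"
        by (simp add: power_mult_distrib nrm_sq[of d "D i"]) (simp add: ip_def power2_eq_square)
      finally show "(ip d (D i) v)\<^sup>2 \<le> (\<Sum>k<d. (D i k)\<^sup>2) * (nrm d v)\<^sup>2" .
    qed
    finally show ?thesis .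
  qed
  also have "\<dots> = (sqrt (\<Sum>i<d. \<Sum>k<d. (D i k)\<^sup>2) * nrm d v)\<^sup>2"
    by (simp add: power_mult_distrib sum_nonneg sum_distrib_right)
  finally have "nrm d (mapp d D v) \<le> sqrt (\<Sum>i<d. \<Sum>k<d. (D i k)\<^sup>2) * nrm d v"
    by (rule power2_le_imp_le) (simp add: sum_nonneg)
  then have "nrm d u * nrm d (mapp d D v) \<le> nrm d u * (sqrt (\<Sum>i<d. \<Sum>k<d. (D i k)\<^sup>2) * nrm d v)"
    by (rule mult_left_mono) simp
  then show ?thesis using ip_Cauchy_Schwarz[of d u "mapp d D v"] by (simp add: mult_ac)
qed

context iid_sample
begin

text \<open>Centred terms at different observations are uncorrelated by independence, so only the
  diagonal of the double sum survives.\<close>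

lemma sum_square:
  fixes g :: "'z \<Rightarrow> real"
  assumes g [measurable]: "g \<in> borel_measurable Q" and g2: "integrable Q (\<lambda>z. (g z)\<^sup>2)" and g0: "(\<integral>z. g z \<partial>Q) = 0"
  shows "integrable M (\<lambda>\<omega>. (\<Sum>j=1..n. g (Z j \<omega>))\<^sup>2)"
    and "(\<integral>\<omega>. (\<Sum>j=1..n. g (Z j \<omega>))\<^sup>2 \<partial>M) = real n * (\<integral>z. (g z)\<^sup>2 \<partial>Q)"
proof -
  have gi: "integrable Q g" using Q.integrable_power_le[of g 2 1] g2 by simp
  have iv: "M.indep_vars (\<lambda>_. borel) (\<lambda>j \<omega>. g (Z j \<omega>)) {1..}"
    by (rule M.indep_vars_compose2[OF Z_indep]) simp
  have pair: "integrable M (\<lambda>\<omega>. g (Z i \<omega>) * g (Z j \<omega>)) \<and>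
      (\<integral>\<omega>. g (Z i \<omega>) * g (Z j \<omega>) \<partial>M) = (if i = j then \<integral>z. (g z)\<^sup>2 \<partial>Q else 0)"
    if ij: "i \<in> {1..n}" "j \<in> {1..n}" for i j
  proof (cases "i = j")
    case True
    then show ?thesis
      using integral_Z[of j "\<lambda>z. (g z)\<^sup>2"] g2 ij by (simp add: power2_eq_square)
  next
    case False
    have iv2: "M.indep_vars (\<lambda>_. borel) (\<lambda>j \<omega>. g (Z j \<omega>)) {i, j}"
      by (rule M.indep_vars_subset[OF iv]) (use ij in auto)
    have int: "integrable M (\<lambda>\<omega>. g (Z k \<omega>))" if "k \<in> {i, j}" for k
      using integral_Z(2)[of k g] gi that ij by auto
    have "(\<integral>\<omega>. g (Z k \<omega>) \<partial>M) = 0" if "k \<in> {i, j}" for k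
      using integral_Z(1)[of k g] g0 that ij by auto
    then show ?thesis
      using M.indep_vars_integrable[OF _ iv2 int] M.indep_vars_lebesgue_integral[OF _ iv2 int] False by simp
  qed
  have sq: "(\<Sum>j=1..n. g (Z j \<omega>))\<^sup>2 = (\<Sum>i=1..n. \<Sum>j=1..n. g (Z i \<omega>) * g (Z j \<omega>))" for \<omega>
    by (simp only: power2_eq_square sum_product)
  show "integrable M (\<lambda>\<omega>. (\<Sum>j=1..n. g (Z j \<omega>))\<^sup>2)"
    unfolding sq using pair by (intro Bochner_Integration.integrable_sum) auto
  have "(\<integral>\<omega>. (\<Sum>j=1..n. g (Z j \<omega>))\<^sup>2 \<partial>M) = (\<Sum>i=1..n. \<integral>\<omega>. (\<Sum>j=1..n. g (Z i \<omega>) * g (Z j \<omega>)) \<partial>M)"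
    unfolding sq using pair by (intro Bochner_Integration.integral_sum Bochner_Integration.integrable_sum) auto
  also have "\<dots> = (\<Sum>i=1..n. \<Sum>j=1..n. \<integral>\<omega>. g (Z i \<omega>) * g (Z j \<omega>) \<partial>M)"
    using pair by (intro sum.cong refl Bochner_Integration.integral_sum) auto
  also have "\<dots> = (\<Sum>i=1..n. \<Sum>j=1..n. if i = j then \<integral>z. (g z)\<^sup>2 \<partial>Q else 0)"
    using pair by (intro sum.cong refl) auto
  also have "\<dots> = real n * (\<integral>z. (g z)\<^sup>2 \<partial>Q)" by simp
  finally show "(\<integral>\<omega>. (\<Sum>j=1..n. g (Z j \<omega>))\<^sup>2 \<partial>M) = real n * (\<integral>z. (g z)\<^sup>2 \<partial>Q)" .
qed

text \<open>Chebyshev's inequality for finitely many centred functions at once. It is applied to the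
  coordinates of the mean, to the entries of the sample second moment matrix and to the scalar sums
  of the correction.\<close>

lemma prob_sum_squares_greater:
  fixes g :: "'i \<Rightarrow> 'z \<Rightarrow> real"
  assumes I: "finite I" and g: "\<And>i. i \<in> I \<Longrightarrow> g i \<in> borel_measurable Q" "\<And>i. i \<in> I \<Longrightarrow> integrable Q (\<lambda>z. (g i z)\<^sup>2)"
    "\<And>i. i \<in> I \<Longrightarrow> (\<integral>z. g i z \<partial>Q) = 0" and c: "(\<Sum>i\<in>I. \<integral>z. (g i z)\<^sup>2 \<partial>Q) \<le> c"
    and n: "1 \<le> n" and K: "0 < K"
  shows "{\<omega> \<in> space M. real n * K < (\<Sum>i\<in>I. (\<Sum>j=1..n. g i (Z j \<omega>))\<^sup>2)} \<in> sets M"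
    and "measure M {\<omega> \<in> space M. real n * K < (\<Sum>i\<in>I. (\<Sum>j=1..n. g i (Z j \<omega>))\<^sup>2)} \<le> c / K"
proof -
  have int: "integrable M (\<lambda>\<omega>. \<Sum>i\<in>I. (\<Sum>j=1..n. g i (Z j \<omega>))\<^sup>2)"
    by (rule Bochner_Integration.integrable_sum) (use sum_square g in auto)
  then have [measurable]: "(\<lambda>\<omega>. \<Sum>i\<in>I. (\<Sum>j=1..n. g i (Z j \<omega>))\<^sup>2) \<in> borel_measurable M" by auto
  show "{\<omega> \<in> space M. real n * K < (\<Sum>i\<in>I. (\<Sum>j=1..n. g i (Z j \<omega>))\<^sup>2)} \<in> sets M" by measurable
  have "(\<integral>\<omega>. (\<Sum>i\<in>I. (\<Sum>j=1..n. g i (Z j \<omega>))\<^sup>2) \<partial>M) = (\<Sum>i\<in>I. real n * (\<integral>z. (g i z)\<^sup>2 \<partial>Q))"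
    by (subst Bochner_Integration.integral_sum) (use sum_square g in auto)
  also have "\<dots> \<le> real n * c" unfolding sum_distrib_left[symmetric] by (intro mult_left_mono c) simp
  finally have "measure M {\<omega> \<in> space M. real n * K < (\<Sum>i\<in>I. (\<Sum>j=1..n. g i (Z j \<omega>))\<^sup>2)} \<le> (real n * c) / (real n * K)"
    by (intro M.prob_greater_le[OF int]) (use n K in \<open>auto intro: sum_nonneg\<close>)
  then show "measure M {\<omega> \<in> space M. real n * K < (\<Sum>i\<in>I. (\<Sum>j=1..n. g i (Z j \<omega>))\<^sup>2)} \<le> c / K"
    using n by simp
qed

end

section \<open>Growing dimension: standing assumptions and exceptional events\<close>

locale el_asymptotics = iid_sample M Q Z for M :: "'a measure" and Q :: "'z measure" and Z :: "nat \<Rightarrow> 'a \<Rightarrow> 'z" +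
  fixes m :: "nat \<Rightarrow> nat" and f :: "nat \<Rightarrow> 'z \<Rightarrow> nat \<Rightarrow> real" and v :: "nat \<Rightarrow> nat \<Rightarrow> 'a \<Rightarrow> nat \<Rightarrow> real"
    and lam Lam C :: real and W :: "nat \<Rightarrow> nat \<Rightarrow> nat \<Rightarrow> real"
  assumes m_lim: "filterlim m at_top sequentially"
    and m_rate: "(\<lambda>n. real (m n) ^ 4 / real n) \<longlonglongrightarrow> 0"
    and f_meas: "\<And>n i. 1 \<le> n \<Longrightarrow> i < m n \<Longrightarrow> (\<lambda>z. f n z i) \<in> borel_measurable Q"
    and f_sq: "\<And>n. 1 \<le> n \<Longrightarrow> integrable Q (\<lambda>z. (nrm (m n) (f n z))\<^sup>2)"
    and f_mean: "\<And>n i. 1 \<le> n \<Longrightarrow> i < m n \<Longrightarrow> (\<integral>z. f n z i \<partial>Q) = 0"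
    and W_def: "\<And>n i k. i < m n \<Longrightarrow> k < m n \<Longrightarrow> W n i k = (\<integral>z. f n z i * f n z k \<partial>Q)"
    and lam: "0 < lam"
    and W_ge: "\<And>n u. 1 \<le> n \<Longrightarrow> lam * (nrm (m n) u)\<^sup>2 \<le> ip (m n) u (mapp (m n) (W n) u)"
    and W_le: "\<And>n u. 1 \<le> n \<Longrightarrow> ip (m n) u (mapp (m n) (W n) u) \<le> Lam * (nrm (m n) u)\<^sup>2"
    and Lam: "0 < Lam" and C: "0 \<le> C"
    and f_fourth: "\<forall>\<^sub>F n in sequentially. integrable Q (\<lambda>z. nrm (m n) (f n z) ^ 4)"
    and f_fourth_le: "\<forall>\<^sub>F n in sequentially. (\<integral>z. nrm (m n) (f n z) ^ 4 \<partial>Q) \<le> C * (real (m n))\<^sup>2"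
    and v_meas: "\<And>n j i. 1 \<le> n \<Longrightarrow> j \<in> {1..n} \<Longrightarrow> i < m n \<Longrightarrow> (\<lambda>\<omega>. v n j \<omega> i) \<in> borel_measurable M"
    and v_close: "little_op M (\<lambda>n \<omega>. (1 / real n) * (\<Sum>j=1..n. (nrm (m n) (\<lambda>i. v n j \<omega> i - f n (Z j \<omega>) i))\<^sup>2))
        (\<lambda>n. 1 / real (m n))"
begin

lemma W_sym: "i < m n \<Longrightarrow> k < m n \<Longrightarrow> W n i k = W n k i"
  by (simp add: W_def mult.commute)

text \<open>A symmetric inverse of \<open>W n\<close>; for \<open>n \<ge> 1\<close> one exists
  because \<open>W_ge\<close> makes \<open>W n\<close> positive definite.\<close>

definition P :: "nat \<Rightarrow> nat \<Rightarrow> nat \<Rightarrow> real" where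
  "P n = (SOME P. (\<forall>i<m n. \<forall>k<m n. P i k = P k i)
    \<and> (\<forall>i<m n. \<forall>k<m n. (\<Sum>l<m n. W n i l * P l k) = (if i = k then 1 else 0)))"

lemma P_spec:
  assumes "1 \<le> n"
  shows "\<And>i k. i < m n \<Longrightarrow> k < m n \<Longrightarrow> P n i k = P n k i"
    and "\<And>i k. i < m n \<Longrightarrow> k < m n \<Longrightarrow> (\<Sum>l<m n. W n i l * P n l k) = (if i = k then 1 else 0)"
proof -
  have pos: "0 < ip (m n) u (mapp (m n) (W n) u)" if "0 < nrm (m n) u" for u
  proof -
    have "0 < lam * (nrm (m n) u)\<^sup>2" using lam that by simp
    then show ?thesis using W_ge[OF assms, of u] by linarith
  qed
  have "(\<forall>i<m n. \<forall>k<m n. P n i k = P n k i)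
    \<and> (\<forall>i<m n. \<forall>k<m n. (\<Sum>l<m n. W n i l * P n l k) = (if i = k then 1 else 0))"
    unfolding P_def by (rule someI_ex[OF posdef_inverse_exists[OF W_sym pos]])
  then show "\<And>i k. i < m n \<Longrightarrow> k < m n \<Longrightarrow> P n i k = P n k i"
    and "\<And>i k. i < m n \<Longrightarrow> k < m n \<Longrightarrow> (\<Sum>l<m n. W n i l * P n l k) = (if i = k then 1 else 0)"
    by blast+
qed

definition wm :: "nat \<Rightarrow> 'a \<Rightarrow> nat \<Rightarrow> real" where
  "wm n \<omega> i = (\<Sum>j=1..n. f n (Z j \<omega>) i) / real n"

definition xm :: "nat \<Rightarrow> 'a \<Rightarrow> nat \<Rightarrow> real" where
  "xm n \<omega> i = (\<Sum>j=1..n. v n j \<omega> i) / real n"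

definition Y :: "nat \<Rightarrow> 'a \<Rightarrow> real" where
  "Y n \<omega> = (real n * ip (m n) (wm n \<omega>) (mapp (m n) (P n) (wm n \<omega>)) - real (m n)) / sqrt (2 * real (m n))"

lemma eventually_whitened:
  "\<forall>\<^sub>F n in sequentially. whitened_quadratic_form Q (m n) (f n) (W n) (P n) lam"
  using f_fourth eventually_ge_at_top[of 1]
proof eventually_elim
  case (elim n)
  show ?case
    by unfold_locales
      (use elim f_meas f_mean W_def P_spec[OF elim(2)] lam W_ge in auto)
qed

text \<open>For natural numbers \<open>m \<le> m ^ 2\<close>, so the quotient is at most the root of
  \<open>m ^ 4 / n\<close>.\<close>

lemma m_sqrt_rate: "(\<lambda>n. real (m n) / sqrt (real n)) \<longlonglongrightarrow> 0"
proof (rule Lim_null_comparison[OF _ tendsto_real_sqrt[OF m_rate, simplified]])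
  show "\<forall>\<^sub>F n in sequentially. norm (real (m n) / sqrt (real n)) \<le> sqrt (real (m n) ^ 4 / real n)"
  proof (rule always_eventually, rule allI)
    fix n
    have "real (m n) \<le> real (m n) ^ 2" by (cases "m n = 0") (simp_all add: power2_eq_square)
    also have "\<dots> = sqrt (((real (m n))\<^sup>2)\<^sup>2)" by (simp only: real_sqrt_abs abs_power2)
    also have "((real (m n))\<^sup>2)\<^sup>2 = real (m n) ^ 4" by (simp flip: power_mult)
    finally show "norm (real (m n) / sqrt (real n)) \<le> sqrt (real (m n) ^ 4 / real n)"
      by (simp add: real_sqrt_divide divide_right_mono)
  qed
qed

lemma Y_conv: "(\<lambda>n. measure M {\<omega> \<in> space M. Y n \<omega> \<le> x}) \<longlonglongrightarrow> cdf std_normal_distribution x"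
proof -
  have "(\<lambda>n. measure M {\<omega> \<in> space M. (ip (m n) (\<lambda>i. \<Sum>j=1..n. f n (Z j \<omega>) i) (mapp (m n) (P n) (\<lambda>i. \<Sum>j=1..n. f n (Z j \<omega>) i)) / real n - real (m n)) / sqrt (2 * real (m n)) \<le> x}) \<longlonglongrightarrow> cdf std_normal_distribution x"
    by (rule quadratic_form_clt[OF eventually_whitened f_fourth_le C m_lim m_sqrt_rate])
  then show ?thesis
  proof (rule Lim_transform_eventually)
    show "\<forall>\<^sub>F n in sequentially. measure M {\<omega> \<in> space M. (ip (m n) (\<lambda>i. \<Sum>j=1..n. f n (Z j \<omega>) i) (mapp (m n) (P n) (\<lambda>i. \<Sum>j=1..n. f n (Z j \<omega>) i)) / real n - real (m n)) / sqrt (2 * real (m n)) \<le> x} = measure M {\<omega> \<in> space M. Y n \<omega> \<le> x}"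
      using eventually_ge_at_top[of 1]
    proof eventually_elim
      case (elim n)
      have "ip (m n) (\<lambda>i. \<Sum>j=1..n. f n (Z j \<omega>) i) (mapp (m n) (P n) (\<lambda>i. \<Sum>j=1..n. f n (Z j \<omega>) i)) / real n
          = real n * ip (m n) (wm n \<omega>) (mapp (m n) (P n) (wm n \<omega>))" for \<omega>
      proof -
        have S: "(\<lambda>i. \<Sum>j=1..n. f n (Z j \<omega>) i) = (\<lambda>i. real n * wm n \<omega> i)"
          using elim by (simp add: wm_def fun_eq_iff)
        have sc: "mapp (m n) (P n) (\<lambda>i. real n * wm n \<omega> i) = (\<lambda>i. real n * mapp (m n) (P n) (wm n \<omega>) i)"
          by (simp add: mapp_def sum_distrib_left mult_ac)
        show ?thesis unfolding S sc ip_scale_left ip_scale_right using elim by simp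
      qed
      then show ?case by (simp add: Y_def)
    qed
  qed
qed

lemma f_Z_meas: "1 \<le> n \<Longrightarrow> j \<in> {1..n} \<Longrightarrow> i < m n \<Longrightarrow> (\<lambda>\<omega>. f n (Z j \<omega>) i) \<in> borel_measurable M"
  by (rule measurable_compose[OF Z_meas f_meas]) auto

lemma wm_meas: "1 \<le> n \<Longrightarrow> i < m n \<Longrightarrow> (\<lambda>\<omega>. wm n \<omega> i) \<in> borel_measurable M"
  unfolding wm_def by (intro borel_measurable_divide borel_measurable_sum f_Z_meas borel_measurable_const) auto

lemma xm_meas: "1 \<le> n \<Longrightarrow> i < m n \<Longrightarrow> (\<lambda>\<omega>. xm n \<omega> i) \<in> borel_measurable M"
  unfolding xm_def by (intro borel_measurable_divide borel_measurable_sum v_meas borel_measurable_const) auto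

lemma ip_measurable:
  assumes "\<And>i. i < d \<Longrightarrow> (\<lambda>\<omega>. a \<omega> i) \<in> borel_measurable N" "\<And>i. i < d \<Longrightarrow> (\<lambda>\<omega>. b \<omega> i) \<in> borel_measurable N"
  shows "(\<lambda>\<omega>. ip d (a \<omega>) (b \<omega>)) \<in> borel_measurable N"
  unfolding ip_def using assms by (intro borel_measurable_sum borel_measurable_times) auto

lemma nrm_measurable:
  assumes "\<And>i. i < d \<Longrightarrow> (\<lambda>\<omega>. a \<omega> i) \<in> borel_measurable N"
  shows "(\<lambda>\<omega>. nrm d (a \<omega>)) \<in> borel_measurable N"
proof -
  have [measurable]: "(\<lambda>\<omega>. ip d (a \<omega>) (a \<omega>)) \<in> borel_measurable N" using assms by (intro ip_measurable)
  show ?thesis unfolding nrm_def by measurable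
qed

lemma mapp_measurable:
  "(\<And>i. i < d \<Longrightarrow> (\<lambda>\<omega>. a \<omega> i) \<in> borel_measurable N) \<Longrightarrow> (\<lambda>\<omega>. mapp d A (a \<omega>) i) \<in> borel_measurable N"
  unfolding mapp_def by (intro borel_measurable_sum borel_measurable_times borel_measurable_const) auto

lemma Y_meas: "1 \<le> n \<Longrightarrow> Y n \<in> borel_measurable M"
  unfolding Y_def[abs_def]
  by (intro borel_measurable_divide borel_measurable_diff borel_measurable_times borel_measurable_const
      ip_measurable mapp_measurable wm_meas)

lemma f_integrable:
  assumes n: "1 \<le> n" and i: "i < m n"
  shows "integrable Q (\<lambda>z. (f n z i)\<^sup>2)" "integrable Q (\<lambda>z. f n z i)"
proof -
  have [measurable]: "(\<lambda>z. f n z i) \<in> borel_measurable Q" by (rule f_meas[OF n i])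
  show "integrable Q (\<lambda>z. (f n z i)\<^sup>2)"
  proof (rule Bochner_Integration.integrable_bound[OF f_sq[OF n]])
    have "(f n z i)\<^sup>2 \<le> (nrm (m n) (f n z))\<^sup>2" for z
      using power_mono[OF abs_le_nrm[OF i, of "f n z"] abs_ge_zero, of 2] by simp
    then show "AE z in Q. norm ((f n z i)\<^sup>2) \<le> norm ((nrm (m n) (f n z))\<^sup>2)" by simp
  qed simp
  then show "integrable Q (\<lambda>z. f n z i)"
    using Q.integrable_power_le[of "\<lambda>z. f n z i" 2 1] by simp
qed

text \<open>The upper bound for the quadratic form, tested on a unit vector.\<close>

lemma W_diag_le:
  assumes n: "1 \<le> n" and i: "i < m n" shows "(\<integral>z. (f n z i)\<^sup>2 \<partial>Q) \<le> Lam"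
proof -
  define u where "u = (\<lambda>k. if k = i then 1 else 0 :: real)"
  have e: "ip (m n) u y = y i" for y
    using i by (simp add: u_def ip_def if_distrib[of "\<lambda>a. a * _"] cong: if_cong)
  have "mapp (m n) (W n) u i = W n i i"
    using i by (simp add: u_def mapp_def if_distrib[of "\<lambda>a. _ * a"] cong: if_cong)
  then have "ip (m n) u (mapp (m n) (W n) u) = W n i i" by (simp add: e)
  moreover have "(nrm (m n) u)\<^sup>2 = 1" unfolding nrm_sq e by (simp add: u_def)
  ultimately show ?thesis using W_le[OF n, of u] i by (simp add: W_def power2_eq_square)
qed

text \<open>The threshold is the order \<open>n * m\<close> of the expectation divided by
  \<open>e ^ 2\<close>, so that Markov's inequality leaves a probability of order
  \<open>e ^ 2\<close>. The next two events follow the same pattern, with \<open>e ^ 4\<close> for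
  the fourth moments.\<close>

definition bad_mean :: "real \<Rightarrow> nat \<Rightarrow> 'a set" where
  "bad_mean e n = {\<omega> \<in> space M. real n * (real (m n) / e\<^sup>2) < (\<Sum>i<m n. (\<Sum>j=1..n. f n (Z j \<omega>) i)\<^sup>2)}"

definition bad_fourth :: "real \<Rightarrow> nat \<Rightarrow> 'a set" where
  "bad_fourth e n = {\<omega> \<in> space M. real n * ((real (m n))\<^sup>2 / e ^ 4) < (\<Sum>j=1..n. nrm (m n) (f n (Z j \<omega>)) ^ 4)}"

text \<open>The double sum is \<open>n ^ 2\<close> times the squared Frobenius distance between the
  sample second moment matrix and \<open>W n\<close>.\<close>

definition bad_cov :: "real \<Rightarrow> nat \<Rightarrow> 'a set" where
  "bad_cov e n = {\<omega> \<in> space M. real n * ((real (m n))\<^sup>2 / e\<^sup>2)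
     < (\<Sum>(i, k)\<in>{..<m n} \<times> {..<m n}. (\<Sum>j=1..n. f n (Z j \<omega>) i * f n (Z j \<omega>) k - W n i k)\<^sup>2)}"

lemma bad_mean:
  assumes n: "1 \<le> n" "1 \<le> m n" and e: "0 < e"
  shows "bad_mean e n \<in> sets M" "measure M (bad_mean e n) \<le> Lam * e\<^sup>2"
proof -
  have c: "(\<Sum>i<m n. \<integral>z. (f n z i)\<^sup>2 \<partial>Q) \<le> real (m n) * Lam"
    using sum_bounded_above[of "{..<m n}" "\<lambda>i. \<integral>z. (f n z i)\<^sup>2 \<partial>Q" Lam] W_diag_le[OF n(1)] by simp
  have K: "0 < real (m n) / e\<^sup>2" using n e by simp
  note A = prob_sum_squares_greater[of "{..<m n}" "\<lambda>i z. f n z i", OF _ _ _ _ c n(1) K]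
  show "bad_mean e n \<in> sets M" unfolding bad_mean_def
    by (rule A(1)) (use f_meas f_integrable f_mean n in auto)
  have "measure M (bad_mean e n) \<le> real (m n) * Lam / (real (m n) / e\<^sup>2)"
    unfolding bad_mean_def by (rule A(2)) (use f_meas f_integrable f_mean n in auto)
  also have "\<dots> = Lam * e\<^sup>2" using n by simp
  finally show "measure M (bad_mean e n) \<le> Lam * e\<^sup>2" .
qed

lemma bad_fourth:
  assumes n: "1 \<le> n" "1 \<le> m n" and e: "0 < e"
    and i4: "integrable Q (\<lambda>z. nrm (m n) (f n z) ^ 4)" and le4: "(\<integral>z. nrm (m n) (f n z) ^ 4 \<partial>Q) \<le> C * (real (m n))\<^sup>2"
  shows "bad_fourth e n \<in> sets M" "measure M (bad_fourth e n) \<le> C * e ^ 4"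
proof -
  have nm: "(\<lambda>z. nrm (m n) (f n z) ^ 4) \<in> borel_measurable Q" using i4 by auto
  have int: "integrable M (\<lambda>\<omega>. \<Sum>j=1..n. nrm (m n) (f n (Z j \<omega>)) ^ 4)"
    by (rule Bochner_Integration.integrable_sum) (use integral_Z(2)[OF _ nm] i4 in auto)
  then have [measurable]: "(\<lambda>\<omega>. \<Sum>j=1..n. nrm (m n) (f n (Z j \<omega>)) ^ 4) \<in> borel_measurable M" by auto
  show "bad_fourth e n \<in> sets M" unfolding bad_fourth_def by measurable
  have "(\<integral>\<omega>. (\<Sum>j=1..n. nrm (m n) (f n (Z j \<omega>)) ^ 4) \<partial>M) = (\<Sum>j=1..n. \<integral>\<omega>. nrm (m n) (f n (Z j \<omega>)) ^ 4 \<partial>M)"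
    by (rule Bochner_Integration.integral_sum) (use integral_Z(2)[OF _ nm] i4 in auto)
  also have "\<dots> = (\<Sum>j=1..n. \<integral>z. nrm (m n) (f n z) ^ 4 \<partial>Q)"
    by (intro sum.cong refl integral_Z(1)[OF _ nm]) auto
  also have "\<dots> \<le> real n * (C * (real (m n))\<^sup>2)" using le4 by (simp add: mult_left_mono)
  finally have "measure M (bad_fourth e n) \<le> (real n * (C * (real (m n))\<^sup>2)) / (real n * ((real (m n))\<^sup>2 / e ^ 4))"
    unfolding bad_fourth_def by (intro M.prob_greater_le[OF int]) (use n e in \<open>auto intro: sum_nonneg\<close>)
  also have "\<dots> = C * e ^ 4" using n e by simp
  finally show "measure M (bad_fourth e n) \<le> C * e ^ 4" .
qed

text \<open>The squares of the products of two coordinates add up to the fourth power of the norm.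
  The variances of all \<open>m ^ 2\<close> entries together are therefore at most the fourth
  moment, of order \<open>m ^ 2\<close>.\<close>

lemma bad_cov:
  assumes n: "1 \<le> n" "1 \<le> m n" and e: "0 < e"
    and i4: "integrable Q (\<lambda>z. nrm (m n) (f n z) ^ 4)" and le4: "(\<integral>z. nrm (m n) (f n z) ^ 4 \<partial>Q) \<le> C * (real (m n))\<^sup>2"
  shows "bad_cov e n \<in> sets M" "measure M (bad_cov e n) \<le> C * e\<^sup>2"
proof -
  let ?I = "{..<m n} \<times> {..<m n}"
  define g where "g = (\<lambda>(i, k) z. f n z i * f n z k - W n i k)"
  have gm: "g p \<in> borel_measurable Q" if "p \<in> ?I" for p
    using that f_meas[OF n(1)] by (auto simp: g_def)
  have prod_le: "(f n z i * f n z k)\<^sup>2 \<le> nrm (m n) (f n z) ^ 4" if "i < m n" "k < m n" for i k z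
  proof -
    have "\<bar>f n z i * f n z k\<bar> \<le> nrm (m n) (f n z) * nrm (m n) (f n z)"
      unfolding abs_mult using that by (intro mult_mono abs_le_nrm) auto
    from power_mono[OF this abs_ge_zero, of 2] show ?thesis
      by (simp add: power2_eq_square power4_eq_xxxx)
  qed
  have i2: "integrable Q (\<lambda>z. (f n z i * f n z k)\<^sup>2)" if "i < m n" "k < m n" for i k
    by (rule Bochner_Integration.integrable_bound[OF i4])
      (use that prod_le f_meas[OF n(1)] in auto)
  have i1: "integrable Q (\<lambda>z. f n z i * f n z k)" if "i < m n" "k < m n" for i k
    using Q.integrable_power_le[of "\<lambda>z. f n z i * f n z k" 2 1] i2[OF that] f_meas[OF n(1)] that by simp
  have g0: "(\<integral>z. g p z \<partial>Q) = 0" if "p \<in> ?I" for p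
    using that i1 by (auto simp: g_def W_def Q.prob_space)
  have gsq: "(g (i, k) z)\<^sup>2 = (f n z i * f n z k)\<^sup>2 - 2 * W n i k * (f n z i * f n z k) + (W n i k)\<^sup>2" for i k z
    by (simp add: g_def power2_diff)
  have g2: "integrable Q (\<lambda>z. (g p z)\<^sup>2)" if "p \<in> ?I" for p
    using that i1 i2 by (cases p) (auto simp: gsq)
  have g2le: "(\<integral>z. (g (i, k) z)\<^sup>2 \<partial>Q) \<le> (\<integral>z. (f n z i * f n z k)\<^sup>2 \<partial>Q)" if "i < m n" "k < m n" for i k
  proof -
    have "(\<integral>z. (g (i, k) z)\<^sup>2 \<partial>Q) = (\<integral>z. (f n z i * f n z k)\<^sup>2 \<partial>Q) - (W n i k)\<^sup>2"
      unfolding gsq using i1[OF that] i2[OF that] that by (simp add: Q.prob_space W_def[symmetric] power2_eq_square)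
    then show ?thesis by simp
  qed
  have c: "(\<Sum>p\<in>?I. \<integral>z. (g p z)\<^sup>2 \<partial>Q) \<le> C * (real (m n))\<^sup>2"
  proof -
    have "(\<Sum>p\<in>?I. \<integral>z. (g p z)\<^sup>2 \<partial>Q) \<le> (\<Sum>(i, k)\<in>?I. \<integral>z. (f n z i * f n z k)\<^sup>2 \<partial>Q)"
      by (intro sum_mono) (use g2le in auto)
    also have "\<dots> = (\<integral>z. (\<Sum>(i, k)\<in>?I. (f n z i * f n z k)\<^sup>2) \<partial>Q)"
      unfolding case_prod_beta by (subst Bochner_Integration.integral_sum) (use i2 in auto)
    also have "\<dots> = (\<integral>z. nrm (m n) (f n z) ^ 4 \<partial>Q)"
    proof (intro Bochner_Integration.integral_cong refl)
      fix z
      have "nrm (m n) (f n z) ^ 4 = (ip (m n) (f n z) (f n z))\<^sup>2" by (simp add: nrm_sq[symmetric] flip: power_mult)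
      also have "\<dots> = (\<Sum>(i, k)\<in>?I. (f n z i * f n z k)\<^sup>2)"
        unfolding ip_def power2_eq_square[of "sum _ _"] sum_product sum.cartesian_product
        by (intro sum.cong refl) (simp add: power2_eq_square mult_ac split_beta)
      finally show "(\<Sum>(i, k)\<in>?I. (f n z i * f n z k)\<^sup>2) = nrm (m n) (f n z) ^ 4" by simp
    qed
    finally show ?thesis using le4 by simp
  qed
  have K: "0 < (real (m n))\<^sup>2 / e\<^sup>2" using n e by simp
  have set_eq: "bad_cov e n = {\<omega> \<in> space M. real n * ((real (m n))\<^sup>2 / e\<^sup>2) < (\<Sum>p\<in>?I. (\<Sum>j=1..n. g p (Z j \<omega>))\<^sup>2)}"
    unfolding bad_cov_def g_def by (simp add: split_beta)
  note A = prob_sum_squares_greater[of ?I g, OF _ gm g2 g0 c n(1) K]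
  show "bad_cov e n \<in> sets M" unfolding set_eq by (rule A(1)) auto
  have "measure M (bad_cov e n) \<le> C * (real (m n))\<^sup>2 / ((real (m n))\<^sup>2 / e\<^sup>2)"
    unfolding set_eq by (rule A(2)) auto
  also have "\<dots> = C * e\<^sup>2" using n e by simp
  finally show "measure M (bad_cov e n) \<le> C * e\<^sup>2" .
qed

end

section \<open>Choice of the tolerance and approximation outside the exceptional events\<close>

context el_asymptotics
begin

definition dist_sq :: "nat \<Rightarrow> 'a \<Rightarrow> real" where
  "dist_sq n \<omega> = (1 / real n) * (\<Sum>j=1..n. (nrm (m n) (\<lambda>i. v n j \<omega> i - f n (Z j \<omega>) i))\<^sup>2)"

text \<open>The power \<open>e ^ 8\<close> makes the root mean square error
  \<open>e ^ 4 / mu\<close>. In contrast to the moment events, its probability is known only to tend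
  to 0 for each fixed \<open>e\<close>.\<close>

definition bad_dist :: "real \<Rightarrow> nat \<Rightarrow> 'a set" where
  "bad_dist e n = {\<omega> \<in> space M. \<bar>dist_sq n \<omega>\<bar> > e ^ 8 * (1 / real (m n))}"

lemma bad_dist:
  assumes "1 \<le> n" shows "bad_dist e n \<in> sets M"
proof -
  have [measurable]: "dist_sq n \<in> borel_measurable M"
    unfolding dist_sq_def[abs_def]
    by (intro borel_measurable_times borel_measurable_const borel_measurable_sum borel_measurable_power
        nrm_measurable borel_measurable_diff v_meas f_Z_meas assms) auto
  show ?thesis unfolding bad_dist_def by measurable
qed

text \<open>Restates the complements of the exceptional events as the hypotheses of
  \<open>el_quadratic_approximation\<close>, in the scales \<open>h\<close> and
  \<open>mu\<close>.\<close>

lemma good_bounds: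
  assumes n: "1 \<le> n" "1 \<le> m n" and e: "0 < e" and w: "\<omega> \<in> space M"
  defines "h \<equiv> root 4 (real n)" and "mu \<equiv> sqrt (real (m n))"
  shows "\<omega> \<notin> bad_mean e n \<Longrightarrow> nrm (m n) (wm n \<omega>) \<le> mu / (h\<^sup>2 * e)"
    and "\<omega> \<notin> bad_fourth e n \<Longrightarrow> (\<Sum>j=1..n. nrm (m n) (f n (Z j \<omega>)) ^ 4) \<le> real n * (mu / e) ^ 4"
    and "\<omega> \<notin> bad_cov e n \<Longrightarrow> \<bar>(\<Sum>j=1..n. ip (m n) u (f n (Z j \<omega>)) * ip (m n) u' (f n (Z j \<omega>))) / real n - ip (m n) u (mapp (m n) (W n) u')\<bar>
      \<le> mu\<^sup>2 / (h\<^sup>2 * e) * nrm (m n) u * nrm (m n) u'"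
    and "\<omega> \<notin> bad_dist e n \<Longrightarrow> (\<Sum>j=1..n. (nrm (m n) (\<lambda>i. v n j \<omega> i - f n (Z j \<omega>) i))\<^sup>2) \<le> real n * (e ^ 4 / mu)\<^sup>2"
proof -
  have h0: "0 < h" using n by (simp add: h_def)
  have h4: "h ^ 4 = real n" by (simp add: h_def real_root_pow_pos2)
  have h22: "(h\<^sup>2)\<^sup>2 = real n" using h4 by (simp flip: power_mult)
  have mu0: "0 < mu" "mu\<^sup>2 = real (m n)" using n by (simp_all add: mu_def)
  have mu4: "mu ^ 4 = (real (m n))\<^sup>2" by (simp add: mu0(2)[symmetric] flip: power_mult)
  show "nrm (m n) (wm n \<omega>) \<le> mu / (h\<^sup>2 * e)" if "\<omega> \<notin> bad_mean e n"
  proof (rule power2_le_imp_le)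
    have "(nrm (m n) (wm n \<omega>))\<^sup>2 = (\<Sum>i<m n. (\<Sum>j=1..n. f n (Z j \<omega>) i)\<^sup>2) / (real n)\<^sup>2"
    proof -
      have "(nrm (m n) (wm n \<omega>))\<^sup>2 = (\<Sum>i<m n. (wm n \<omega> i)\<^sup>2)"
        unfolding nrm_sq ip_def by (simp only: power2_eq_square)
      then show ?thesis unfolding wm_def power_divide sum_divide_distrib[of _ _ "(real n)\<^sup>2"] .
    qed
    also have "\<dots> \<le> real n * (real (m n) / e\<^sup>2) / (real n)\<^sup>2"
      using that w by (intro divide_right_mono) (auto simp: bad_mean_def)
    also have "\<dots> = (mu / (h\<^sup>2 * e))\<^sup>2"
      using n e by (simp add: power_divide power_mult_distrib mu0 h22 h4 power2_eq_square[of "real n"])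
    finally show "(nrm (m n) (wm n \<omega>))\<^sup>2 \<le> (mu / (h\<^sup>2 * e))\<^sup>2" .
    show "0 \<le> mu / (h\<^sup>2 * e)" using mu0 e by simp
  qed
  show "(\<Sum>j=1..n. nrm (m n) (f n (Z j \<omega>)) ^ 4) \<le> real n * (mu / e) ^ 4" if "\<omega> \<notin> bad_fourth e n"
    using that w by (auto simp: bad_fourth_def power_divide mu4 not_less)
  show "\<bar>(\<Sum>j=1..n. ip (m n) u (f n (Z j \<omega>)) * ip (m n) u' (f n (Z j \<omega>))) / real n - ip (m n) u (mapp (m n) (W n) u')\<bar>
      \<le> mu\<^sup>2 / (h\<^sup>2 * e) * nrm (m n) u * nrm (m n) u'" if "\<omega> \<notin> bad_cov e n"
  proof -
    let ?d = "m n"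
    define D where "D = (\<lambda>i k. (\<Sum>j=1..n. f n (Z j \<omega>) i * f n (Z j \<omega>) k - W n i k) / real n)"
    have D: "(\<Sum>j=1..n. ip ?d u (f n (Z j \<omega>)) * ip ?d u' (f n (Z j \<omega>))) / real n - ip ?d u (mapp ?d (W n) u') = ip ?d u (mapp ?d D u')"
    proof -
      have D': "D i k = (\<Sum>j=1..n. f n (Z j \<omega>) i * f n (Z j \<omega>) k) / real n - W n i k" for i k
        using n by (simp add: D_def sum_subtractf diff_divide_distrib)
      have "ip ?d u (mapp ?d D u') = (\<Sum>i<?d. \<Sum>k<?d. u i * u' k * ((\<Sum>j=1..n. f n (Z j \<omega>) i * f n (Z j \<omega>) k) / real n)) - (\<Sum>i<?d. \<Sum>k<?d. u i * u' k * W n i k)"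
        unfolding ip_def mapp_def D' sum_distrib_left sum_subtractf[symmetric]
        by (intro sum.cong refl) (simp add: algebra_simps)
      also have "(\<Sum>i<?d. \<Sum>k<?d. u i * u' k * W n i k) = ip ?d u (mapp ?d (W n) u')"
        unfolding ip_def mapp_def sum_distrib_left by (intro sum.cong refl) simp
      also have "(\<Sum>i<?d. \<Sum>k<?d. u i * u' k * ((\<Sum>j=1..n. f n (Z j \<omega>) i * f n (Z j \<omega>) k) / real n))
          = (\<Sum>i<?d. \<Sum>k<?d. \<Sum>j=1..n. (u i * f n (Z j \<omega>) i) * (u' k * f n (Z j \<omega>) k)) / real n"
        unfolding sum_divide_distrib sum_distrib_left by (intro sum.cong refl) simp
      also have "(\<Sum>i<?d. \<Sum>k<?d. \<Sum>j=1..n. (u i * f n (Z j \<omega>) i) * (u' k * f n (Z j \<omega>) k))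
          = (\<Sum>i<?d. \<Sum>j=1..n. \<Sum>k<?d. (u i * f n (Z j \<omega>) i) * (u' k * f n (Z j \<omega>) k))"
        by (intro sum.cong refl sum.swap)
      also have "\<dots> = (\<Sum>j=1..n. \<Sum>i<?d. \<Sum>k<?d. (u i * f n (Z j \<omega>) i) * (u' k * f n (Z j \<omega>) k))"
        by (rule sum.swap)
      also have "\<dots> = (\<Sum>j=1..n. ip ?d u (f n (Z j \<omega>)) * ip ?d u' (f n (Z j \<omega>)))"
        unfolding ip_def sum_product ..
      finally show ?thesis by simp
    qed
    have "(\<Sum>i<?d. \<Sum>k<?d. (D i k)\<^sup>2) = (\<Sum>(i, k)\<in>{..<?d} \<times> {..<?d}. (\<Sum>j=1..n. f n (Z j \<omega>) i * f n (Z j \<omega>) k - W n i k)\<^sup>2) / (real n)\<^sup>2"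
      unfolding D_def power_divide sum.cartesian_product sum_divide_distrib[of _ _ "(real n)\<^sup>2"]
      by (intro sum.cong refl) (simp only: split_beta)
    also have "\<dots> \<le> real n * ((real ?d)\<^sup>2 / e\<^sup>2) / (real n)\<^sup>2"
      using that w by (intro divide_right_mono) (auto simp: bad_cov_def)
    also have "\<dots> = (mu\<^sup>2 / (h\<^sup>2 * e))\<^sup>2"
      using n e by (simp add: power_divide power_mult_distrib mu0 h22 h4 power2_eq_square[of "real n"])
    finally have "sqrt (\<Sum>i<?d. \<Sum>k<?d. (D i k)\<^sup>2) \<le> mu\<^sup>2 / (h\<^sup>2 * e)"
      using e by (intro real_le_lsqrt) (auto intro!: sum_nonneg)
    then have "sqrt (\<Sum>i<?d. \<Sum>k<?d. (D i k)\<^sup>2) * nrm ?d u * nrm ?d u' \<le> mu\<^sup>2 / (h\<^sup>2 * e) * nrm ?d u * nrm ?d u'"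
      by (intro mult_right_mono) auto
    then show ?thesis unfolding D using frobenius_bound[of ?d u D u'] by linarith
  qed
  show "(\<Sum>j=1..n. (nrm (m n) (\<lambda>i. v n j \<omega> i - f n (Z j \<omega>) i))\<^sup>2) \<le> real n * (e ^ 4 / mu)\<^sup>2" if "\<omega> \<notin> bad_dist e n"
  proof -
    have "dist_sq n \<omega> \<le> e ^ 8 * (1 / real (m n))" using that w by (auto simp: bad_dist_def abs_le_iff not_less)
    then have "(\<Sum>j=1..n. (nrm (m n) (\<lambda>i. v n j \<omega> i - f n (Z j \<omega>) i))\<^sup>2) \<le> e ^ 8 * (1 / real (m n)) * real n"
      using n by (simp add: dist_sq_def pos_divide_le_eq)
    also have "\<dots> = real n * (e ^ 4 / mu)\<^sup>2" by (simp add: power_divide mu0 flip: power_mult)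
    finally show ?thesis .
  qed
qed

text \<open>The mean of the estimated constraints is \<open>wm - y\<close> up to a remainder of
  smaller order than \<open>n powr (- 1 / 2)\<close>; part (i) takes \<open>y = 0\<close>, part (ii)
  the correction by \<open>\<psi>\<close>. The second condition in \<open>yB\<close> bounds the
  cross term directly, since norm bounds would give the order \<open>sqrt m\<close>. The
  approximating form involves \<open>wm\<close> alone.\<close>

theorem el_quadratic_form_approx:
  fixes y :: "nat \<Rightarrow> 'a \<Rightarrow> nat \<Rightarrow> real" and B :: "real \<Rightarrow> nat \<Rightarrow> 'a set" and cy by' :: real
  assumes y_meas: "\<And>n i. 1 \<le> n \<Longrightarrow> i < m n \<Longrightarrow> (\<lambda>\<omega>. y n \<omega> i) \<in> borel_measurable M"
    and mean_close: "little_op M (\<lambda>n \<omega>. nrm (m n) (\<lambda>i. xm n \<omega> i - (wm n \<omega> i - y n \<omega> i))) (\<lambda>n. real n powr (- 1 / 2))"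
    and B: "\<And>e n. 0 < e \<Longrightarrow> 1 \<le> n \<Longrightarrow> B e n \<in> sets M" "\<And>e n. 0 < e \<Longrightarrow> 1 \<le> n \<Longrightarrow> measure M (B e n) \<le> by' * e\<^sup>2"
    and yB: "\<And>e n \<omega>. 0 < e \<Longrightarrow> 1 \<le> n \<Longrightarrow> \<omega> \<in> space M - B e n \<Longrightarrow> nrm (m n) (y n \<omega>) \<le> cy / (sqrt (real n) * e)"
      "\<And>e n \<omega>. 0 < e \<Longrightarrow> 1 \<le> n \<Longrightarrow> \<omega> \<in> space M - B e n \<Longrightarrow> \<bar>real n * ip (m n) (y n \<omega>) (mapp (m n) (P n) (wm n \<omega>))\<bar> \<le> cy / e\<^sup>2"
    and cy: "0 \<le> cy"
  shows "\<exists>G b. (\<forall>n. G n \<in> sets M) \<and> (\<lambda>n. measure M (G n)) \<longlonglongrightarrow> 1 \<and> b \<longlonglongrightarrow> (0::real) \<and>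
    (\<forall>\<^sub>F n in sequentially. \<forall>\<omega>\<in>G n. 0 < elr (m n) n (\<lambda>j. v n j \<omega>) \<and>
      \<bar>- 2 * ln (elr (m n) n (\<lambda>j. v n j \<omega>)) - real n * ip (m n) (wm n \<omega>) (mapp (m n) (P n) (wm n \<omega>))\<bar> \<le> b n * sqrt (real (m n)))"
proof -
  define rem where "rem = (\<lambda>n \<omega>. nrm (m n) (\<lambda>i. xm n \<omega> i - (wm n \<omega> i - y n \<omega> i)))"
  \<comment> \<open>One power of \<open>e\<close> offsets the factor \<open>1 / e\<close> in the
    bound for \<open>wm\<close>, the other makes the cross term of remainder and mean as small as
    \<open>e * mu\<close>.\<close>
  define bad_rem where "bad_rem = (\<lambda>e n. {\<omega> \<in> space M. \<bar>rem n \<omega>\<bar> > e\<^sup>2 * real n powr (- 1 / 2)})"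
  have bad_rem_meas: "bad_rem e n \<in> sets M" if "1 \<le> n" for e n
  proof -
    have [measurable]: "rem n \<in> borel_measurable M"
      unfolding rem_def by (intro nrm_measurable borel_measurable_diff xm_meas wm_meas y_meas that)
    show ?thesis unfolding bad_rem_def by measurable
  qed
  \<comment> \<open>The last summand encodes the two deterministic rates as a sequence that vanishes
    eventually for each fixed \<open>e\<close>, so that a single diagonal choice covers random and
    deterministic conditions. Events with an explicit bound of order \<open>e ^ 2\<close> stay
    outside \<open>p\<close>.\<close>
  define p where "p = (\<lambda>e n. measure M (bad_dist e n) + measure M (bad_rem e n)
      + (if real (m n) ^ 4 \<le> e ^ 16 * real n \<and> 1 \<le> e ^ 8 * real (m n) then 0 else 1))"
  have p0: "(\<lambda>n. p e n) \<longlonglongrightarrow> 0" if e: "0 < e" for e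
  proof -
    have 1: "(\<lambda>n. measure M (bad_dist e n)) \<longlonglongrightarrow> 0"
      using v_close e unfolding little_op_def bad_dist_def dist_sq_def by simp
    have 2: "(\<lambda>n. measure M (bad_rem e n)) \<longlonglongrightarrow> 0"
      using mean_close e unfolding little_op_def bad_rem_def rem_def by simp
    have "\<forall>\<^sub>F n in sequentially. real (m n) ^ 4 / real n < e ^ 16"
      using order_tendstoD(2)[OF m_rate, of "e ^ 16"] e by simp
    moreover have "\<forall>\<^sub>F n in sequentially. 1 / e ^ 8 \<le> real (m n)"
      using filterlim_compose[OF filterlim_real_sequentially m_lim] by (simp add: filterlim_at_top)
    ultimately have "\<forall>\<^sub>F n in sequentially. (if real (m n) ^ 4 \<le> e ^ 16 * real n \<and> 1 \<le> e ^ 8 * real (m n) then 0 else 1) = (0::real)"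
      using eventually_gt_at_top[of 0]
    proof eventually_elim
      case (elim n)
      then show ?case using e by (simp add: pos_divide_less_eq pos_divide_le_eq mult.commute)
    qed
    then have 3: "(\<lambda>n. if real (m n) ^ 4 \<le> e ^ 16 * real n \<and> 1 \<le> e ^ 8 * real (m n) then 0 else 1::real) \<longlonglongrightarrow> 0"
      by (rule tendsto_eventually)
    show ?thesis unfolding p_def using tendsto_add[OF tendsto_add[OF 1 2] 3] by simp
  qed
  obtain e where e: "\<And>n. 0 < e n" "e \<longlonglongrightarrow> 0" "(\<lambda>n. p (e n) n) \<longlonglongrightarrow> 0"
    using diagonal_rate[of p] p0 by blast
  define ok where "ok = (\<lambda>n. 1 \<le> n \<and> 1 \<le> m n \<and> e n \<le> 1 \<and> integrable Q (\<lambda>z. nrm (m n) (f n z) ^ 4)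
    \<and> (\<integral>z. nrm (m n) (f n z) ^ 4 \<partial>Q) \<le> C * (real (m n))\<^sup>2 \<and> real (m n) ^ 4 \<le> e n ^ 16 * real n \<and> 1 \<le> e n ^ 8 * real (m n))"
  define bad where "bad = (\<lambda>n. bad_dist (e n) n \<union> bad_rem (e n) n \<union> bad_mean (e n) n \<union> bad_fourth (e n) n \<union> bad_cov (e n) n \<union> B (e n) n)"
  define G where "G = (\<lambda>n. if ok n then space M - bad n else {})"
  have evok: "\<forall>\<^sub>F n in sequentially. ok n"
  proof -
    have "\<forall>\<^sub>F n in sequentially. 1 \<le> m n" using m_lim by (simp add: filterlim_at_top)
    moreover have "\<forall>\<^sub>F n in sequentially. e n < 1" using order_tendstoD(2)[OF e(2)] by simp
    moreover have "\<forall>\<^sub>F n in sequentially. p (e n) n < 1" using order_tendstoD(2)[OF e(3)] by simp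
    ultimately show ?thesis using f_fourth f_fourth_le eventually_ge_at_top[of 1]
    proof eventually_elim
      case (elim n)
      \<comment> \<open>A value of \<open>p\<close> below 1 forces the indicator in its last summand
        to be 0, which gives the two rates at tolerance \<open>e n\<close>.\<close>
      have "\<not> (real (m n) ^ 4 \<le> e n ^ 16 * real n \<and> 1 \<le> e n ^ 8 * real (m n)) \<Longrightarrow> 1 \<le> p (e n) n"
        unfolding p_def by (simp add: add_increasing)
      then show ?case using elim by (auto simp: ok_def)
    qed
  qed
  have bad_meas: "bad n \<in> sets M" if ok: "ok n" for n
    unfolding bad_def using ok e(1)[of n] unfolding ok_def
    by (intro sets.Un bad_dist bad_rem_meas bad_mean bad_fourth bad_cov B) auto
  have bad_prob: "measure M (bad n) \<le> p (e n) n + (Lam + C + C + by') * (e n)\<^sup>2" if ok: "ok n" for n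
  proof -
    have n: "1 \<le> n" "1 \<le> m n" and e1: "e n \<le> 1" and
      i4: "integrable Q (\<lambda>z. nrm (m n) (f n z) ^ 4)" and
      le4: "(\<integral>z. nrm (m n) (f n z) ^ 4 \<partial>Q) \<le> C * (real (m n))\<^sup>2" using ok by (auto simp: ok_def)
    note ms = bad_dist[OF n(1), of "e n"] bad_rem_meas[OF n(1), of "e n"] bad_mean[OF n e(1)] bad_fourth[OF n e(1) i4 le4]
      bad_cov[OF n e(1) i4 le4] B[OF e(1) n(1)]
    have "measure M (bad n) \<le> measure M (bad_dist (e n) n) + measure M (bad_rem (e n) n) + measure M (bad_mean (e n) n)
      + measure M (bad_fourth (e n) n) + measure M (bad_cov (e n) n) + measure M (B (e n) n)"
      unfolding bad_def by (intro order_trans[OF measure_Un_le] add_right_mono order_refl sets.Un ms)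
    also have "\<dots> \<le> measure M (bad_dist (e n) n) + measure M (bad_rem (e n) n) + Lam * (e n)\<^sup>2 + C * (e n) ^ 4 + C * (e n)\<^sup>2 + by' * (e n)\<^sup>2"
      by (intro add_mono order_refl ms)
    also have "C * (e n) ^ 4 \<le> C * (e n)\<^sup>2"
      using C e1 e(1)[of n] by (intro mult_left_mono power_decreasing) auto
    finally have "measure M (bad n) \<le> measure M (bad_dist (e n) n) + measure M (bad_rem (e n) n) + (Lam + C + C + by') * (e n)\<^sup>2"
      by (simp add: distrib_right)
    then show ?thesis using ok by (simp add: p_def ok_def)
  qed
  define L where "L = sqrt (Lam + 1)"
  \<comment> \<open>The summands 1 and \<open>cy\<close> bound the norms of remainder and
    correction; for the cross term, the remainder contributes \<open>1 / lam\<close> and the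
    correction again \<open>cy\<close>.\<close>
  define c where "c = 1 + cy + 1 / lam"
  define C1 where "C1 = 2 + 2 * L + (1 + c)\<^sup>2"
  define C2 where "C2 = 2 * (1 + c) / lam"
  define K where "K = C2\<^sup>2 * C1 + 8 * C2 ^ 3 * (4 * L + 4 + (1 + c) ^ 3) + 2 * c + c\<^sup>2 / lam"
  have c0: "0 \<le> c" using cy lam by (simp add: c_def)
  show ?thesis
  proof (intro exI[of _ G] exI[of _ "\<lambda>n. K * e n"] conjI allI)
    show "G n \<in> sets M" for n using bad_meas by (auto simp: G_def)
    show "(\<lambda>n. K * e n) \<longlonglongrightarrow> 0" using tendsto_mult_right_zero[OF e(2)] .
    show "(\<lambda>n. measure M (G n)) \<longlonglongrightarrow> 1"
    proof -
      have b0: "(\<lambda>n. p (e n) n + (Lam + C + C + by') * (e n)\<^sup>2) \<longlonglongrightarrow> 0"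
      proof -
        have "(\<lambda>n. (e n)\<^sup>2) \<longlonglongrightarrow> 0" using tendsto_power[OF e(2), of 2] by simp
        then show ?thesis
          using tendsto_add[OF e(3) tendsto_mult_right_zero] by (simp only: add_0_right)
      qed
      have "(\<lambda>n. 1 - measure M (G n)) \<longlonglongrightarrow> 0"
      proof (rule Lim_null_comparison[OF _ b0])
        show "\<forall>\<^sub>F n in sequentially. norm (1 - measure M (G n)) \<le> p (e n) n + (Lam + C + C + by') * (e n)\<^sup>2"
          using evok
        proof eventually_elim
          case (elim n)
          then show ?case using bad_prob[OF elim] M.prob_compl[OF bad_meas[OF elim]] by (simp add: G_def)
        qed
      qed
      from tendsto_diff[OF tendsto_const[of 1] this] show ?thesis by simp
    qed
    have "\<forall>\<^sub>F n in sequentially. C1 * e n < lam / 2" "\<forall>\<^sub>F n in sequentially. C2 * (3 + c) * e n < 1 / 2"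
      by (rule order_tendstoD(2)[OF tendsto_mult_right_zero[OF e(2)]]; use lam in simp)+
    with evok show "\<forall>\<^sub>F n in sequentially. \<forall>\<omega>\<in>G n. 0 < elr (m n) n (\<lambda>j. v n j \<omega>) \<and>
      \<bar>- 2 * ln (elr (m n) n (\<lambda>j. v n j \<omega>)) - real n * ip (m n) (wm n \<omega>) (mapp (m n) (P n) (wm n \<omega>))\<bar> \<le> K * e n * sqrt (real (m n))"
    proof eventually_elim
      case (elim n)
      show ?case
      proof
        fix \<omega> assume "\<omega> \<in> G n"
        then have w: "\<omega> \<in> space M" and nb: "\<omega> \<notin> bad n" using elim by (auto simp: G_def)
        have n: "1 \<le> n" "1 \<le> m n" and e1: "e n \<le> 1" and r4: "real (m n) ^ 4 \<le> e n ^ 16 * real n" and r8: "1 \<le> e n ^ 8 * real (m n)"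
          using elim by (auto simp: ok_def)
        define h where "h = root 4 (real n)"
        define mu where "mu = sqrt (real (m n))"
        note gb = good_bounds[OF n e(1) w, folded h_def mu_def]
        have h0: "0 < h" using n by (simp add: h_def)
        have h4: "real n = h ^ 4" by (simp add: h_def real_root_pow_pos2)
        have h2: "sqrt (real n) = h\<^sup>2"
        proof -
          have "real n = (h\<^sup>2)\<^sup>2" using h4 by (simp flip: power_mult)
          then show ?thesis by (simp only: real_sqrt_abs abs_power2)
        qed
        have mu1: "1 \<le> mu" "mu\<^sup>2 = real (m n)" using n by (simp_all add: mu_def)
        have A1: "mu\<^sup>2 \<le> e n ^ 4 * h"
        proof -
          have "(mu\<^sup>2) ^ 4 \<le> (e n ^ 4 * h) ^ 4" using r4 by (simp add: mu1 power_mult_distrib h4 flip: power_mult)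
          then show ?thesis using h0 e(1)[of n] by (subst (asm) power_mono_iff) auto
        qed
        have A2: "1 \<le> e n ^ 4 * mu"
        proof (rule power2_le_imp_le)
          show "1\<^sup>2 \<le> (e n ^ 4 * mu)\<^sup>2" using r8 by (simp add: power_mult_distrib mu1 flip: power_mult)
        qed (use mu1 e(1)[of n] in simp)
        define r where "r = (\<lambda>i. xm n \<omega> i - (wm n \<omega> i - y n \<omega> i))"
        have rem: "nrm (m n) r \<le> (e n)\<^sup>2 / h\<^sup>2"
        proof -
          have "\<omega> \<notin> bad_rem (e n) n" using nb by (simp add: bad_def)
          then have "\<bar>rem n \<omega>\<bar> \<le> (e n)\<^sup>2 * real n powr (- 1 / 2)" using w by (simp add: bad_rem_def not_less)
          moreover have "real n powr (- 1 / 2) = 1 / h\<^sup>2"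
          proof -
            have "real n powr (- 1 / 2) = real n powr (- (1 / 2))" by simp
            also have "\<dots> = 1 / h\<^sup>2"
              unfolding powr_minus_divide powr_half_sqrt[OF of_nat_0_le_iff] h2 ..
            finally show ?thesis .
          qed
          ultimately show ?thesis by (simp add: rem_def r_def)
        qed
        have yb: "nrm (m n) (y n \<omega>) \<le> cy / (h\<^sup>2 * e n)" "\<bar>real n * ip (m n) (y n \<omega>) (mapp (m n) (P n) (wm n \<omega>))\<bar> \<le> cy / (e n)\<^sup>2"
          using yB[OF e(1) n(1), of \<omega>] w nb unfolding h2 by (auto simp: bad_def)
        have wmb: "nrm (m n) (wm n \<omega>) \<le> mu / (h\<^sup>2 * e n)" by (rule gb(1)) (use nb in \<open>simp add: bad_def\<close>)
        have diff: "(\<lambda>i. xm n \<omega> i - wm n \<omega> i) = (\<lambda>i. r i - y n \<omega> i)" by (simp add: r_def)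
        have en0: "0 < e n" by (rule e(1))
        have e2e: "(e n)\<^sup>2 \<le> 1 / e n"
        proof -
          have "(e n)\<^sup>2 * e n \<le> 1 * 1" using e1 en0 by (intro mult_mono power_le_one) auto
          then show ?thesis using en0 by (simp add: pos_le_divide_eq)
        qed
        have rb: "nrm (m n) (\<lambda>i. xm n \<omega> i - wm n \<omega> i) \<le> c / (h\<^sup>2 * e n)"
        proof -
          have "nrm (m n) (\<lambda>i. r i - y n \<omega> i) \<le> nrm (m n) r + nrm (m n) (\<lambda>i. - y n \<omega> i)"
            using nrm_triangle[of "m n" r "\<lambda>i. - y n \<omega> i"] by simp
          also have "nrm (m n) (\<lambda>i. - y n \<omega> i) = nrm (m n) (y n \<omega>)" by (simp add: nrm_def ip_def)
          also have "nrm (m n) r + nrm (m n) (y n \<omega>) \<le> (1 / e n) / h\<^sup>2 + cy / (h\<^sup>2 * e n)"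
            by (intro add_mono yb order_trans[OF rem] divide_right_mono e2e) simp
          also have "\<dots> = (1 + cy) / (h\<^sup>2 * e n)" by (simp add: add_divide_distrib mult.commute)
          also have "\<dots> \<le> c / (h\<^sup>2 * e n)" using lam h0 en0 by (intro divide_right_mono) (auto simp: c_def)
          finally show ?thesis unfolding diff .
        qed
        have cross: "\<bar>real n * ip (m n) (\<lambda>i. xm n \<omega> i - wm n \<omega> i) (mapp (m n) (P n) (wm n \<omega>))\<bar> \<le> c * e n * mu"
        proof -
          let ?Pw = "mapp (m n) (P n) (wm n \<omega>)"
          have Pw: "nrm (m n) ?Pw \<le> (mu / (h\<^sup>2 * e n)) / lam"
            by (rule order_trans[OF nrm_mapp_inverse_le[OF lam P_spec(2)[OF n(1)] W_ge[OF n(1)]] divide_right_mono[OF wmb]]) (use lam in auto)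
          have "\<bar>ip (m n) r ?Pw\<bar> \<le> ((e n)\<^sup>2 / h\<^sup>2) * ((mu / (h\<^sup>2 * e n)) / lam)"
            by (rule order_trans[OF ip_Cauchy_Schwarz mult_mono[OF rem Pw]]) (use lam in auto)
          then have "real n * \<bar>ip (m n) r ?Pw\<bar> \<le> real n * (((e n)\<^sup>2 / h\<^sup>2) * ((mu / (h\<^sup>2 * e n)) / lam))"
            by (rule mult_left_mono) simp
          also have "\<dots> = 1 / lam * (e n * mu)"
          proof -
            have "g * g * (a\<^sup>2 / g * (b / (g * a) / lam)) = 1 / lam * (a * b)" if "g \<noteq> 0" "a \<noteq> 0" for g a b
              using that lam by (simp add: power2_eq_square)
            from this[of "h\<^sup>2" "e n" mu] show ?thesis using h0 en0 h4 by (simp flip: power_add)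
          qed
          finally have 1: "\<bar>real n * ip (m n) r ?Pw\<bar> \<le> 1 / lam * (e n * mu)" by (simp add: abs_mult)
          \<comment> \<open>The cross term of the correction is bounded in probability, of order
            \<open>1 / e ^ 2\<close>; the growth of \<open>m\<close>, in the form \<open>A2\<close>,
            makes it small against \<open>mu\<close>.\<close>
          have "1 / (e n)\<^sup>2 \<le> e n ^ 4 * mu / (e n)\<^sup>2" using A2 by (intro divide_right_mono) auto
          also have "\<dots> = e n ^ 4 / (e n)\<^sup>2 * mu" by simp
          also have "e n ^ 4 / (e n)\<^sup>2 = (e n)\<^sup>2" using en0 power_diff[of "e n" 2 4] by simp
          also have "(e n)\<^sup>2 * mu \<le> e n * mu" using e1 en0 mu1 power_decreasing[of 1 2 "e n"] by (intro mult_right_mono) auto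
          finally have "cy * (1 / (e n)\<^sup>2) \<le> cy * (e n * mu)" by (rule mult_left_mono[OF _ cy])
          then have 2: "\<bar>real n * ip (m n) (y n \<omega>) ?Pw\<bar> \<le> cy * (e n * mu)" using yb(2) by simp
          have "\<bar>real n * ip (m n) (\<lambda>i. r i - y n \<omega> i) ?Pw\<bar> \<le> 1 / lam * (e n * mu) + cy * (e n * mu)"
            unfolding ip_diff_left right_diff_distrib by (rule order_trans[OF abs_triangle_ineq4 add_mono[OF 1 2]])
          also have "\<dots> \<le> c * e n * mu"
            using en0 mu1 by (simp add: c_def distrib_right)
          finally show ?thesis unfolding diff .
        qed
        have L: "Lam + 1 \<le> L\<^sup>2" "0 \<le> L" using Lam by (simp_all add: L_def)
        have kap: "\<bar>(\<Sum>j=1..n. ip (m n) u (f n (Z j \<omega>)) * ip (m n) u' (f n (Z j \<omega>))) / real n - ip (m n) u (mapp (m n) (W n) u')\<bar>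
          \<le> mu\<^sup>2 / (h\<^sup>2 * e n) * nrm (m n) u * nrm (m n) u'" for u u'
          by (rule gb(3)) (use nb in \<open>simp add: bad_def\<close>)
        have s: "(\<Sum>j=1..n. (nrm (m n) (\<lambda>i. v n j \<omega> i - f n (Z j \<omega>) i))\<^sup>2) \<le> real n * (e n ^ 4 / mu)\<^sup>2"
          by (rule gb(4)) (use nb in \<open>simp add: bad_def\<close>)
        have b: "(\<Sum>j=1..n. nrm (m n) (f n (Z j \<omega>)) ^ 4) \<le> real n * (mu / e n) ^ 4"
          by (rule gb(2)) (use nb in \<open>simp add: bad_def\<close>)
        have xm: "xm n \<omega> i = (\<Sum>j=1..n. f n (Z j \<omega>) i + (v n j \<omega> i - f n (Z j \<omega>) i)) / real n" for i
          by (simp add: xm_def)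
        have wm: "wm n \<omega> i = (\<Sum>j=1..n. f n (Z j \<omega>) i) / real n" for i by (simp add: wm_def)
        have Ws: "W n i k = W n k i" if "i < m n" "k < m n" for i k by (rule W_sym[OF that])
        define x where "x = (\<lambda>j i. f n (Z j \<omega>) i + (v n j \<omega> i - f n (Z j \<omega>) i))"
        have xv: "x = (\<lambda>j. v n j \<omega>)" by (simp add: x_def)
        note prems = n(1) lam L c0 h4 h0 mu1(1) en0 e1 A1 A2 s b wmb rb cross C1_def C2_def
          less_imp_le[OF elim(2)] less_imp_le[OF elim(3)]
        note app = el_quadratic_approximation[where w = "\<lambda>j. f n (Z j \<omega>)" and dl = "\<lambda>j i. v n j \<omega> i - f n (Z j \<omega>) i"
            and d = "m n" and W = "W n" and P = "P n" and wm = "wm n \<omega>" and xm = "xm n \<omega>" and n = n and lam = lam and Lam = Lam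
            and L = L and c = c and h = h and mu = mu and e = "e n" and ?C1.0 = C1 and ?C2.0 = C2]
        have X1: "0 < elr (m n) n x"
          unfolding x_def
          by (rule app(1)) (fact prems | rule kap wm xm W_ge[OF n(1)] W_le[OF n(1)] Ws P_spec[OF n(1)]; assumption?)+
        have X2: "\<bar>- 2 * ln (elr (m n) n x) - real n * ip (m n) (wm n \<omega>) (mapp (m n) (P n) (wm n \<omega>))\<bar> \<le> K * e n * mu"
          unfolding x_def K_def
          by (rule app(2)) (fact prems | rule kap wm xm W_ge[OF n(1)] W_le[OF n(1)] Ws P_spec[OF n(1)]; assumption?)+
        show "0 < elr (m n) n (\<lambda>j. v n j \<omega>) \<and>
          \<bar>- 2 * ln (elr (m n) n (\<lambda>j. v n j \<omega>)) - real n * ip (m n) (wm n \<omega>) (mapp (m n) (P n) (wm n \<omega>))\<bar> \<le> K * e n * sqrt (real (m n))"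
          using X1 X2 unfolding xv mu_def by (rule conjI)
      qed
    qed
  qed
qed

end

section \<open>Corrections by square integrable functions\<close>

lemma nrm_scale: "nrm d (\<lambda>i. c * u i) = \<bar>c\<bar> * nrm d u"
proof -
  have "c * (c * ip d u u) = c\<^sup>2 * ip d u u" by (simp add: power2_eq_square)
  then show ?thesis unfolding nrm_def ip_scale_left ip_scale_right by (simp only: real_sqrt_mult real_sqrt_abs)
qed

context el_asymptotics
begin

context
  fixes q :: nat and g :: "nat \<Rightarrow> 'z \<Rightarrow> real"
  assumes g_meas: "\<And>l. l < q \<Longrightarrow> g l \<in> borel_measurable Q"
    and g_sq: "\<And>l. l < q \<Longrightarrow> integrable Q (\<lambda>z. (g l z)\<^sup>2)" "\<And>l. l < q \<Longrightarrow> (\<integral>z. (g l z)\<^sup>2 \<partial>Q) = 1"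
    and g_mean: "\<And>l. l < q \<Longrightarrow> (\<integral>z. g l z \<partial>Q) = 0"
begin

text \<open>\<open>g l\<close> plays the role of the coordinate \<open>l\<close> of
  \<open>\<psi>\<close>; this is then column \<open>l\<close> of the matrix \<open>A n\<close> of
  the statement, and \<open>corr\<close> is the mean of \<open>A n\<close> applied to
  \<open>\<psi>\<close> at the observations.\<close>

definition coef :: "nat \<Rightarrow> nat \<Rightarrow> nat \<Rightarrow> real" where
  "coef n l i = (\<integral>z. f n z i * g l z \<partial>Q)"

definition corr :: "nat \<Rightarrow> 'a \<Rightarrow> nat \<Rightarrow> real" where
  "corr n \<omega> i = (\<Sum>l<q. coef n l i * (\<Sum>j=1..n. g l (Z j \<omega>))) / real n"

lemma fg_integrable:
  assumes "1 \<le> n" "i < m n" "l < q" shows "integrable Q (\<lambda>z. f n z i * g l z)"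
proof (rule Bochner_Integration.integrable_bound[of _ "\<lambda>z. (f n z i)\<^sup>2 + (g l z)\<^sup>2"])
  show "integrable Q (\<lambda>z. (f n z i)\<^sup>2 + (g l z)\<^sup>2)" using f_integrable[OF assms(1,2)] g_sq assms by simp
  show "(\<lambda>z. f n z i * g l z) \<in> borel_measurable Q" using f_meas g_meas assms by simp
  have "\<bar>a * b\<bar> \<le> a\<^sup>2 + b\<^sup>2" for a b :: real
  proof -
    have "2 * \<bar>a\<bar> * \<bar>b\<bar> \<le> a\<^sup>2 + b\<^sup>2" using sum_squares_bound[of "\<bar>a\<bar>" "\<bar>b\<bar>"] by simp
    moreover have "0 \<le> \<bar>a\<bar> * \<bar>b\<bar>" by simp
    ultimately show ?thesis unfolding abs_mult by linarith
  qed
  then show "AE z in Q. norm (f n z i * g l z) \<le> norm ((f n z i)\<^sup>2 + (g l z)\<^sup>2)"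
    by (intro AE_I2) (simp add: order_trans[OF _ abs_ge_self])
qed

lemma ip_f:
  assumes n: "1 \<le> n"
  shows "(\<lambda>z. ip (m n) u (f n z)) \<in> borel_measurable Q"
    and "integrable Q (\<lambda>z. (ip (m n) u (f n z))\<^sup>2)"
    and "(\<integral>z. ip (m n) u (f n z) \<partial>Q) = 0"
    and "(\<integral>z. (ip (m n) u (f n z))\<^sup>2 \<partial>Q) = ip (m n) u (mapp (m n) (W n) u)"
proof -
  show meas: "(\<lambda>z. ip (m n) u (f n z)) \<in> borel_measurable Q"
    unfolding ip_def using f_meas[OF n] by (intro borel_measurable_sum borel_measurable_times) auto
  show "integrable Q (\<lambda>z. (ip (m n) u (f n z))\<^sup>2)"
  proof (rule Bochner_Integration.integrable_bound[of _ "\<lambda>z. (nrm (m n) u)\<^sup>2 * (nrm (m n) (f n z))\<^sup>2"])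
    show "integrable Q (\<lambda>z. (nrm (m n) u)\<^sup>2 * (nrm (m n) (f n z))\<^sup>2)" using f_sq[OF n] by simp
    have "(ip (m n) u (f n z))\<^sup>2 \<le> (nrm (m n) u)\<^sup>2 * (nrm (m n) (f n z))\<^sup>2" for z
      using power_mono[OF ip_Cauchy_Schwarz[of "m n" u "f n z"] abs_ge_zero, of 2] by (simp add: power_mult_distrib)
    then show "AE z in Q. norm ((ip (m n) u (f n z))\<^sup>2) \<le> norm ((nrm (m n) u)\<^sup>2 * (nrm (m n) (f n z))\<^sup>2)" by simp
  qed (use meas in simp)
  have int: "integrable Q (\<lambda>z. u i * f n z i)" if "i < m n" for i using f_integrable[OF n that] by simp
  have "(\<integral>z. ip (m n) u (f n z) \<partial>Q) = (\<Sum>i<m n. \<integral>z. u i * f n z i \<partial>Q)"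
    unfolding ip_def by (rule Bochner_Integration.integral_sum) (use int in auto)
  then show "(\<integral>z. ip (m n) u (f n z) \<partial>Q) = 0" by (simp add: f_mean[OF n])
  have int2: "integrable Q (\<lambda>z. u i * u k * (f n z i * f n z k))" if "i < m n" "k < m n" for i k
  proof -
    have "integrable Q (\<lambda>z. f n z i * f n z k)"
    proof (rule Bochner_Integration.integrable_bound[OF f_sq[OF n]])
      show "(\<lambda>z. f n z i * f n z k) \<in> borel_measurable Q" using f_meas[OF n] that by simp
      show "AE z in Q. norm (f n z i * f n z k) \<le> norm ((nrm (m n) (f n z))\<^sup>2)"
        using mult_mono[OF abs_le_nrm[OF that(1)] abs_le_nrm[OF that(2)]]
        by (simp add: abs_mult power2_eq_square)
    qed
    then show ?thesis by simp
  qed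
  have "(\<integral>z. (ip (m n) u (f n z))\<^sup>2 \<partial>Q) = (\<integral>z. (\<Sum>i<m n. \<Sum>k<m n. u i * u k * (f n z i * f n z k)) \<partial>Q)"
    unfolding ip_def power2_eq_square sum_product by (simp only: mult_ac)
  also have "\<dots> = (\<Sum>i<m n. \<integral>z. (\<Sum>k<m n. u i * u k * (f n z i * f n z k)) \<partial>Q)"
    by (intro Bochner_Integration.integral_sum Bochner_Integration.integrable_sum int2) auto
  also have "\<dots> = (\<Sum>i<m n. \<Sum>k<m n. \<integral>z. u i * u k * (f n z i * f n z k) \<partial>Q)"
    by (intro sum.cong refl Bochner_Integration.integral_sum int2) auto
  also have "\<dots> = (\<Sum>i<m n. \<Sum>k<m n. u i * (W n i k * u k))"
    by (intro sum.cong refl) (simp add: W_def)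
  also have "\<dots> = ip (m n) u (mapp (m n) (W n) u)"
    unfolding ip_def mapp_def sum_distrib_left ..
  finally show "(\<integral>z. (ip (m n) u (f n z))\<^sup>2 \<partial>Q) = ip (m n) u (mapp (m n) (W n) u)" .
qed

lemma ip_f_g:
  assumes n: "1 \<le> n" and l: "l < q"
  shows "integrable Q (\<lambda>z. ip (m n) u (f n z) * g l z)" "(\<integral>z. ip (m n) u (f n z) * g l z \<partial>Q) = ip (m n) u (coef n l)"
proof -
  have eq: "ip (m n) u (f n z) * g l z = (\<Sum>i<m n. u i * (f n z i * g l z))" for z
    by (simp add: ip_def sum_distrib_right mult.assoc)
  have int: "integrable Q (\<lambda>z. u i * (f n z i * g l z))" if "i < m n" for i using fg_integrable[OF n that l] by simp
  show "integrable Q (\<lambda>z. ip (m n) u (f n z) * g l z)"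
    unfolding eq by (rule Bochner_Integration.integrable_sum) (use int in auto)
  show "(\<integral>z. ip (m n) u (f n z) * g l z \<partial>Q) = ip (m n) u (coef n l)"
    unfolding eq by (subst Bochner_Integration.integral_sum) (use int in \<open>auto simp: ip_def coef_def\<close>)
qed

text \<open>The second moment of \<open>g l\<close> minus a multiple of a linear function of
  \<open>f\<close> is nonnegative. Both the multiple \<open>s\<close> and the direction
  \<open>u\<close> are left free, for two different choices.\<close>

lemma bessel:
  assumes n: "1 \<le> n" and l: "l < q"
  shows "0 \<le> 1 - 2 * s * ip (m n) u (coef n l) + s\<^sup>2 * ip (m n) u (mapp (m n) (W n) u)"
proof -
  have "0 \<le> (\<integral>z. (g l z - s * ip (m n) u (f n z))\<^sup>2 \<partial>Q)" by (rule Bochner_Integration.integral_nonneg) simp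
  also have "\<dots> = (\<integral>z. (g l z)\<^sup>2 - 2 * s * (ip (m n) u (f n z) * g l z) + s\<^sup>2 * (ip (m n) u (f n z))\<^sup>2 \<partial>Q)"
    by (intro Bochner_Integration.integral_cong refl) (simp add: power2_diff power_mult_distrib mult_ac)
  also have "\<dots> = 1 - 2 * s * ip (m n) u (coef n l) + s\<^sup>2 * ip (m n) u (mapp (m n) (W n) u)"
    using g_sq[OF l] ip_f_g[OF n l, of u] ip_f[OF n, of u] by simp
  finally show ?thesis .
qed

text \<open>Bessel's inequality with \<open>s = 1 / Lam\<close> in the direction of the coefficient
  vector itself.\<close>

lemma nrm_coef: assumes n: "1 \<le> n" and l: "l < q" shows "nrm (m n) (coef n l) \<le> sqrt Lam"
proof -
  let ?a = "(nrm (m n) (coef n l))\<^sup>2"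
  have "(1 / Lam)\<^sup>2 * ip (m n) (coef n l) (mapp (m n) (W n) (coef n l)) \<le> (1 / Lam)\<^sup>2 * (Lam * ?a)"
    by (intro mult_left_mono W_le n) simp
  also have "\<dots> = ?a / Lam" using Lam by (simp add: power2_eq_square)
  finally have "0 \<le> 1 - 2 * (1 / Lam) * ?a + ?a / Lam"
    using bessel[OF n l, of "1 / Lam" "coef n l"] unfolding nrm_sq by linarith
  then have "?a \<le> Lam" using Lam by (simp add: pos_divide_le_eq)
  then show ?thesis by (rule real_le_rsqrt)
qed

text \<open>With \<open>s = 1\<close> and the direction \<open>P a\<close>, where \<open>a\<close>
  is the coefficient vector, the last two terms of Bessel's inequality combine to minus the form of
  \<open>P\<close> at \<open>a\<close>. The whitened coefficients thus have norm at most 1, whatever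
  the dimension.\<close>

lemma coef_P: assumes n: "1 \<le> n" and l: "l < q"
  shows "ip (m n) (mapp (m n) (P n) (coef n l)) (mapp (m n) (W n) (mapp (m n) (P n) (coef n l))) \<le> 1"
proof -
  let ?u = "mapp (m n) (P n) (coef n l)"
  have "ip (m n) ?u (mapp (m n) (W n) ?u) = ip (m n) ?u (coef n l)"
    by (rule ip_cong) (auto intro: mapp_inverse P_spec[OF n])
  then show ?thesis using bessel[OF n l, of 1 ?u] by simp
qed

definition bad_g :: "real \<Rightarrow> nat \<Rightarrow> 'a set" where
  "bad_g e n = {\<omega> \<in> space M. real n * (1 / e\<^sup>2) < (\<Sum>l<q. (\<Sum>j=1..n. g l (Z j \<omega>))\<^sup>2)}"

text \<open>The scalar sums that arise when \<open>wm\<close> is paired with column \<open>l\<close>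
  through \<open>P n\<close>. By \<open>coef_P\<close> each has variance at most \<open>n\<close>,
  free of \<open>m\<close>.\<close>

definition bad_fg :: "real \<Rightarrow> nat \<Rightarrow> 'a set" where
  "bad_fg e n = {\<omega> \<in> space M. real n * (1 / e\<^sup>2) < (\<Sum>l<q. (\<Sum>j=1..n. ip (m n) (mapp (m n) (P n) (coef n l)) (f n (Z j \<omega>)))\<^sup>2)}"

lemma bad_corr:
  assumes e: "0 < e" and n: "1 \<le> n"
  shows "bad_g e n \<union> bad_fg e n \<in> sets M" "measure M (bad_g e n \<union> bad_fg e n) \<le> (2 * real q) * e\<^sup>2"
proof -
  have K: "0 < 1 / e\<^sup>2" using e by simp
  have c1: "(\<Sum>l<q. \<integral>z. (g l z)\<^sup>2 \<partial>Q) \<le> real q" using g_sq by simp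
  note A = prob_sum_squares_greater[of "{..<q}" g, OF _ _ _ _ c1 n K]
  have A1: "bad_g e n \<in> sets M" unfolding bad_g_def by (rule A(1)) (use g_meas g_sq g_mean in auto)
  have A2: "measure M (bad_g e n) \<le> real q / (1 / e\<^sup>2)"
    unfolding bad_g_def by (rule A(2)) (use g_meas g_sq g_mean in auto)
  have c2: "(\<Sum>l<q. \<integral>z. (ip (m n) (mapp (m n) (P n) (coef n l)) (f n z))\<^sup>2 \<partial>Q) \<le> real q"
    using sum_bounded_above[of "{..<q}" "\<lambda>l. \<integral>z. (ip (m n) (mapp (m n) (P n) (coef n l)) (f n z))\<^sup>2 \<partial>Q" 1] coef_P[OF n]
    by (simp add: ip_f(4)[OF n])
  note B = prob_sum_squares_greater[of "{..<q}" "\<lambda>l z. ip (m n) (mapp (m n) (P n) (coef n l)) (f n z)", OF _ _ _ _ c2 n K]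
  have B1: "bad_fg e n \<in> sets M" unfolding bad_fg_def by (rule B(1)) (use ip_f[OF n] in auto)
  have B2: "measure M (bad_fg e n) \<le> real q / (1 / e\<^sup>2)"
    unfolding bad_fg_def by (rule B(2)) (use ip_f[OF n] in auto)
  show "bad_g e n \<union> bad_fg e n \<in> sets M" using A1 B1 by auto
  show "measure M (bad_g e n \<union> bad_fg e n) \<le> (2 * real q) * e\<^sup>2"
    using measure_Un_le[OF A1 B1] A2 B2 by simp
qed

lemma sum_coord_le:
  assumes "(\<Sum>l<q. (a l)\<^sup>2) \<le> real n * (1 / e\<^sup>2)" "l < q" "0 < e"
  shows "\<bar>a l\<bar> \<le> sqrt (real n) / e"
proof -
  have "(a l)\<^sup>2 \<le> (\<Sum>l<q. (a l)\<^sup>2)" by (rule member_le_sum) (use assms in auto)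
  also have "\<dots> \<le> (sqrt (real n) / e)\<^sup>2" using assms(1) by (simp add: power_divide)
  finally have "\<bar>a l\<bar>\<^sup>2 \<le> (sqrt (real n) / e)\<^sup>2" by simp
  then show ?thesis by (rule power2_le_imp_le) (use assms in simp)
qed

text \<open>The cross term equals the sum over \<open>l\<close> of \<open>G l * H l / n\<close>.
  Both factors are of order \<open>sqrt n\<close> outside the exceptional events, so the sum is
  bounded; the dimension never enters.\<close>

lemma corr_bounds:
  assumes e: "0 < e" and n: "1 \<le> n" and w: "\<omega> \<in> space M - (bad_g e n \<union> bad_fg e n)"
  shows "nrm (m n) (corr n \<omega>) \<le> (real q * (sqrt Lam + 1)) / (sqrt (real n) * e)"
    and "\<bar>real n * ip (m n) (corr n \<omega>) (mapp (m n) (P n) (wm n \<omega>))\<bar> \<le> (real q * (sqrt Lam + 1)) / e\<^sup>2"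
proof -
  define G where "G = (\<lambda>l. \<Sum>j=1..n. g l (Z j \<omega>))"
  define H where "H = (\<lambda>l. \<Sum>j=1..n. ip (m n) (mapp (m n) (P n) (coef n l)) (f n (Z j \<omega>)))"
  have G: "\<bar>G l\<bar> \<le> sqrt (real n) / e" if "l < q" for l
    by (rule sum_coord_le[OF _ that e]) (use w in \<open>auto simp: bad_g_def G_def\<close>)
  have H: "\<bar>H l\<bar> \<le> sqrt (real n) / e" if "l < q" for l
    by (rule sum_coord_le[OF _ that e]) (use w in \<open>auto simp: bad_fg_def H_def\<close>)
  have n0: "0 < real n" using n by simp
  have cs: "corr n \<omega> = (\<lambda>i. \<Sum>l<q. (G l / real n) * coef n l i)"
    unfolding corr_def sum_divide_distrib[of _ "{..<q}"] by (intro ext sum.cong refl) (simp add: G_def)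
  have "nrm (m n) (corr n \<omega>) \<le> (\<Sum>l<q. nrm (m n) (\<lambda>i. (G l / real n) * coef n l i))"
    unfolding cs by (rule nrm_sum)
  also have "\<dots> = (\<Sum>l<q. \<bar>G l / real n\<bar> * nrm (m n) (coef n l))"
    by (simp only: nrm_scale)
  also have "\<dots> \<le> (\<Sum>l<q. (sqrt (real n) / e) / real n * sqrt Lam)"
    unfolding abs_divide abs_of_nat
  proof (rule sum_mono)
    fix l assume "l \<in> {..<q}"
    then have l: "l < q" by simp
    show "\<bar>G l\<bar> / real n * nrm (m n) (coef n l) \<le> (sqrt (real n) / e) / real n * sqrt Lam"
      by (rule mult_mono[OF divide_right_mono[OF G[OF l]] nrm_coef[OF n l]]) (use e in auto)
  qed
  also have "\<dots> = real q * sqrt Lam / (sqrt (real n) * e)"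
  proof -
    have "(r / e) / (r * r) * a = a / (r * e)" if "r \<noteq> 0" for r a using that by simp
    from this[of "sqrt (real n)" "sqrt Lam"] show ?thesis using n0 by simp
  qed
  also have "\<dots> \<le> (real q * (sqrt Lam + 1)) / (sqrt (real n) * e)"
    using e n0 by (intro divide_right_mono mult_left_mono) auto
  finally show "nrm (m n) (corr n \<omega>) \<le> (real q * (sqrt Lam + 1)) / (sqrt (real n) * e)" .
  have HP: "ip (m n) (coef n l) (mapp (m n) (P n) (wm n \<omega>)) = H l / real n" for l
  proof -
    have "ip (m n) (coef n l) (mapp (m n) (P n) (wm n \<omega>)) = ip (m n) (wm n \<omega>) (mapp (m n) (P n) (coef n l))"
      by (rule ip_mapp_sym[OF P_spec(1)[OF n]])
    also have "\<dots> = ip (m n) (mapp (m n) (P n) (coef n l)) (\<lambda>i. (1 / real n) * (\<Sum>j=1..n. f n (Z j \<omega>) i))"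
    proof -
      have "wm n \<omega> = (\<lambda>i. (1 / real n) * (\<Sum>j=1..n. f n (Z j \<omega>) i))" by (simp add: wm_def fun_eq_iff)
      then show ?thesis by (subst ip_commute) (simp only:)
    qed
    also have "\<dots> = H l / real n"
      unfolding ip_scale_right H_def ip_sum_right by simp
    finally show ?thesis .
  qed
  have "real n * ip (m n) (corr n \<omega>) (mapp (m n) (P n) (wm n \<omega>)) = (\<Sum>l<q. G l * H l / real n)"
  proof -
    let ?v = "mapp (m n) (P n) (wm n \<omega>)"
    have "ip (m n) (corr n \<omega>) ?v = (\<Sum>l<q. (G l / real n) * ip (m n) ?v (coef n l))"
      unfolding cs by (subst ip_commute) (simp only: ip_sum_right ip_scale_right)
    also have "\<dots> = (\<Sum>l<q. (G l / real n) * (H l / real n))"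
    proof -
      have "ip (m n) ?v (coef n l) = H l / real n" for l by (subst ip_commute) (rule HP)
      then show ?thesis by (simp only:)
    qed
    finally show ?thesis using n0 by (simp add: sum_distrib_left)
  qed
  also have "\<bar>\<dots>\<bar> \<le> (\<Sum>l<q. (sqrt (real n) / e) * (sqrt (real n) / e) / real n)"
  proof (rule order_trans[OF sum_abs], rule sum_mono)
    fix l assume "l \<in> {..<q}"
    then have l: "l < q" by simp
    show "\<bar>G l * H l / real n\<bar> \<le> (sqrt (real n) / e) * (sqrt (real n) / e) / real n"
      unfolding abs_divide abs_mult abs_of_nat
      by (rule divide_right_mono[OF mult_mono[OF G[OF l] H[OF l]]]) (use e in auto)
  qed
  also have "\<dots> = real q / e\<^sup>2" using n0 e by (simp add: power2_eq_square)
  also have "\<dots> \<le> (real q * (sqrt Lam + 1)) / e\<^sup>2"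
    using Lam by (intro divide_right_mono) (auto simp: mult_le_cancel_left1)
  finally show "\<bar>real n * ip (m n) (corr n \<omega>) (mapp (m n) (P n) (wm n \<omega>))\<bar> \<le> (real q * (sqrt Lam + 1)) / e\<^sup>2" .
qed

lemma corr_meas: "1 \<le> n \<Longrightarrow> i < m n \<Longrightarrow> (\<lambda>\<omega>. corr n \<omega> i) \<in> borel_measurable M"
  unfolding corr_def
  by (intro borel_measurable_divide borel_measurable_sum borel_measurable_times borel_measurable_const
      measurable_compose[OF Z_meas g_meas]) auto

theorem el_corrected_approx:
  assumes "little_op M (\<lambda>n \<omega>. nrm (m n) (\<lambda>i. xm n \<omega> i - (wm n \<omega> i - corr n \<omega> i))) (\<lambda>n. real n powr (- 1 / 2))"
  shows "\<exists>G b. (\<forall>n. G n \<in> sets M) \<and> (\<lambda>n. measure M (G n)) \<longlonglongrightarrow> 1 \<and> b \<longlonglongrightarrow> (0::real) \<and>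
    (\<forall>\<^sub>F n in sequentially. \<forall>\<omega>\<in>G n. 0 < elr (m n) n (\<lambda>j. v n j \<omega>) \<and>
      \<bar>- 2 * ln (elr (m n) n (\<lambda>j. v n j \<omega>)) - real n * ip (m n) (wm n \<omega>) (mapp (m n) (P n) (wm n \<omega>))\<bar> \<le> b n * sqrt (real (m n)))"
proof (rule el_quadratic_form_approx[where y = corr and B = "\<lambda>e n. bad_g e n \<union> bad_fg e n" and by' = "2 * real q"
      and cy = "real q * (sqrt Lam + 1)", OF _ assms])
  show "0 \<le> real q * (sqrt Lam + 1)" using Lam by simp
qed (fact corr_meas bad_corr corr_bounds)+

end

end

section \<open>Vectors of varying dimension\<close>

lemma scalar_prod_eq_ip: "u \<in> carrier_vec d \<Longrightarrow> v \<in> carrier_vec d \<Longrightarrow> u \<bullet> v = ip d (\<lambda>i. u $ i) (\<lambda>i. v $ i)"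
  by (auto simp: scalar_prod_def ip_def atLeast0LessThan)

lemma vnorm_eq_nrm: "u \<in> carrier_vec d \<Longrightarrow> vnorm u = nrm d (\<lambda>i. u $ i)"
  by (simp add: vnorm_def nrm_def scalar_prod_eq_ip)

lemma vmean_carrier:
  assumes "\<And>j. j \<in> {1..n} \<Longrightarrow> x j \<in> carrier_vec d"
  shows "vmean d n x \<in> carrier_vec d"
proof -
  have "finsum_vec TYPE(real) d x {1..n} \<in> carrier_vec d" by (rule finsum_vec_closed) (use assms in auto)
  then show ?thesis by (simp add: vmean_def)
qed

lemma vmean_index:
  assumes "\<And>j. j \<in> {1..n} \<Longrightarrow> x j \<in> carrier_vec d" "i < d"
  shows "vmean d n x $ i = (\<Sum>j=1..n. x j $ i) / real n"
proof -
  have c: "x \<in> {1..n} \<rightarrow> carrier_vec d" using assms by auto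
  have "finsum_vec TYPE(real) d x {1..n} \<in> carrier_vec d" by (rule finsum_vec_closed[OF c])
  then show ?thesis
    unfolding vmean_def using assms(2) index_finsum_vec[OF _ assms(2) c] by simp
qed

lemma el_ratio_eq_elr:
  assumes x: "\<And>j. j \<in> {1..n} \<Longrightarrow> x j \<in> carrier_vec d" and n: "1 \<le> n"
  shows "el_ratio d n x = elr d n (\<lambda>j i. x j $ i)"
proof -
  have "vmean d n (\<lambda>j. p j \<cdot>\<^sub>v x j) = 0\<^sub>v d \<longleftrightarrow> (\<forall>i<d. (\<Sum>j=1..n. p j * x j $ i) = 0)" for p
  proof -
    have c: "p j \<cdot>\<^sub>v x j \<in> carrier_vec d" if "j \<in> {1..n}" for j using x[OF that] by simp
    have v: "vmean d n (\<lambda>j. p j \<cdot>\<^sub>v x j) \<in> carrier_vec d" by (rule vmean_carrier[OF c])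
    have i: "vmean d n (\<lambda>j. p j \<cdot>\<^sub>v x j) $ i = (\<Sum>j=1..n. p j * x j $ i) / real n" if "i < d" for i
    proof -
      have "vmean d n (\<lambda>j. p j \<cdot>\<^sub>v x j) $ i = (\<Sum>j=1..n. (p j \<cdot>\<^sub>v x j) $ i) / real n"
        by (rule vmean_index[OF c that])
      also have "(\<Sum>j=1..n. (p j \<cdot>\<^sub>v x j) $ i) = (\<Sum>j=1..n. p j * x j $ i)"
      proof (intro sum.cong refl)
        fix j assume "j \<in> {1..n}"
        then have "dim_vec (x j) = d" using x by auto
        then show "(p j \<cdot>\<^sub>v x j) $ i = p j * x j $ i" using that by simp
      qed
      finally show ?thesis .
    qed
    have "vmean d n (\<lambda>j. p j \<cdot>\<^sub>v x j) = 0\<^sub>v d \<longleftrightarrow> (\<forall>i<d. vmean d n (\<lambda>j. p j \<cdot>\<^sub>v x j) $ i = 0)"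
      using v by (auto intro!: eq_vecI)
    also have "\<dots> \<longleftrightarrow> (\<forall>i<d. (\<Sum>j=1..n. p j * x j $ i) = 0)"
      using n by (simp add: i)
    finally show ?thesis .
  qed
  then show ?thesis unfolding el_ratio_def elr_def by simp
qed

lemma little_op_cong:
  assumes "\<And>n \<omega>. 1 \<le> n \<Longrightarrow> \<omega> \<in> space M \<Longrightarrow> X n \<omega> = X' n \<omega>" "little_op M X r"
  shows "little_op M X' r"
  unfolding little_op_def
proof (intro allI impI)
  fix e :: real assume "0 < e"
  then have "(\<lambda>n. measure M {\<omega> \<in> space M. \<bar>X n \<omega>\<bar> > e * r n}) \<longlonglongrightarrow> 0"
    using assms(2) by (simp add: little_op_def)
  then show "(\<lambda>n. measure M {\<omega> \<in> space M. \<bar>X' n \<omega>\<bar> > e * r n}) \<longlonglongrightarrow> 0"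
  proof (rule Lim_transform_eventually)
    show "\<forall>\<^sub>F n in sequentially. measure M {\<omega> \<in> space M. \<bar>X n \<omega>\<bar> > e * r n} = measure M {\<omega> \<in> space M. \<bar>X' n \<omega>\<bar> > e * r n}"
      using eventually_ge_at_top[of 1]
    proof eventually_elim
      case (elim n)
      then have "{\<omega> \<in> space M. \<bar>X n \<omega>\<bar> > e * r n} = {\<omega> \<in> space M. \<bar>X' n \<omega>\<bar> > e * r n}"
        using assms(1) by auto
      then show ?case by simp
    qed
  qed
qed

lemma mapp_scale: "mapp d A (\<lambda>i. c * u i) = (\<lambda>i. c * mapp d A u i)"
  by (simp add: mapp_def sum_distrib_left mult_ac)

text \<open>Scaling to norm 1. A vanishing norm does not make \<open>u\<close> the zero function, as
  coordinates beyond \<open>d\<close> are free; Cauchy-Schwarz settles that case.\<close>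

lemma quadratic_bounds_from_sphere:
  assumes "\<And>u. nrm d u = 1 \<Longrightarrow> a \<le> ip d u (mapp d W u) \<and> ip d u (mapp d W u) \<le> b"
  shows "a * (nrm d u)\<^sup>2 \<le> ip d u (mapp d W u) \<and> ip d u (mapp d W u) \<le> b * (nrm d u)\<^sup>2"
proof (cases "nrm d u = 0")
  case True
  then have "ip d u (mapp d W u) = 0" using ip_Cauchy_Schwarz[of d u "mapp d W u"] by simp
  then show ?thesis using True by simp
next
  case False
  define s where "s = nrm d u"
  define x where "x = (\<lambda>i. (1 / s) * u i)"
  have s: "0 < s" using False nrm_nonneg[of d u] by (simp add: s_def less_le)
  have "nrm d x = 1" unfolding x_def nrm_scale using s by (simp add: s_def)
  then have *: "a \<le> ip d x (mapp d W x) \<and> ip d x (mapp d W x) \<le> b" by (rule assms)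
  have "ip d x (mapp d W x) = ip d u (mapp d W u) / s\<^sup>2"
    unfolding x_def mapp_scale ip_scale_left ip_scale_right by (simp add: power2_eq_square)
  then show ?thesis using * s unfolding s_def[symmetric]
    by (simp add: pos_le_divide_eq pos_divide_le_eq)
qed

text \<open>Real constants are chosen strictly between 0 and the infimum and strictly above the
  supremum, which removes the extended reals.\<close>

lemma regular_seq_bounds:
  assumes reg: "regular_seq m (\<lambda>n. mat (m n) (m n) (\<lambda>(i, k). W n i k))"
  obtains a b where "0 < a" "0 < b"
    "\<And>n u. 1 \<le> n \<Longrightarrow> a * (nrm (m n) u)\<^sup>2 \<le> ip (m n) u (mapp (m n) (W n) u)"
    "\<And>n u. 1 \<le> n \<Longrightarrow> ip (m n) u (mapp (m n) (W n) u) \<le> b * (nrm (m n) u)\<^sup>2"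
proof -
  let ?S = "\<lambda>n. {u \<in> carrier_vec (m n). vnorm u = 1}"
  let ?M = "\<lambda>n. mat (m n) (m n) (\<lambda>(i, k). W n i k)"
  obtain a where a: "0 < ereal a" "ereal a < (INF n\<in>{1..}. INF u\<in>?S n. ereal (u \<bullet> (?M n *\<^sub>v u)))"
    using reg ereal_dense2 unfolding regular_seq_def by blast
  obtain b where b: "(SUP n\<in>{1..}. SUP u\<in>?S n. ereal (u \<bullet> (?M n *\<^sub>v u))) < ereal b"
    using reg ereal_dense2 unfolding regular_seq_def by blast
  \<comment> \<open>The maximum with 1 ensures that the upper constant is positive.\<close>
  have sphere: "a \<le> ip (m n) u (mapp (m n) (W n) u) \<and> ip (m n) u (mapp (m n) (W n) u) \<le> max 1 b"
    if n: "1 \<le> n" and u: "nrm (m n) u = 1" for n u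
  proof -
    define v where "v = vec (m n) u"
    have v: "v \<in> carrier_vec (m n)" by (simp add: v_def)
    have "nrm (m n) (\<lambda>i. v $ i) = nrm (m n) u" unfolding nrm_def by (simp add: v_def ip_def)
    then have vS: "v \<in> ?S n" using v u by (simp add: vnorm_eq_nrm)
    have Mv: "?M n *\<^sub>v v \<in> carrier_vec (m n)" by (rule mult_mat_vec_carrier[OF _ v]) simp
    have q: "v \<bullet> (?M n *\<^sub>v v) = ip (m n) u (mapp (m n) (W n) u)"
      unfolding scalar_prod_eq_ip[OF v Mv]
      by (rule ip_cong) (auto simp: v_def mapp_def scalar_prod_def atLeast0LessThan)
    have "(INF n\<in>{1..}. INF u\<in>?S n. ereal (u \<bullet> (?M n *\<^sub>v u))) \<le> ereal (v \<bullet> (?M n *\<^sub>v v))"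
      by (rule INF_lower2[of n], use n in simp, rule INF_lower[OF vS])
    then have "ereal a \<le> ereal (v \<bullet> (?M n *\<^sub>v v))" using a(2) by (rule less_imp_le[OF less_le_trans, rotated])
    moreover have "ereal (v \<bullet> (?M n *\<^sub>v v)) \<le> (SUP n\<in>{1..}. SUP u\<in>?S n. ereal (u \<bullet> (?M n *\<^sub>v u)))"
      by (rule SUP_upper2[of n], use n in simp, rule SUP_upper[OF vS])
    then have "ereal (v \<bullet> (?M n *\<^sub>v v)) \<le> ereal b" using b by (rule less_imp_le[OF le_less_trans])
    ultimately show ?thesis by (simp add: q)
  qed
  show ?thesis
    by (rule that[of a "max 1 b"]) (use a quadratic_bounds_from_sphere[OF sphere] in auto)
qed

section \<open>Normalisation of the statistic\<close>

context el_asymptotics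
begin

text \<open>Serves both parts, with \<open>c = 0\<close> and \<open>c = q\<close>. Changing
  \<open>m\<close> to \<open>m - c\<close> in centring and scale multiplies the limiting statistic
  by \<open>al\<close>, which tends to 1, and adds a shift of order
  \<open>c / sqrt m\<close>.\<close>

lemma asymp_std_normal_minus2_log:
  fixes R :: "nat \<Rightarrow> 'a \<Rightarrow> real" and c :: real
  assumes R: "\<And>n \<omega>. 1 \<le> n \<Longrightarrow> \<omega> \<in> space M \<Longrightarrow> R n \<omega> = elr (m n) n (\<lambda>j. v n j \<omega>)"
    and G: "\<And>n. G n \<in> sets M" "(\<lambda>n. measure M (G n)) \<longlonglongrightarrow> 1" and b: "b \<longlonglongrightarrow> (0::real)"
    and approx: "\<forall>\<^sub>F n in sequentially. \<forall>\<omega>\<in>G n. 0 < elr (m n) n (\<lambda>j. v n j \<omega>) \<and>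
      \<bar>- 2 * ln (elr (m n) n (\<lambda>j. v n j \<omega>)) - real n * ip (m n) (wm n \<omega>) (mapp (m n) (P n) (wm n \<omega>))\<bar> \<le> b n * sqrt (real (m n))"
    and c: "0 \<le> c"
    and T: "\<And>n \<omega> x. 1 \<le> n \<Longrightarrow> R n \<omega> \<noteq> 0 \<Longrightarrow> c < real (m n) \<Longrightarrow> T n \<omega> = ereal ((- 2 * ln (R n \<omega>) - real (m n) + c) / sqrt (2 * (real (m n) - c)))"
    and T_meas: "\<And>n. 1 \<le> n \<Longrightarrow> T n \<in> borel_measurable M"
  shows "asymp_std_normal M T"
proof -
  define al where "al = (\<lambda>n. sqrt (2 * real (m n)) / sqrt (2 * (real (m n) - c)))"
  define be where "be = (\<lambda>n. (b n * sqrt (real (m n)) + c) / sqrt (2 * (real (m n) - c)))"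
  have mreal: "filterlim (\<lambda>n. real (m n)) at_top sequentially"
    by (rule filterlim_compose[OF filterlim_real_sequentially m_lim])
  have im: "(\<lambda>n. 1 / real (m n)) \<longlonglongrightarrow> 0"
    by (rule tendsto_divide_0[OF tendsto_const]) (rule filterlim_at_top_imp_at_infinity[OF mreal])
  have ism: "(\<lambda>n. 1 / sqrt (real (m n))) \<longlonglongrightarrow> 0"
    by (rule tendsto_divide_0[OF tendsto_const]) (rule filterlim_at_top_imp_at_infinity[OF filterlim_compose[OF sqrt_at_top mreal]])
  have evm: "\<forall>\<^sub>F n in sequentially. c < real (m n)"
    using mreal by (simp add: filterlim_at_top_dense)
  have al: "al \<longlonglongrightarrow> 1"
  proof -
    have "(\<lambda>n. 1 / sqrt (1 - c * (1 / real (m n)))) \<longlonglongrightarrow> 1 / sqrt (1 - c * 0)"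
      by (intro tendsto_intros im) simp
    then have "(\<lambda>n. 1 / sqrt (1 - c * (1 / real (m n)))) \<longlonglongrightarrow> 1" by simp
    then show ?thesis
    proof (rule Lim_transform_eventually)
      show "\<forall>\<^sub>F n in sequentially. 1 / sqrt (1 - c * (1 / real (m n))) = al n" using evm
      proof eventually_elim
        case (elim n)
        then have m0: "0 < real (m n)" using c by linarith
        have "1 - c * (1 / real (m n)) = (2 * (real (m n) - c)) / (2 * real (m n))" using m0 by (simp add: diff_divide_distrib)
        then show ?case unfolding al_def by (simp only: real_sqrt_divide) simp
      qed
    qed
  qed
  have be: "be \<longlonglongrightarrow> 0"
  proof -
    have "(\<lambda>n. (b n / sqrt 2 + c * (1 / sqrt (real (m n))) / sqrt 2) * al n) \<longlonglongrightarrow> (0 / sqrt 2 + c * 0 / sqrt 2) * 1"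
      by (intro tendsto_intros b ism al) simp_all
    then have "(\<lambda>n. (b n / sqrt 2 + c * (1 / sqrt (real (m n))) / sqrt 2) * al n) \<longlonglongrightarrow> 0" by simp
    then show ?thesis
    proof (rule Lim_transform_eventually)
      show "\<forall>\<^sub>F n in sequentially. (b n / sqrt 2 + c * (1 / sqrt (real (m n))) / sqrt 2) * al n = be n" using evm
      proof eventually_elim
        case (elim n)
        then have m0: "sqrt (real (m n)) \<noteq> 0" using c by simp
        have "(x / r + c * (1 / y) / r) * (r * y / d) = (x * y + c) / d" if "r \<noteq> 0" "y \<noteq> 0" for x r y d :: real
        proof -
          have "(x / r + c * (1 / y) / r) * (r * y) = x * y + c" using that by (simp add: distrib_right)
          then show ?thesis by (simp only: times_divide_eq_right)
        qed
        from this[of "sqrt 2" "sqrt (real (m n))" "b n" "sqrt (2 * (real (m n) - c))"] show ?case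
          using m0 unfolding al_def be_def real_sqrt_mult[of 2 "real (m n)"] by simp
      qed
    qed
  qed
  have ev: "\<forall>\<^sub>F n in sequentially. \<forall>\<omega>\<in>G n. \<exists>t. T n \<omega> = ereal t \<and> \<bar>t - al n * Y n \<omega>\<bar> \<le> be n"
    using approx evm eventually_ge_at_top[of 1]
  proof eventually_elim
    case (elim n)
    show ?case
    proof
      fix \<omega> assume w: "\<omega> \<in> G n"
      then have ws: "\<omega> \<in> space M" using sets.sets_into_space[OF G(1)] by blast
      define X where "X = - 2 * ln (R n \<omega>)"
      define q where "q = real n * ip (m n) (wm n \<omega>) (mapp (m n) (P n) (wm n \<omega>))"
      define D where "D = sqrt (2 * (real (m n) - c))"
      have D: "0 < D" using elim by (simp add: D_def)
      have Rp: "0 < R n \<omega>" and Xq: "\<bar>X - q\<bar> \<le> b n * sqrt (real (m n))"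
        using elim w R[OF elim(3) ws] by (auto simp: X_def q_def)
      have m0: "sqrt (2 * real (m n)) \<noteq> 0" using elim c by simp
      have alY: "al n * Y n \<omega> = (q - real (m n)) / D"
        using m0 by (simp add: al_def Y_def q_def D_def)
      have "(X - real (m n) + c) / D - (q - real (m n)) / D = ((X - q) + c) / D"
        by (simp add: diff_divide_distrib add_divide_distrib)
      also have "\<bar>\<dots>\<bar> \<le> be n"
        unfolding be_def D_def[symmetric] abs_divide abs_of_pos[OF D]
        using Xq c D by (intro divide_right_mono) linarith+
      finally have "\<bar>(X - real (m n) + c) / D - al n * Y n \<omega>\<bar> \<le> be n" unfolding alY .
      moreover have "T n \<omega> = ereal ((X - real (m n) + c) / D)"
        unfolding X_def D_def by (rule T) (use elim Rp in auto)
      ultimately show "\<exists>t. T n \<omega> = ereal t \<and> \<bar>t - al n * Y n \<omega>\<bar> \<le> be n" by blast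
    qed
  qed
  show ?thesis
    by (rule asymp_std_normal_transfer[OF M.prob_space_axioms T_meas Y_meas Y_conv al be G ev])
qed

end

section \<open>Translation to the vectors of the statement and conclusion of both parts\<close>

lemma minus2_log_measurable [measurable]: "minus2_log \<in> borel_measurable borel"
  unfolding minus2_log_def[abs_def] by measurable

theorem corollary7p6:
  fixes M :: "'a measure" and Q :: "'z measure" and Z :: "nat \<Rightarrow> 'a \<Rightarrow> 'z"
    and m :: "nat \<Rightarrow> nat" and q :: nat
    and w :: "nat \<Rightarrow> 'z \<Rightarrow> real vec"
    and w_hat :: "nat \<Rightarrow> (nat \<Rightarrow> 'z) \<Rightarrow> 'z \<Rightarrow> real vec"
  defines "W \<equiv> \<lambda>n. mat_integral (m n) (m n) Q (\<lambda>z. outer_prod (w n z) (w n z))"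
    and "V \<equiv> \<lambda>n j \<omega>. w_hat n (sample Z n \<omega>) (Z j \<omega>)"
    and "R \<equiv> \<lambda>n \<omega>. el_ratio (m n) n (\<lambda>j. w_hat n (sample Z n \<omega>) (Z j \<omega>))"
  assumes "prob_space M" and "prob_space Q"
    and Z_indep: "prob_space.indep_vars M (\<lambda>_. Q) Z {1..}"
    and Z_distr: "\<And>j. j \<ge> 1 \<Longrightarrow> distr M Q (Z j) = Q"
    and m_pos: "\<And>n. n \<ge> 1 \<Longrightarrow> m n \<ge> 1"
    and m_lim: "filterlim m at_top sequentially"
    and q_pos: "q \<ge> 1"
    and w_meas: "\<And>n. n \<ge> 1 \<Longrightarrow> random_vec (m n) Q (w n)"
    and w_sq_int: "\<And>n. n \<ge> 1 \<Longrightarrow> integrable Q (\<lambda>z. (vnorm (w n z))\<^sup>2)"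
    and w_centered: "\<And>n. n \<ge> 1 \<Longrightarrow> vec_integral (m n) Q (w n) = 0\<^sub>v (m n)"
    and w_hat: "\<And>n. n \<ge> 1 \<Longrightarrow> is_estimator M Q Z n (m n) (w_hat n)"
    and W_regular: "regular_seq m W"
    and w_hat_close:
      "little_op M (\<lambda>n \<omega>. (1 / real n) * (\<Sum>j=1..n. (vnorm (V n j \<omega> - w n (Z j \<omega>)))\<^sup>2))
         (\<lambda>n. 1 / real (m n))"
    and w_fourth_int: "\<forall>\<^sub>F n in sequentially. integrable Q (\<lambda>z. vnorm (w n z) ^ 4)"
    and w_fourth: "(\<lambda>n. \<integral>z. vnorm (w n z) ^ 4 \<partial>Q) \<in> O(\<lambda>n. real (m n) ^ 2)"
    and m_rate: "(\<lambda>n. real (m n) ^ 4) \<in> o(\<lambda>n. real n)"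
  shows
    "(little_op M
        (\<lambda>n \<omega>. vnorm (vmean (m n) n (\<lambda>j. V n j \<omega>) - vmean (m n) n (\<lambda>j. w n (Z j \<omega>))))
        (\<lambda>n. real n powr (- 1 / 2))
      \<longrightarrow> asymp_std_normal M
            (\<lambda>n \<omega>. (minus2_log (R n \<omega>) - ereal (real (m n))) / ereal (sqrt (2 * real (m n)))))
     \<and>
     ((\<exists>\<psi> :: 'z \<Rightarrow> real vec.
         random_vec q Q \<psi> \<and>
         vec_integral q Q \<psi> = 0\<^sub>v q \<and>
         mat_integral q q Q (\<lambda>z. outer_prod (\<psi> z) (\<psi> z)) = 1\<^sub>m q \<and>
         (let A = (\<lambda>n. mat_integral (m n) q Q (\<lambda>z. outer_prod (w n z) (\<psi> z))) in
            little_op M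
              (\<lambda>n \<omega>. vnorm (vmean (m n) n (\<lambda>j. V n j \<omega>)
                              - vmean (m n) n (\<lambda>j. w n (Z j \<omega>) - A n *\<^sub>v \<psi> (Z j \<omega>))))
              (\<lambda>n. real n powr (- 1 / 2)) \<and>
            (\<lambda>n. mat_trace (transpose_mat (A n) * mat_inv (W n) * A n)) \<longlonglongrightarrow> real q))
      \<longrightarrow> asymp_std_normal M
            (\<lambda>n \<omega>. (minus2_log (R n \<omega>) - ereal (real (m n)) + ereal (real q))
                     / ereal (sqrt (2 * (real (m n) - real q)))))"
proof -
  interpret M: prob_space M by fact
  interpret Q: prob_space Q by fact
  interpret S: iid_sample M Q Z by unfold_locales (fact Z_indep, rule Z_distr)
  define f where "f = (\<lambda>n z i. w n z $ i)"
  define v where "v = (\<lambda>n j \<omega> i. V n j \<omega> $ i)"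
  define Wf where "Wf = (\<lambda>n i k. \<integral>z. f n z i * f n z k \<partial>Q)"
  have f_app: "f n z i = w n z $ i" for n z i by (simp add: f_def)
  have v_app: "v n j \<omega> i = V n j \<omega> $ i" for n j \<omega> i by (simp add: v_def)
  have w_carr: "w n z \<in> carrier_vec (m n)" if "1 \<le> n" "z \<in> space Q" for n z
    using w_meas[OF that(1)] that(2) by (simp add: random_vec_def)
  have Z_space: "Z j \<omega> \<in> space Q" if "1 \<le> j" "\<omega> \<in> space M" for j \<omega>
    using measurable_space[OF S.Z_meas[OF that(1)] that(2)] .
  have V_carr: "V n j \<omega> \<in> carrier_vec (m n)" if "1 \<le> n" "j \<in> {1..n}" "\<omega> \<in> space M" for n j \<omega>
    using w_hat[OF that(1)] that unfolding is_estimator_def random_vec_def V_def by blast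
  have V_meas: "(\<lambda>\<omega>. v n j \<omega> i) \<in> borel_measurable M" if "1 \<le> n" "j \<in> {1..n}" "i < m n" for n j i
    using w_hat[OF that(1)] that unfolding is_estimator_def random_vec_def v_def V_def by blast
  have nrm_w: "vnorm (w n z) = nrm (m n) (f n z)" if "1 \<le> n" "z \<in> space Q" for n z
    unfolding f_def by (rule vnorm_eq_nrm[OF w_carr[OF that]])
  have wZ: "w n (Z j \<omega>) \<in> carrier_vec (m n)" if "1 \<le> n" "j \<in> {1..n}" "\<omega> \<in> space M" for n j \<omega>
    by (rule w_carr[OF that(1) Z_space]) (use that in auto)
  have W_eq: "W n = mat (m n) (m n) (\<lambda>(i, k). Wf n i k)" if n: "1 \<le> n" for n
  proof -
    have "(\<integral>z. outer_prod (w n z) (w n z) $$ (i, k) \<partial>Q) = Wf n i k" if "i < m n" "k < m n" for i k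
      unfolding Wf_def f_def
    proof (rule Bochner_Integration.integral_cong[OF refl])
      fix z assume "z \<in> space Q"
      then have "dim_vec (w n z) = m n" using w_carr[OF n] by auto
      then show "outer_prod (w n z) (w n z) $$ (i, k) = w n z $ i * w n z $ k"
        using that by (simp add: outer_prod_def)
    qed
    then show ?thesis unfolding W_def mat_integral_def by (intro eq_matI) auto
  qed
  \<comment> \<open>The identification of \<open>W\<close> with \<open>Wf\<close> is available for
    \<open>n \<ge> 1\<close> only, which suffices as the infima and suprema leave out the index
    0.\<close>
  have reg: "regular_seq m (\<lambda>n. mat (m n) (m n) (\<lambda>(i, k). Wf n i k))"
  proof -
    have I: "(INF n\<in>{1..}. INF u\<in>{u \<in> carrier_vec (m n). vnorm u = 1}. ereal (u \<bullet> (W n *\<^sub>v u)))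
        = (INF n\<in>{1..}. INF u\<in>{u \<in> carrier_vec (m n). vnorm u = 1}. ereal (u \<bullet> (mat (m n) (m n) (\<lambda>(i, k). Wf n i k) *\<^sub>v u)))"
      by (rule INF_cong) (simp_all add: W_eq)
    have S: "(SUP n\<in>{1..}. SUP u\<in>{u \<in> carrier_vec (m n). vnorm u = 1}. ereal (u \<bullet> (W n *\<^sub>v u)))
        = (SUP n\<in>{1..}. SUP u\<in>{u \<in> carrier_vec (m n). vnorm u = 1}. ereal (u \<bullet> (mat (m n) (m n) (\<lambda>(i, k). Wf n i k) *\<^sub>v u)))"
      by (rule SUP_cong) (simp_all add: W_eq)
    show ?thesis using W_regular unfolding regular_seq_def I S .
  qed
  obtain lam Lam where lam: "0 < lam" "0 < Lam"
    "\<And>n u. 1 \<le> n \<Longrightarrow> lam * (nrm (m n) u)\<^sup>2 \<le> ip (m n) u (mapp (m n) (Wf n) u)"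
    "\<And>n u. 1 \<le> n \<Longrightarrow> ip (m n) u (mapp (m n) (Wf n) u) \<le> Lam * (nrm (m n) u)\<^sup>2"
    using regular_seq_bounds[OF reg] by metis
  obtain C where C: "0 < C" "\<forall>\<^sub>F n in sequentially. norm (\<integral>z. vnorm (w n z) ^ 4 \<partial>Q) \<le> C * norm (real (m n) ^ 2)"
    using landau_o.bigE[OF w_fourth] by blast
  have int4: "(\<integral>z. vnorm (w n z) ^ 4 \<partial>Q) = (\<integral>z. nrm (m n) (f n z) ^ 4 \<partial>Q)" if "1 \<le> n" for n
    by (rule Bochner_Integration.integral_cong[OF refl]) (simp add: nrm_w[OF that])
  interpret E: el_asymptotics M Q Z m f v lam Lam C Wf
  proof unfold_locales
    show "(\<lambda>n. real (m n) ^ 4 / real n) \<longlonglongrightarrow> 0" by (rule smalloD_tendsto[OF m_rate])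
    show "(\<lambda>z. f n z i) \<in> borel_measurable Q" if "1 \<le> n" "i < m n" for n i
      using w_meas[OF that(1)] that(2) by (simp add: random_vec_def f_app)
    show "integrable Q (\<lambda>z. (nrm (m n) (f n z))\<^sup>2)" if "1 \<le> n" for n
      using w_sq_int[OF that] by (rule Bochner_Integration.integrable_cong[OF refl, THEN iffD1, rotated]) (simp add: nrm_w[OF that])
    show "(\<integral>z. f n z i \<partial>Q) = 0" if "1 \<le> n" "i < m n" for n i
    proof -
      have "vec_integral (m n) Q (w n) $ i = 0" using w_centered[OF that(1)] that(2) by simp
      then show ?thesis using that(2) by (simp add: vec_integral_def f_app)
    qed
    show "\<forall>\<^sub>F n in sequentially. integrable Q (\<lambda>z. nrm (m n) (f n z) ^ 4)"
      using w_fourth_int eventually_ge_at_top[of 1]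
    proof eventually_elim
      case (elim n)
      show ?case
        using elim(1) by (rule Bochner_Integration.integrable_cong[OF refl, THEN iffD1, rotated]) (simp add: nrm_w[OF elim(2)])
    qed
    show "\<forall>\<^sub>F n in sequentially. (\<integral>z. nrm (m n) (f n z) ^ 4 \<partial>Q) \<le> C * (real (m n))\<^sup>2"
      using C(2) eventually_ge_at_top[of 1]
    proof eventually_elim
      case (elim n)
      then show ?case using int4[OF elim(2)] by (simp add: abs_le_iff)
    qed
    show "little_op M (\<lambda>n \<omega>. (1 / real n) * (\<Sum>j=1..n. (nrm (m n) (\<lambda>i. v n j \<omega> i - f n (Z j \<omega>) i))\<^sup>2)) (\<lambda>n. 1 / real (m n))"
    proof (rule little_op_cong[OF _ w_hat_close])
      fix n :: nat and \<omega> assume n: "1 \<le> n" and \<omega>: "\<omega> \<in> space M"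
      have "vnorm (V n j \<omega> - w n (Z j \<omega>)) = nrm (m n) (\<lambda>i. v n j \<omega> i - f n (Z j \<omega>) i)" if j: "j \<in> {1..n}" for j
      proof -
        have c: "V n j \<omega> \<in> carrier_vec (m n)" "w n (Z j \<omega>) \<in> carrier_vec (m n)"
          using V_carr[OF n j \<omega>] wZ[OF n j \<omega>] by auto
        then have "vnorm (V n j \<omega> - w n (Z j \<omega>)) = nrm (m n) (\<lambda>i. (V n j \<omega> - w n (Z j \<omega>)) $ i)"
          by (intro vnorm_eq_nrm minus_carrier_vec)
        also have "\<dots> = nrm (m n) (\<lambda>i. v n j \<omega> i - f n (Z j \<omega>) i)"
          unfolding nrm_def using c by (intro arg_cong[of _ _ sqrt] ip_cong) (auto simp: v_app f_app)
        finally show ?thesis .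
      qed
      then show "1 / real n * (\<Sum>j=1..n. (vnorm (V n j \<omega> - w n (Z j \<omega>)))\<^sup>2)
          = 1 / real n * (\<Sum>j=1..n. (nrm (m n) (\<lambda>i. v n j \<omega> i - f n (Z j \<omega>) i))\<^sup>2)"
        by simp
    qed
  qed (use m_lim lam C(1) V_meas in \<open>auto simp: Wf_def\<close>)
  have R_eq: "R n \<omega> = elr (m n) n (\<lambda>j. v n j \<omega>)" if "1 \<le> n" "\<omega> \<in> space M" for n \<omega>
    unfolding R_def v_def V_def[symmetric]
    by (subst el_ratio_eq_elr) (use V_carr that in \<open>auto simp: V_def\<close>)
  have R_meas: "R n \<in> borel_measurable M" if "1 \<le> n" for n
    by (subst measurable_cong[OF R_eq[OF that]]) (auto intro!: elr_measurable V_meas that)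
  have R_log: "minus2_log (R n \<omega>) = ereal (- 2 * ln (R n \<omega>))" if "R n \<omega> \<noteq> 0" for n \<omega>
    using that by (simp add: minus2_log_def)
  have Vm: "vmean (m n) n (\<lambda>j. V n j \<omega>) \<in> carrier_vec (m n)" "i < m n \<Longrightarrow> vmean (m n) n (\<lambda>j. V n j \<omega>) $ i = E.xm n \<omega> i"
    if "1 \<le> n" "\<omega> \<in> space M" for n \<omega> i
    using vmean_carrier[of n "\<lambda>j. V n j \<omega>" "m n"] vmean_index[of n "\<lambda>j. V n j \<omega>" "m n" i] V_carr[OF that(1) _ that(2)]
    by (auto simp: E.xm_def v_app)
  show ?thesis
  proof (intro conjI impI)
    assume close: "little_op M
        (\<lambda>n \<omega>. vnorm (vmean (m n) n (\<lambda>j. V n j \<omega>) - vmean (m n) n (\<lambda>j. w n (Z j \<omega>))))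
        (\<lambda>n. real n powr (- 1 / 2))"
    have mean_close: "little_op M (\<lambda>n \<omega>. nrm (m n) (\<lambda>i. E.xm n \<omega> i - (E.wm n \<omega> i - 0))) (\<lambda>n. real n powr (- 1 / 2))"
    proof (rule little_op_cong[OF _ close])
      fix n :: nat and \<omega> assume n: "1 \<le> n" and \<omega>: "\<omega> \<in> space M"
      have c: "vmean (m n) n (\<lambda>j. w n (Z j \<omega>)) \<in> carrier_vec (m n)"
        by (rule vmean_carrier) (rule wZ[OF n _ \<omega>])
      have i: "vmean (m n) n (\<lambda>j. w n (Z j \<omega>)) $ i = E.wm n \<omega> i" if "i < m n" for i
        by (subst vmean_index) (use wZ[OF n _ \<omega>] that in \<open>auto simp: E.wm_def f_app\<close>)
      have "vnorm (vmean (m n) n (\<lambda>j. V n j \<omega>) - vmean (m n) n (\<lambda>j. w n (Z j \<omega>)))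
          = nrm (m n) (\<lambda>i. (vmean (m n) n (\<lambda>j. V n j \<omega>) - vmean (m n) n (\<lambda>j. w n (Z j \<omega>))) $ i)"
        by (intro vnorm_eq_nrm minus_carrier_vec Vm(1) n \<omega> c)
      also have "\<dots> = nrm (m n) (\<lambda>i. E.xm n \<omega> i - (E.wm n \<omega> i - 0))"
        unfolding nrm_def using Vm[OF n \<omega>] c i by (intro arg_cong[of _ _ sqrt] ip_cong) auto
      finally show "vnorm (vmean (m n) n (\<lambda>j. V n j \<omega>) - vmean (m n) n (\<lambda>j. w n (Z j \<omega>)))
          = nrm (m n) (\<lambda>i. E.xm n \<omega> i - (E.wm n \<omega> i - 0))" .
    qed
    \<comment> \<open>In part (i) there is no correction: \<open>y = 0\<close> meets all its bounds
      with constant 0 and empty exceptional events.\<close>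
    have zero: "nrm d (\<lambda>i. 0) \<le> 0 / a" "\<bar>b * ip d (\<lambda>i. 0) u\<bar> \<le> 0 / a" "measure M {} \<le> 0 * a" "{} \<in> sets M"
      "(\<lambda>\<omega>::'a. 0::real) \<in> borel_measurable M" for d a b u
      by (simp_all add: nrm_def ip_def)
    obtain G b where Gb: "\<And>n. G n \<in> sets M" "(\<lambda>n. measure M (G n)) \<longlonglongrightarrow> 1" "b \<longlonglongrightarrow> (0::real)"
      "\<forall>\<^sub>F n in sequentially. \<forall>\<omega>\<in>G n. 0 < elr (m n) n (\<lambda>j. v n j \<omega>) \<and>
        \<bar>- 2 * ln (elr (m n) n (\<lambda>j. v n j \<omega>)) - real n * ip (m n) (E.wm n \<omega>) (mapp (m n) (E.P n) (E.wm n \<omega>))\<bar> \<le> b n * sqrt (real (m n))"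
    proof -
      note A = E.el_quadratic_form_approx[where y = "\<lambda>n \<omega> i. 0" and B = "\<lambda>e n. {}" and cy = 0 and by' = 0,
          OF zero(5) mean_close zero(4) zero(3) zero(1) zero(2) order_refl]
      from A show thesis by (elim exE conjE) (rule that, erule spec, assumption+)
    qed
    show "asymp_std_normal M (\<lambda>n \<omega>. (minus2_log (R n \<omega>) - ereal (real (m n))) / ereal (sqrt (2 * real (m n))))"
    proof (rule E.asymp_std_normal_minus2_log[OF R_eq Gb, of 0])
      fix n :: nat and \<omega> assume "1 \<le> n" "R n \<omega> \<noteq> 0" "0 < real (m n)"
      then show "(minus2_log (R n \<omega>) - ereal (real (m n))) / ereal (sqrt (2 * real (m n)))
          = ereal ((- 2 * ln (R n \<omega>) - real (m n) + 0) / sqrt (2 * (real (m n) - 0)))"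
        by (simp add: R_log)
    next
      fix n :: nat assume "1 \<le> n"
      then have [measurable]: "R n \<in> borel_measurable M" by (rule R_meas)
      show "(\<lambda>\<omega>. (minus2_log (R n \<omega>) - ereal (real (m n))) / ereal (sqrt (2 * real (m n)))) \<in> borel_measurable M"
        by measurable
    qed simp_all
  next
    assume "\<exists>\<psi> :: 'z \<Rightarrow> real vec.
         random_vec q Q \<psi> \<and>
         vec_integral q Q \<psi> = 0\<^sub>v q \<and>
         mat_integral q q Q (\<lambda>z. outer_prod (\<psi> z) (\<psi> z)) = 1\<^sub>m q \<and>
         (let A = (\<lambda>n. mat_integral (m n) q Q (\<lambda>z. outer_prod (w n z) (\<psi> z))) in
            little_op M
              (\<lambda>n \<omega>. vnorm (vmean (m n) n (\<lambda>j. V n j \<omega>)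
                              - vmean (m n) n (\<lambda>j. w n (Z j \<omega>) - A n *\<^sub>v \<psi> (Z j \<omega>))))
              (\<lambda>n. real n powr (- 1 / 2)) \<and>
            (\<lambda>n. mat_trace (transpose_mat (A n) * mat_inv (W n) * A n)) \<longlonglongrightarrow> real q)"
    then obtain \<psi> :: "'z \<Rightarrow> real vec" where psi: "random_vec q Q \<psi>" "vec_integral q Q \<psi> = 0\<^sub>v q"
        "mat_integral q q Q (\<lambda>z. outer_prod (\<psi> z) (\<psi> z)) = 1\<^sub>m q"
      and close: "little_op M
          (\<lambda>n \<omega>. vnorm (vmean (m n) n (\<lambda>j. V n j \<omega>)
             - vmean (m n) n (\<lambda>j. w n (Z j \<omega>) - mat_integral (m n) q Q (\<lambda>z. outer_prod (w n z) (\<psi> z)) *\<^sub>v \<psi> (Z j \<omega>))))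
          (\<lambda>n. real n powr (- 1 / 2))"
      by (auto simp: Let_def)
    define g where "g = (\<lambda>l z. \<psi> z $ l)"
    define A where "A = (\<lambda>n. mat_integral (m n) q Q (\<lambda>z. outer_prod (w n z) (\<psi> z)))"
    have psi_carr: "\<psi> z \<in> carrier_vec q" if "z \<in> space Q" for z using psi(1) that by (simp add: random_vec_def)
    have g_meas: "g l \<in> borel_measurable Q" if "l < q" for l
      using psi(1) that by (simp add: random_vec_def g_def)
    have g_mean: "(\<integral>z. g l z \<partial>Q) = 0" if "l < q" for l
    proof -
      have "vec_integral q Q \<psi> $ l = 0" using psi(2) that by simp
      then show ?thesis using that by (simp add: vec_integral_def g_def)
    qed
    have g_sq: "(\<integral>z. (g l z)\<^sup>2 \<partial>Q) = 1" if "l < q" for l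
    proof -
      have "(\<integral>z. (g l z)\<^sup>2 \<partial>Q) = (\<integral>z. outer_prod (\<psi> z) (\<psi> z) $$ (l, l) \<partial>Q)"
      proof (rule Bochner_Integration.integral_cong[OF refl])
        fix z assume "z \<in> space Q"
        then have "dim_vec (\<psi> z) = q" using psi_carr by auto
        then show "(g l z)\<^sup>2 = outer_prod (\<psi> z) (\<psi> z) $$ (l, l)"
          using that by (simp add: outer_prod_def g_def power2_eq_square)
      qed
      also have "\<dots> = mat_integral q q Q (\<lambda>z. outer_prod (\<psi> z) (\<psi> z)) $$ (l, l)"
        using that by (simp add: mat_integral_def)
      also have "\<dots> = 1" using that by (simp add: psi(3))
      finally show ?thesis .
    qed
    \<comment> \<open>The Bochner integral of a function that is not integrable is 0 by convention,
      so the value 1 forces integrability.\<close>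
    have g_int: "integrable Q (\<lambda>z. (g l z)\<^sup>2)" if "l < q" for l
      using g_sq[OF that] not_integrable_integral_eq[of Q "\<lambda>z. (g l z)\<^sup>2"] by auto
    note corr = g_meas g_int g_sq g_mean
    have A_index: "A n $$ (i, l) = E.coef g n l i" if "1 \<le> n" "i < m n" "l < q" for n i l
    proof -
      have "A n $$ (i, l) = (\<integral>z. outer_prod (w n z) (\<psi> z) $$ (i, l) \<partial>Q)"
        using that by (simp add: A_def mat_integral_def)
      also have "\<dots> = (\<integral>z. f n z i * g l z \<partial>Q)"
      proof (rule Bochner_Integration.integral_cong[OF refl])
        fix z assume "z \<in> space Q"
        then have "dim_vec (w n z) = m n" "dim_vec (\<psi> z) = q" using w_carr[OF that(1)] psi_carr by auto
        then show "outer_prod (w n z) (\<psi> z) $$ (i, l) = f n z i * g l z"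
          using that by (simp add: outer_prod_def f_app g_def)
      qed
      finally show ?thesis by (simp add: E.coef_def[OF corr])
    qed
    have A_carr: "A n \<in> carrier_mat (m n) q" for n by (simp add: A_def mat_integral_def)
    have mean_close: "little_op M (\<lambda>n \<omega>. nrm (m n) (\<lambda>i. E.xm n \<omega> i - (E.wm n \<omega> i - E.corr q g n \<omega> i))) (\<lambda>n. real n powr (- 1 / 2))"
    proof (rule little_op_cong[OF _ close])
      fix n :: nat and \<omega> assume n: "1 \<le> n" and \<omega>: "\<omega> \<in> space M"
      let ?u = "\<lambda>j. w n (Z j \<omega>) - A n *\<^sub>v \<psi> (Z j \<omega>)"
      have psiZ: "\<psi> (Z j \<omega>) \<in> carrier_vec q" if "j \<in> {1..n}" for j
        by (rule psi_carr[OF Z_space[OF _ \<omega>]]) (use that in auto)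
      have ApZ: "A n *\<^sub>v \<psi> (Z j \<omega>) \<in> carrier_vec (m n)" if "j \<in> {1..n}" for j
        by (rule mult_mat_vec_carrier[OF A_carr psiZ[OF that]])
      have u: "?u j \<in> carrier_vec (m n)" if "j \<in> {1..n}" for j
        by (rule minus_carrier_vec[OF wZ[OF n that \<omega>] ApZ[OF that]])
      have c: "vmean (m n) n ?u \<in> carrier_vec (m n)" by (rule vmean_carrier[OF u])
      have i: "vmean (m n) n ?u $ i = E.wm n \<omega> i - E.corr q g n \<omega> i" if i: "i < m n" for i
      proof -
        have uj: "?u j $ i = f n (Z j \<omega>) i - (\<Sum>l<q. E.coef g n l i * g l (Z j \<omega>))" if j: "j \<in> {1..n}" for j
        proof -
          have "(A n *\<^sub>v \<psi> (Z j \<omega>)) $ i = (\<Sum>l<q. A n $$ (i, l) * \<psi> (Z j \<omega>) $ l)"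
            using A_carr[of n] psiZ[OF j] i by (auto simp: scalar_prod_def atLeast0LessThan)
          also have "\<dots> = (\<Sum>l<q. E.coef g n l i * g l (Z j \<omega>))"
            by (intro sum.cong refl) (simp add: A_index[OF n i] g_def)
          finally show ?thesis using carrier_matD(1)[OF A_carr[of n]] i by (simp add: f_app)
        qed
        have "vmean (m n) n ?u $ i = (\<Sum>j=1..n. f n (Z j \<omega>) i - (\<Sum>l<q. E.coef g n l i * g l (Z j \<omega>))) / real n"
          by (subst vmean_index[OF u i]) (simp_all add: uj)
        also have "\<dots> = E.wm n \<omega> i - (\<Sum>j=1..n. \<Sum>l<q. E.coef g n l i * g l (Z j \<omega>)) / real n"
          by (simp add: sum_subtractf diff_divide_distrib E.wm_def)
        also have "(\<Sum>j=1..n. \<Sum>l<q. E.coef g n l i * g l (Z j \<omega>)) = (\<Sum>l<q. E.coef g n l i * (\<Sum>j=1..n. g l (Z j \<omega>)))"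
          by (subst sum.swap) (simp add: sum_distrib_left)
        finally show ?thesis by (simp add: E.corr_def[OF corr])
      qed
      have "vnorm (vmean (m n) n (\<lambda>j. V n j \<omega>) - vmean (m n) n ?u)
          = nrm (m n) (\<lambda>i. (vmean (m n) n (\<lambda>j. V n j \<omega>) - vmean (m n) n ?u) $ i)"
        by (intro vnorm_eq_nrm minus_carrier_vec Vm(1) n \<omega> c)
      also have "\<dots> = nrm (m n) (\<lambda>i. E.xm n \<omega> i - (E.wm n \<omega> i - E.corr q g n \<omega> i))"
        unfolding nrm_def using Vm[OF n \<omega>] c i by (intro arg_cong[of _ _ sqrt] ip_cong) auto
      finally show "vnorm (vmean (m n) n (\<lambda>j. V n j \<omega>) - vmean (m n) n (\<lambda>j. w n (Z j \<omega>) - mat_integral (m n) q Q (\<lambda>z. outer_prod (w n z) (\<psi> z)) *\<^sub>v \<psi> (Z j \<omega>)))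
          = nrm (m n) (\<lambda>i. E.xm n \<omega> i - (E.wm n \<omega> i - E.corr q g n \<omega> i))"
        unfolding A_def .
    qed
    obtain G b where Gb: "\<And>n. G n \<in> sets M" "(\<lambda>n. measure M (G n)) \<longlonglongrightarrow> 1" "b \<longlonglongrightarrow> (0::real)"
      "\<forall>\<^sub>F n in sequentially. \<forall>\<omega>\<in>G n. 0 < elr (m n) n (\<lambda>j. v n j \<omega>) \<and>
        \<bar>- 2 * ln (elr (m n) n (\<lambda>j. v n j \<omega>)) - real n * ip (m n) (E.wm n \<omega>) (mapp (m n) (E.P n) (E.wm n \<omega>))\<bar> \<le> b n * sqrt (real (m n))"
    proof -
      have "\<exists>G b. (\<forall>n. G n \<in> sets M) \<and> (\<lambda>n. measure M (G n)) \<longlonglongrightarrow> 1 \<and> b \<longlonglongrightarrow> (0::real) \<and>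
        (\<forall>\<^sub>F n in sequentially. \<forall>\<omega>\<in>G n. 0 < elr (m n) n (\<lambda>j. v n j \<omega>) \<and>
          \<bar>- 2 * ln (elr (m n) n (\<lambda>j. v n j \<omega>)) - real n * ip (m n) (E.wm n \<omega>) (mapp (m n) (E.P n) (E.wm n \<omega>))\<bar> \<le> b n * sqrt (real (m n)))"
        by (rule E.el_corrected_approx[OF corr mean_close])
      then show thesis by (elim exE conjE) (rule that, erule spec, assumption+)
    qed
    show "asymp_std_normal M (\<lambda>n \<omega>. (minus2_log (R n \<omega>) - ereal (real (m n)) + ereal (real q)) / ereal (sqrt (2 * (real (m n) - real q))))"
    \<comment> \<open>Where \<open>m n \<le> q\<close> the normalisation degenerates. Such
      \<open>n\<close> are finitely many, and for them only measurability is asked.\<close>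
    proof (rule E.asymp_std_normal_minus2_log[OF R_eq Gb, of "real q"])
      fix n :: nat and \<omega> assume "1 \<le> n" "R n \<omega> \<noteq> 0" "real q < real (m n)"
      then show "(minus2_log (R n \<omega>) - ereal (real (m n)) + ereal (real q)) / ereal (sqrt (2 * (real (m n) - real q)))
          = ereal ((- 2 * ln (R n \<omega>) - real (m n) + real q) / sqrt (2 * (real (m n) - real q)))"
        by (simp add: R_log)
    next
      fix n :: nat assume "1 \<le> n"
      then have [measurable]: "R n \<in> borel_measurable M" by (rule R_meas)
      show "(\<lambda>\<omega>. (minus2_log (R n \<omega>) - ereal (real (m n)) + ereal (real q)) / ereal (sqrt (2 * (real (m n) - real q)))) \<in> borel_measurable M"
        by measurable
    qed simp_all
  qed
qed

end
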